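(* In the setting below: (1) The $p$-elementary divisors of the restriction of $\mu_L$ to $M_0$ are $0,1,1,p^t,p^t$. (2) For $1\leq i\leq\frac{q-5}{4}$, consider the two lists $\{c(i,r),c(i+r,3r),c(i+2r,r),c(i+3r,3r)\}$ and $\{c(i,3r),c(i+r,r),c(i+2r,3r),c(i+3r,r)\}$, and let $C_i$ be the list that contains the smallest element. Then the four $p$-elementary divisors of the restriction of $\mu_L$ to $M_i$ are $p^c$ for $c$ in $C_i$.
   Context: Let $p$ be a prime with $p\equiv3\pmod4$, $t\geq1$, $q=p^{2t}$, $r=\frac{q-1}{4}$. Let $\xi$ be a primitive $(q-1)$-th root of unity in an algebraic closure of $\mathbb{Q}$, $\pi$ a prime ideal of $\mathbb{Z}[\xi]$ containing $p$, and $R=\mathbb{Z}[\xi]_\pi$, a discrete valuation ring with maximal ideal $pR$ and $R/pR\cong\mathbb{F}_q$. Let $\beta\in\mathbb{F}_q$ be the image of $\xi$ (a primitive element) and $T:\mathbb{F}_q^\times\to R^\times$ the Teichmüller character, $T(\beta^j)=\xi^j$. Let $C_0\le\mathbb{F}_q^\times$ be the subgroup of nonzero fourth powers and $S'=C_0\cup\beta C_0$; the Peisert graph $P^*(q)$ has vertex set $\mathbb{F}_q$, distinct $x,y$ adjacent iff $x-y\in S'$; its Laplacian is $L=\frac{q-1}{2}I-A$. Let $R^{\mathbb{F}_q}$ be the free $R$-module with basis $\{[x]:x\in\mathbb{F}_q\}$, with $\mu_L([x])=\frac{q-1}{2}[x]-\sum_{y:\,y-x\in S'}[y]$, and with $\mathbb{F}_q^\times$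 acting by $y\cdot[x]=[yx]$; $\mu_L$ commutes with the action of $C_0$. For $i$ an integer, let $M_i=\{m\in R^{\mathbb{F}_q}: y m=T^i(y)m\ \forall y\in C_0\}$; then $M_0$ (the $C_0$-fixed points) is free of rank $5$ with basis $\mathbf{1}=\sum_x[x]$, $[0]$, $e_r,e_{2r},e_{3r}$, and for $1\le i\le\frac{q-5}{4}$, $M_i$ is free of rank $4$ with basis $e_i,e_{i+r},e_{i+2r},e_{i+3r}$, where $e_j=\sum_{x\in\mathbb{F}_q^\times}T^j(x^{-1})[x]$; each $M_i$ is $\mu_L$-invariant. The $p$-elementary divisors of an $R$-linear map between finitely generated free $R$-modules are the diagonal entries (powers of $p$ up to units, or $0$) of its Smith normal form over $R$. For digit sums: for $j\not\equiv0\pmod{q-1}$, $s(j)$ is the sum of the base-$p$ digits of the representative of $j$ modulo $q-1$ in $\{1,\dots,q-2\}$ (written with $2t$ digits), and $c(i,j)=\frac{1}{p-1}(s(i)+s(j)-s(i+j))$. *)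

theory Defs
  imports "HOL-Algebra.Algebraic_Closure_Type" "HOL-Algebra.RingHom" "HOL-Library.FuncSet" "HOL-Library.Cardinality"
begin

section \<open>The coefficient ring\<close>

abbreviation subring_on :: "'a::comm_ring_1 set \<Rightarrow> 'a ring" where
  "subring_on A \<equiv> ring_of_type_algebra\<lparr>carrier := A\<rparr>"

definition int_adjoin :: "'k::field \<Rightarrow> 'k set" where
  "int_adjoin \<xi> = range (\<lambda>f :: int poly. poly (map_poly of_int f) \<xi>)"

definition localize_at :: "'k::field set \<Rightarrow> 'k set \<Rightarrow> 'k set" where
  "localize_at A P = {a / b | a b. a \<in> A \<and> b \<in> A \<and> b \<notin> P}"

text \<open>
  The identification of \<open>R/pR\<close> with the finite field \<open>'f\<close>, given as the induced reduction map
  \<open>R \<rightarrow> 'f\<close>; only the values of \<open>red\<close> on \<open>R\<close> matter.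
\<close>
definition reduction_map :: "'k::field set \<Rightarrow> 'k \<Rightarrow> ('k \<Rightarrow> 'f::field) \<Rightarrow> bool" where
  "reduction_map R \<rho> red \<longleftrightarrow>
     red \<in> ring_hom (subring_on R) ring_of_type_algebra \<and>
     red ` R = UNIV \<and>
     a_kernel (subring_on R) ring_of_type_algebra red = {\<rho> * a | a. a \<in> R}"

text \<open>The Teichmueller character, meant for nonzero arguments and \<open>\<beta>\<close> primitive.\<close>
definition teichmueller :: "'k::field \<Rightarrow> 'f::field \<Rightarrow> 'f \<Rightarrow> 'k" where
  "teichmueller \<xi> \<beta> x = (THE u. \<exists>j :: nat. x = \<beta> ^ j \<and> u = \<xi> ^ j)"


section \<open>Elementary divisors over a ring given by its carrier\<close>

text \<open>
  Elements of the free module over \<open>R\<close> with basis \<open>'f\<close> are functions \<open>m\<close> with values in \<open>R\<close>,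
  standing for the sum of the \<open>m x\<close> times \<open>[x]\<close>; submodules are sets of such functions.
\<close>
definition module_basis :: "'k::field set \<Rightarrow> ('f \<Rightarrow> 'k) set \<Rightarrow> ('f \<Rightarrow> 'k) list \<Rightarrow> bool" where
  "module_basis R M b \<longleftrightarrow>
     set b \<subseteq> M \<and>
     (\<forall>a \<in> {..<length b} \<rightarrow>\<^sub>E R. (\<lambda>z. \<Sum>k<length b. a k * (b ! k) z) \<in> M) \<and>
     (\<forall>m\<in>M. \<exists>!a. a \<in> {..<length b} \<rightarrow>\<^sub>E R \<and> m = (\<lambda>z. \<Sum>k<length b. a k * (b ! k) z))"

text \<open>
  With respect to suitable bases of \<open>M\<close> and \<open>N\<close>, the matrix of \<open>f\<close> is diagonal with
  diagonal \<open>d\<close>, each entry dividing the next one in \<open>R\<close>.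
\<close>
definition smith_normal_form ::
  "'k::field set \<Rightarrow> (('f \<Rightarrow> 'k) \<Rightarrow> ('f \<Rightarrow> 'k)) \<Rightarrow> ('f \<Rightarrow> 'k) set \<Rightarrow> ('f \<Rightarrow> 'k) set \<Rightarrow> 'k list \<Rightarrow> bool"
where
  "smith_normal_form R f M N d \<longleftrightarrow>
     f \<in> M \<rightarrow> N \<and> set d \<subseteq> R \<and>
     (\<forall>k. Suc k < length d \<longrightarrow> (\<exists>u\<in>R. d ! Suc k = u * d ! k)) \<and>
     (\<exists>b c. module_basis R M b \<and> module_basis R N c \<and>
        length d = min (length b) (length c) \<and>
        (\<forall>k<length b. f (b ! k) = (if k < length d then (\<lambda>z. d ! k * (c ! k) z) else (\<lambda>z. 0))))"

text \<open>
  The elementary divisors, with multiplicity, normalised to be exact powers of the prime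
  element \<open>\<rho>\<close>, or 0.
\<close>
definition has_elementary_divisors ::
  "'k::field set \<Rightarrow> 'k \<Rightarrow> (('f \<Rightarrow> 'k) \<Rightarrow> ('f \<Rightarrow> 'k)) \<Rightarrow> ('f \<Rightarrow> 'k) set \<Rightarrow> ('f \<Rightarrow> 'k) set
     \<Rightarrow> 'k multiset \<Rightarrow> bool"
where
  "has_elementary_divisors R \<rho> f M N D \<longleftrightarrow>
     (\<forall>x\<in>#D. x = 0 \<or> (\<exists>k :: nat. x = \<rho> ^ k)) \<and>
     (\<exists>d. mset d = D \<and> smith_normal_form R f M N d)"


section \<open>The Laplacian of the Peisert graph and the isotypic submodules\<close>

definition fourth_powers :: "'f::field set" where
  "fourth_powers = {y ^ 4 | y. y \<noteq> 0}"

definition peisert_set :: "'f::field \<Rightarrow> 'f set" where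
  "peisert_set \<beta> = fourth_powers \<union> (\<lambda>x. \<beta> * x) ` fourth_powers"

definition basis_elt :: "'f \<Rightarrow> 'f \<Rightarrow> 'k::field" where
  "basis_elt x = (\<lambda>z. if z = x then 1 else 0)"

definition lin_extend :: "('f::finite \<Rightarrow> 'f \<Rightarrow> 'k::field) \<Rightarrow> ('f \<Rightarrow> 'k) \<Rightarrow> ('f \<Rightarrow> 'k)" where
  "lin_extend g m = (\<lambda>z. \<Sum>x\<in>UNIV. m x * g x z)"

text \<open>
  In the Peisert graph distinct \<open>x\<close>, \<open>y\<close> are adjacent iff \<open>x - y\<close> lies in \<open>peisert_set \<beta>\<close>; it is
  regular of degree \<open>(q - 1) / 2\<close>, an integer as \<open>q\<close> is odd.
\<close>
definition mu_L :: "'f::finite_field \<Rightarrow> ('f \<Rightarrow> 'k::field) \<Rightarrow> ('f \<Rightarrow> 'k)" where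
  "mu_L \<beta> = lin_extend (\<lambda>x z. of_nat ((CARD('f) - 1) div 2) * basis_elt x z
                          - (\<Sum>y | y - x \<in> peisert_set \<beta>. basis_elt y z))"

definition act :: "'f::finite_field \<Rightarrow> ('f \<Rightarrow> 'k::field) \<Rightarrow> ('f \<Rightarrow> 'k)" where
  "act y = lin_extend (\<lambda>x. basis_elt (y * x))"

definition isotypic ::
  "'k::field set \<Rightarrow> 'k \<Rightarrow> 'f::finite_field \<Rightarrow> int \<Rightarrow> ('f \<Rightarrow> 'k) set"
where
  "isotypic R \<xi> \<beta> i =
     {m. range m \<subseteq> R \<and>
         (\<forall>y\<in>fourth_powers. act y m = (\<lambda>z. (teichmueller \<xi> \<beta> y powi i) * m z))}"


section \<open>Digit sums\<close>

text \<open>Used for \<open>j\<close> not divisible by \<open>p ^ (2 * t) - 1\<close> only.\<close>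
definition digit_sum :: "nat \<Rightarrow> nat \<Rightarrow> int \<Rightarrow> int" where
  "digit_sum p t j =
     (\<Sum>k<2 * t. (j mod (int p ^ (2 * t) - 1)) div int p ^ k mod int p)"

text \<open>The division is exact, since \<open>digit_sum p t j\<close> is congruent to \<open>j\<close> modulo \<open>p - 1\<close>.\<close>
definition carries :: "nat \<Rightarrow> nat \<Rightarrow> int \<Rightarrow> int \<Rightarrow> int" where
  "carries p t i j =
     (digit_sum p t i + digit_sum p t j - digit_sum p t (i + j)) div (int p - 1)"

end

theory Submission
  imports Defs
begin

text \<open>
  The additive convolution of two multiplicative characters of \<open>F\<close> is a third one, scaled by a
  Jacobi sum, up to a constant function. Associativity of convolution therefore makes the valuations
  \<open>V a b\<close> of Jacobi sums a 2-cocycle on \<open>\<int>/(q - 1)\<close>, which is a coboundary after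
  multiplication by \<open>q - 1\<close>, say \<open>(q - 1) V a b = F a + F b - F (a + b)\<close>. The function \<open>F\<close> is
  invariant under \<open>a \<mapsto> p a\<close>; reduction modulo \<open>p\<close> gives \<open>V a 1 = 0\<close> unless the last digit of
  \<open>a\<close> is \<open>p - 1\<close>, so \<open>F\<close> is a multiple of the digit sum; and \<open>F a + F (- a) = 2 t (q - 1)\<close> fixes
  the multiple. So \<open>V a b\<close> is the number of carries.

  The indicator function of the connection set is \<open>(1 - [0]) / 2 + h\<close> with \<open>h\<close> a combination of
  the two characters of order 4. Convolution \<open>E\<close> with \<open>h\<close> satisfies \<open>L = (2 E - 1) E\<close>, and
  \<open>2 E - 1\<close> is invertible over \<open>R\<close>, so \<open>L\<close> may be replaced by \<open>E\<close>. On each isotypic component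
  \<open>E\<close> splits into two 2-by-2 blocks of Jacobi sums, whose determinants have the valuation
  of either of their two terms; pivoting on an entry of least valuation diagonalizes them.
\<close>

section \<open>Elementary divisors over a discrete valuation ring\<close>

text \<open>Gauss sums would exhibit the cocycle as a coboundary at once, but they need
  \<open>p\<close>-th roots of unity, which do not lie in \<open>R\<close> and where
  \<open>p\<close> ramifies. Convolution alone keeps everything in \<open>R\<close>; the price is
  the factor \<open>q - 1\<close>, harmless because \<int> is torsion-free.

  \<open>residue_dvr\<close> does not assume that every nonzero element is a unit times a power of
  \<open>\<rho>\<close>. Valuations are therefore claimed only for divisors of elements that have
  one: each \<open>N a b\<close> divides \<open>N b (- b)\<close>, which is a unit or a unit times
  \<open>q\<close>.

  The factorization of \<open>L\<close> rests on \<open>E (E f) = q / 4 * f\<close> up to a constant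
  function: the coefficients of \<open>h\<close> have squares with sum 0, so the quadratic character
  drops out of \<open>conv h h\<close>.

  \<open>E\<close> shifts the index of a character by \<open>r\<close> or \<open>3 * r\<close>, so
  it exchanges even and odd multiples of \<open>r\<close>; hence the two blocks. Away from
  \<open>i = 0\<close> the composite \<open>E (E f)\<close> is exactly \<open>q / 4 * f\<close>, so
  each block is \<open>q / 4\<close> times the inverse of the other. That is why one smallest entry
  selects the pivots in both blocks.\<close>

definition lincomb :: "(nat \<Rightarrow> 'k::field) \<Rightarrow> ('v \<Rightarrow> 'k) list \<Rightarrow> 'v \<Rightarrow> 'k" where
  "lincomb a b = (\<lambda>z. \<Sum>k<length b. a k * (b ! k) z)"

definition linear_map :: "(('v \<Rightarrow> 'k::field) \<Rightarrow> ('w \<Rightarrow> 'k)) \<Rightarrow> bool" where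
  "linear_map f \<longleftrightarrow> (\<forall>x y. f (\<lambda>z. x z + y z) = (\<lambda>z. f x z + f y z)) \<and>
     (\<forall>s x. f (\<lambda>z. s * x z) = (\<lambda>z. s * f x z))"

lemma linear_map_add: "linear_map f \<Longrightarrow> f (\<lambda>z. x z + y z) = (\<lambda>z. f x z + f y z)"
  and linear_map_scale: "linear_map f \<Longrightarrow> f (\<lambda>z. s * x z) = (\<lambda>z. s * f x z)"
  by (auto simp: linear_map_def)

lemma linear_map_zero: "linear_map f \<Longrightarrow> f (\<lambda>z. 0) = (\<lambda>z. 0)"
  using linear_map_scale[of f 0 "\<lambda>z. 0"] by simp

lemma lincomb_Nil [simp]: "lincomb a [] = (\<lambda>z. 0)"
  by (simp add: lincomb_def)

lemma lincomb_Cons: "lincomb a (x # xs) = (\<lambda>z. a 0 * x z + lincomb (\<lambda>k. a (Suc k)) xs z)"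
  by (simp add: lincomb_def sum.lessThan_Suc_shift del: sum.lessThan_Suc)

lemma linear_map_lincomb: "linear_map f \<Longrightarrow> f (lincomb a b) = lincomb a (map f b)"
proof (induction b arbitrary: a)
  case (Cons x b)
  then show ?case
    using linear_map_add[of f "\<lambda>z. a 0 * x z" "lincomb (\<lambda>k. a (Suc k)) b"]
      linear_map_scale[of f "a 0" x] by (simp add: lincomb_Cons)
qed (simp add: linear_map_zero)

lemma lincomb_cong: "(\<And>k. k < length b \<Longrightarrow> a k = a' k) \<Longrightarrow> lincomb a b = lincomb a' b"
  by (simp add: lincomb_def)

lemma lincomb_permute_list:
  assumes "\<pi> permutes {..<length b}"
  shows "lincomb (a \<circ> \<pi>) (permute_list \<pi> b) = lincomb a b"
proof
  fix z
  have "lincomb (a \<circ> \<pi>) (permute_list \<pi> b) z = (\<Sum>k<length b. ((\<lambda>k. a k * (b ! k) z) \<circ> \<pi>) k)"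
    using assms by (simp add: lincomb_def permute_list_nth)
  also have "\<dots> = lincomb a b z"
    unfolding lincomb_def by (rule sum.permute[OF assms, symmetric])
  finally show "lincomb (a \<circ> \<pi>) (permute_list \<pi> b) z = lincomb a b z" .
qed

text \<open>The residue map is the primitive notion here, not a valuation: \<open>inverse_R\<close>
  says that \<open>R\<close> is local, \<open>red_eq_0\<close> that its maximal ideal is generated
  by \<open>\<rho>\<close>. Nothing is known of \<open>red\<close> outside \<open>R\<close>, hence
  the membership premises.\<close>

locale residue_dvr =
  fixes R :: "'k::field set" and red :: "'k \<Rightarrow> 'f::field" and \<rho> :: 'k
  assumes one_R [simp]: "1 \<in> R"
    and add_R [simp]: "x \<in> R \<Longrightarrow> y \<in> R \<Longrightarrow> x + y \<in> R"
    and uminus_R [simp]: "x \<in> R \<Longrightarrow> - x \<in> R"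
    and mult_R [simp]: "x \<in> R \<Longrightarrow> y \<in> R \<Longrightarrow> x * y \<in> R"
    and red_add [simp]: "x \<in> R \<Longrightarrow> y \<in> R \<Longrightarrow> red (x + y) = red x + red y"
    and red_mult [simp]: "x \<in> R \<Longrightarrow> y \<in> R \<Longrightarrow> red (x * y) = red x * red y"
    and red_1 [simp]: "red 1 = 1"
    and red_eq_0: "x \<in> R \<Longrightarrow> red x = 0 \<longleftrightarrow> (\<exists>a\<in>R. x = \<rho> * a)"
    and inverse_R: "x \<in> R \<Longrightarrow> red x \<noteq> 0 \<Longrightarrow> inverse x \<in> R"
    and rho_R [simp]: "\<rho> \<in> R" and rho_nz [simp]: "\<rho> \<noteq> 0"
begin

lemma zero_R [simp]: "0 \<in> R"
  using add_R[OF one_R uminus_R[OF one_R]] by simp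

lemma diff_R [simp]: "x \<in> R \<Longrightarrow> y \<in> R \<Longrightarrow> x - y \<in> R"
  using add_R[of x "- y"] by simp

lemma sum_R: "(\<And>x. x \<in> A \<Longrightarrow> g x \<in> R) \<Longrightarrow> sum g A \<in> R"
  by (induction A rule: infinite_finite_induct) auto

lemma power_R [simp]: "x \<in> R \<Longrightarrow> x ^ n \<in> R"
  by (induction n) auto

lemma of_nat_R [simp]: "of_nat n \<in> R"
  by (induction n) auto

lemma numeral_R [simp]: "numeral n \<in> R"
  using of_nat_R[of "numeral n"] by simp

lemma red_0 [simp]: "red 0 = 0"
  using red_add[of 0 0] by (simp only: zero_R add_0_right add_cancel_right_right simp_thms)

lemma red_uminus [simp]: "x \<in> R \<Longrightarrow> red (- x) = - red x"
  using red_add[of x "- x"] by (simp add: eq_neg_iff_add_eq_0 add.commute)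

lemma red_diff [simp]: "x \<in> R \<Longrightarrow> y \<in> R \<Longrightarrow> red (x - y) = red x - red y"
  using red_add[of x "- y"] by simp

lemma red_sum: "(\<And>x. x \<in> A \<Longrightarrow> g x \<in> R) \<Longrightarrow> red (sum g A) = (\<Sum>x\<in>A. red (g x))"
  by (induction A rule: infinite_finite_induct) (auto simp: sum_R)

lemma red_power [simp]: "x \<in> R \<Longrightarrow> red (x ^ n) = red x ^ n"
  by (induction n) auto

lemma red_of_nat [simp]: "red (of_nat n) = of_nat n"
  by (induction n) auto

lemma red_rho [simp]: "red \<rho> = 0"
  using red_eq_0[of \<rho>] by (metis mult.right_neutral one_R rho_R)

section \<open>Units and valuations\<close>

definition R_unit :: "'k \<Rightarrow> bool" where
  "R_unit u \<longleftrightarrow> u \<in> R \<and> red u \<noteq> 0"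

lemma R_unit_R: "R_unit u \<Longrightarrow> u \<in> R"
  by (simp add: R_unit_def)

lemma R_unit_nz: "R_unit u \<Longrightarrow> u \<noteq> 0"
  by (auto simp: R_unit_def)

lemma R_unit_mult: "R_unit u \<Longrightarrow> R_unit v \<Longrightarrow> R_unit (u * v)"
  by (auto simp: R_unit_def)

lemma R_unit_1: "R_unit 1"
  by (simp add: R_unit_def)

lemma R_unit_uminus: "R_unit u \<Longrightarrow> R_unit (- u)"
  by (simp add: R_unit_def)

lemma R_unit_inverse:
  assumes "R_unit u" shows "R_unit (inverse u)"
proof -
  have "red u * red (inverse u) = 1"
    using red_mult[of u "inverse u"] assms R_unit_nz[OF assms]
    by (simp add: R_unit_def inverse_R)
  then show ?thesis
    using assms by (auto simp: R_unit_def inverse_R)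
qed

lemma R_unit_divide: "R_unit u \<Longrightarrow> R_unit v \<Longrightarrow> R_unit (u / v)"
  by (simp add: divide_inverse R_unit_mult R_unit_inverse)

lemma R_unitI: "u \<in> R \<Longrightarrow> v \<in> R \<Longrightarrow> u * v = 1 \<Longrightarrow> R_unit u"
  using red_mult[of u v] by (auto simp: R_unit_def)

text \<open>A relation, because 0 has no valuation and the existence of one has to be proved for
  each element in question.\<close>

definition has_val :: "'k \<Rightarrow> nat \<Rightarrow> bool" where
  "has_val x k \<longleftrightarrow> (\<exists>u. R_unit u \<and> x = u * \<rho> ^ k)"

lemma has_val_unit: "R_unit u \<Longrightarrow> has_val u 0"
  by (auto simp: has_val_def)

lemma has_val_rho: "has_val (\<rho> ^ k) k"
  using R_unit_1 by (auto simp: has_val_def)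

lemma has_val_mult: "has_val x k \<Longrightarrow> has_val y l \<Longrightarrow> has_val (x * y) (k + l)"
  unfolding has_val_def by (metis R_unit_mult mult.assoc mult.left_commute power_add)

lemma has_val_unit_mult: "R_unit u \<Longrightarrow> has_val x k \<Longrightarrow> has_val (u * x) k"
  using has_val_mult[OF has_val_unit] by force

lemma has_val_nz: "has_val x k \<Longrightarrow> x \<noteq> 0"
  by (auto simp: has_val_def R_unit_nz)

lemma has_val_divide_R:
  assumes "has_val x k" "has_val y l" "l \<le> k"
  shows "x / y \<in> R"
proof -
  obtain u v where *: "R_unit u" "x = u * \<rho> ^ k" "R_unit v" "y = v * \<rho> ^ l"
    using assms by (auto simp: has_val_def)
  have "x / y = u / v * \<rho> ^ (k - l)"
    using * assms(3) R_unit_nz[OF *(3)] by (simp add: power_diff)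
  then show ?thesis
    using mult_R[OF R_unit_R[OF R_unit_divide[OF *(1,3)]] power_R[OF rho_R]] by metis
qed

lemma has_val_divide_unit:
  assumes "has_val x k" "has_val y k"
  shows "R_unit (x / y)"
proof -
  obtain u v where *: "R_unit u" "x = u * \<rho> ^ k" "R_unit v" "y = v * \<rho> ^ k"
    using assms by (auto simp: has_val_def)
  then have "x / y = u / v"
    by simp
  then show ?thesis
    using R_unit_divide[OF *(1,3)] by simp
qed

text \<open>Two different exponents would put \<open>inverse \<rho>\<close> into \<open>R\<close>,
  although \<open>red \<rho> = 0\<close>.\<close>

lemma has_val_unique:
  assumes "has_val x k" "has_val x l" shows "k = l"
proof -
  have False if *: "has_val x k" "has_val x l" "k < l" for k l
  proof -
    have "x / (x * \<rho>) \<in> R"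
      using has_val_divide_R[OF *(2), of "x * \<rho>" "k + 1"] has_val_mult[OF *(1) has_val_rho[of 1]] *
      by simp
    then have "inverse \<rho> \<in> R"
      using has_val_nz[OF *(1)] by (simp add: field_simps)
    then show False
      using red_mult[of \<rho> "inverse \<rho>"] by simp
  qed
  then show ?thesis
    using assms by (metis linorder_neqE_nat)
qed

text \<open>Either \<open>x\<close> is a unit or a factor \<open>\<rho>\<close> can be split off,
  which uses up one of the \<open>m\<close> factors in the product. The exponent \<open>m\<close>
  thus bounds the divisibility of \<open>x\<close>.\<close>

lemma has_val_factor:
  assumes "x \<in> R" "y \<in> R" "has_val (x * y) m"
  shows "\<exists>k. has_val x k"
  using assms
proof (induction m arbitrary: x)
  case (0 x)
  then have "R_unit (x * y)"
    by (auto simp: has_val_def)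
  then have "R_unit x"
    using 0 by (auto simp: R_unit_def)
  then show ?case
    using has_val_unit by blast
next
  case (Suc m x)
  show ?case
  proof (cases "red x = 0")
    case False
    then show ?thesis
      using Suc.prems has_val_unit by (auto simp: R_unit_def)
  next
    case True
    then obtain x' where x': "x' \<in> R" "x = \<rho> * x'"
      using red_eq_0 Suc.prems by blast
    have "has_val (x' * y) m"
      using Suc.prems(3) unfolding has_val_def x' by (force simp: algebra_simps)
    then obtain k where "has_val x' k"
      using Suc.IH[OF x'(1) Suc.prems(2)] by blast
    then have "has_val x (k + 1)"
      using has_val_mult[of x' k \<rho> 1] has_val_rho[of 1] x' by (simp add: mult.commute)
    then show ?thesis ..
  qed
qed

text \<open>In \<open>module_basis\<close> the coefficient functions are extensional so that
  uniqueness makes sense. Here they are arbitrary outside the index range, and uniqueness becomes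
  linear independence.\<close>

lemma module_basis_alt:
  "module_basis R M b \<longleftrightarrow>
     (\<forall>a. (\<forall>k<length b. a k \<in> R) \<longrightarrow> lincomb a b \<in> M) \<and>
     (\<forall>m\<in>M. \<exists>a. (\<forall>k<length b. a k \<in> R) \<and> m = lincomb a b) \<and>
     (\<forall>a. (\<forall>k<length b. a k \<in> R) \<longrightarrow> lincomb a b = (\<lambda>z. 0) \<longrightarrow> (\<forall>k<length b. a k = 0))"
    (is "?L \<longleftrightarrow> ?A \<and> ?B \<and> ?C")
proof -
  have basis: "(\<lambda>z. \<Sum>k<length b. a k * (b ! k) z) = lincomb a b" for a
    by (simp add: lincomb_def)
  have restr: "lincomb (restrict a {..<length b}) b = lincomb a b" for a
    by (rule lincomb_cong) simp
  have A: "(\<forall>a \<in> {..<length b} \<rightarrow>\<^sub>E R. lincomb a b \<in> M) \<longleftrightarrow> ?A"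
  proof (intro iffI allI impI ballI)
    fix a assume "\<forall>a\<in>{..<length b} \<rightarrow>\<^sub>E R. lincomb a b \<in> M" "\<forall>k<length b. a k \<in> R"
    moreover from this have "restrict a {..<length b} \<in> {..<length b} \<rightarrow>\<^sub>E R"
      by auto
    ultimately show "lincomb a b \<in> M"
      using restr by metis
  qed (auto simp: PiE_def Pi_def)
  have diff: "lincomb (\<lambda>k. a k - a' k) b = (\<lambda>z. lincomb a b z - lincomb a' b z)" for a a'
    by (simp add: lincomb_def sum_subtractf left_diff_distrib)
  have zero: "lincomb (\<lambda>k. 0) b = (\<lambda>z. 0)"
    by (simp add: lincomb_def)
  have sub: "set b \<subseteq> M" if ?A
  proof
    fix x assume "x \<in> set b"
    then obtain k where k: "k < length b" "x = b ! k"
      by (auto simp: in_set_conv_nth)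
    then have "lincomb (\<lambda>j. if j = k then 1 else 0) b = x"
      by (auto simp: lincomb_def if_distrib[of "\<lambda>y. y * _"] cong: if_cong)
    then show "x \<in> M"
      using that by force
  qed
  show ?thesis
  proof (intro iffI conjI)
    assume L: ?L
    then show a: ?A
      using A by (simp add: module_basis_def basis)
    show ?B
      using L unfolding module_basis_def basis by (meson PiE_mem lessThan_iff)
    show ?C
    proof (intro allI impI)
      fix a k assume *: "\<forall>k<length b. a k \<in> R" "lincomb a b = (\<lambda>z. 0)" "k < length b"
      have m0: "(\<lambda>z. 0) \<in> M"
        using a *(1,2) by metis
      have "\<exists>!a. a \<in> {..<length b} \<rightarrow>\<^sub>E R \<and> (\<lambda>z. 0) = lincomb a b"
        using L m0 unfolding module_basis_def basis by blast
      moreover have "restrict a {..<length b} \<in> {..<length b} \<rightarrow>\<^sub>E R"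
        "lincomb (restrict a {..<length b}) b = (\<lambda>z. 0)"
        using * restr by auto
      moreover have "restrict (\<lambda>k. 0) {..<length b} \<in> {..<length b} \<rightarrow>\<^sub>E R"
        "lincomb (restrict (\<lambda>k. 0) {..<length b}) b = (\<lambda>z. 0)"
        using restr[of "\<lambda>k. 0"] zero by auto
      ultimately have "restrict a {..<length b} = restrict (\<lambda>k. 0) {..<length b}"
        by metis
      then show "a k = 0"
        using *(3) by (metis lessThan_iff restrict_apply')
    qed
  next
    assume ABC: "?A \<and> ?B \<and> ?C"
    show ?L
      unfolding module_basis_def basis
    proof (intro conjI ballI)
      fix m assume "m \<in> M"
      then obtain a where a: "\<forall>k<length b. a k \<in> R" "m = lincomb a b"
        using ABC by blast
      show "\<exists>!a. a \<in> {..<length b} \<rightarrow>\<^sub>E R \<and> m = lincomb a b"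
      proof (rule ex1I[of _ "restrict a {..<length b}"])
        fix a' assume a': "a' \<in> {..<length b} \<rightarrow>\<^sub>E R \<and> m = lincomb a' b"
        then have "lincomb (\<lambda>k. a' k - a k) b = (\<lambda>z. 0)"
          using diff[of a' a] a by (metis diff_self)
        moreover have "\<forall>k<length b. a' k - a k \<in> R"
          using a a' by (auto simp: PiE_def Pi_def)
        ultimately have "a' k - a k = 0" if "k < length b" for k
          using ABC that by (auto dest!: spec[of _ "\<lambda>k. a' k - a k"])
        then show "a' = restrict a {..<length b}"
          using a' by (auto simp: PiE_def extensional_def restrict_def fun_eq_iff)
      qed (use a restr in auto)
    qed (use ABC sub A in auto)
  qed
qed

lemma lincomb_mem: "module_basis R M b \<Longrightarrow> (\<And>k. k < length b \<Longrightarrow> a k \<in> R) \<Longrightarrow> lincomb a b \<in> M"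
  unfolding module_basis_alt by blast

text \<open>Allows every basis change below to be done on the first two vectors, after a
  permutation.\<close>

lemma module_basis_mset_cong:
  assumes "module_basis R M b" "mset b' = mset b"
  shows "module_basis R M b'"
proof -
  obtain \<pi> where \<pi>: "\<pi> permutes {..<length b}" "permute_list \<pi> b = b'"
    using mset_eq_permutation[OF assms(2)] by blast
  have len: "length b' = length b"
    using \<pi> by auto
  have fwd: "lincomb (a \<circ> \<pi>) b' = lincomb a b" for a
    using lincomb_permute_list[OF \<pi>(1)] \<pi>(2) by metis
  have bwd: "lincomb a b' = lincomb (a \<circ> inv_into UNIV \<pi>) b" for a
    using fwd[of "a \<circ> inv_into UNIV \<pi>"] permutes_inv_o(2)[OF \<pi>(1)] by (simp add: comp_assoc)
  have p: "\<pi> k < length b \<longleftrightarrow> k < length b" "inv_into UNIV \<pi> k < length b \<longleftrightarrow> k < length b" for k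
    using permutes_in_image[OF \<pi>(1)] permutes_in_image[OF permutes_inv[OF \<pi>(1)]] by auto
  show ?thesis
    unfolding module_basis_alt len
  proof (intro conjI allI impI ballI)
    fix a assume "\<forall>k<length b. a k \<in> R"
    then show "lincomb a b' \<in> M"
      unfolding bwd using p by (intro lincomb_mem[OF assms(1)]) auto
  next
    fix m assume "m \<in> M"
    then obtain a where "\<forall>k<length b. a k \<in> R" "m = lincomb a b"
      using assms(1) unfolding module_basis_alt by blast
    then show "\<exists>a. (\<forall>k<length b. a k \<in> R) \<and> m = lincomb a b'"
      using p by (intro exI[of _ "a \<circ> \<pi>"]) (auto simp: fwd)
  next
    fix a k assume *: "\<forall>k<length b. a k \<in> R" "lincomb a b' = (\<lambda>z. 0)" "k < length b"
    have indep: "(\<forall>k<length b. c k \<in> R) \<longrightarrow> lincomb c b = (\<lambda>z. 0) \<longrightarrow> (\<forall>k<length b. c k = 0)" for c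
      using assms(1) unfolding module_basis_alt by blast
    have "(a \<circ> inv_into UNIV \<pi>) (\<pi> k) = 0"
      using indep[of "a \<circ> inv_into UNIV \<pi>"] * p unfolding bwd by simp
    then show "a k = 0"
      by (simp add: permutes_inverses(2)[OF \<pi>(1)])
  qed
qed

lemma module_basis_modify_head:
  assumes "module_basis R M (x # y # xs)" "R_unit u" "r \<in> R"
  shows "module_basis R M ((\<lambda>z. u * x z + r * y z) # y # xs)"
proof -
  let ?b = "x # y # xs" and ?b' = "(\<lambda>z. u * x z + r * y z) # y # xs"
  \<comment> \<open>\<open>\<phi>\<close> turns coordinates for the new basis into coordinates for
    the old one; \<open>\<psi>\<close> is its inverse, and both preserve integrality.\<close>
  define \<phi> where "\<phi> = (\<lambda>a k. if k = 0 then a 0 * u else if k = 1 then a 1 + a 0 * r else a (k::nat))"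
  define \<psi> where "\<psi> = (\<lambda>a k. if k = 0 then a 0 / u else if k = 1 then a 1 - a 0 / u * r else a (k::nat))"
  have unz: "u \<noteq> 0" and uR: "u \<in> R"
    using assms R_unit_nz R_unit_R by auto
  have divR: "c / u \<in> R" if "c \<in> R" for c
    using that assms(2) by (simp add: divide_inverse inverse_R R_unit_def)
  have fwd: "lincomb a ?b' = lincomb (\<phi> a) ?b" for a
    by (simp add: lincomb_Cons \<phi>_def algebra_simps)
  have phi_psi: "\<phi> (\<psi> a) = a" for a
    using unz by (auto simp: \<phi>_def \<psi>_def fun_eq_iff)
  have \<phi>R: "\<forall>k<length ?b. \<phi> a k \<in> R" if "\<forall>k<length ?b. a k \<in> R" for a
    using that uR assms(3) by (auto simp: \<phi>_def)
  have \<psi>R: "\<forall>k<length ?b. \<psi> a k \<in> R" if "\<forall>k<length ?b. a k \<in> R" for a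
    using that divR assms(3) by (auto simp: \<psi>_def)
  have len: "length ?b' = length ?b"
    by simp
  show ?thesis
    unfolding module_basis_alt len
  proof (intro conjI allI impI ballI)
    fix a assume "\<forall>k<length ?b. a k \<in> R"
    then show "lincomb a ?b' \<in> M"
      unfolding fwd using \<phi>R lincomb_mem[OF assms(1)] by blast
  next
    fix m assume "m \<in> M"
    then obtain a where "\<forall>k<length ?b. a k \<in> R" "m = lincomb a ?b"
      using assms(1) unfolding module_basis_alt by blast
    then show "\<exists>a. (\<forall>k<length ?b. a k \<in> R) \<and> m = lincomb a ?b'"
      using \<psi>R by (intro exI[of _ "\<psi> a"]) (simp only: fwd phi_psi, blast)
  next
    fix a k assume *: "\<forall>k<length ?b. a k \<in> R" "lincomb a ?b' = (\<lambda>z. 0)" "k < length ?b"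
    then have 0: "\<forall>k<length ?b. \<phi> a k = 0"
      using assms(1) \<phi>R[OF *(1)] unfolding fwd module_basis_alt by blast
    have "a 0 = 0"
      using 0 unz by (force simp: \<phi>_def)
    moreover have "a 1 = 0"
      using 0[rule_format, of 1] calculation by (simp add: \<phi>_def)
    ultimately show "a k = 0"
      using 0 *(3) by (cases "k = 0"; cases "k = 1") (auto simp: \<phi>_def)
  qed
qed

lemma module_basis_scale_head:
  assumes "module_basis R M (x # y # xs)" "R_unit u"
  shows "module_basis R M ((\<lambda>z. u * x z) # y # xs)"
  using module_basis_modify_head[OF assms zero_R] by simp

lemma module_basis_image:
  assumes "module_basis R M b" "linear_map U" "\<And>m. m \<in> M \<Longrightarrow> U m \<in> M"
    and "\<And>m. m \<in> M \<Longrightarrow> V m \<in> M" "\<And>m. m \<in> M \<Longrightarrow> U (V m) = m" "\<And>m. m \<in> M \<Longrightarrow> V (U m) = m"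
  shows "module_basis R M (map U b)"
  unfolding module_basis_alt length_map
proof (intro conjI allI impI ballI)
  fix a assume "\<forall>k<length b. a k \<in> R"
  then show "lincomb a (map U b) \<in> M"
    using assms(3)[OF lincomb_mem[OF assms(1)]] linear_map_lincomb[OF assms(2)] by metis
next
  fix m assume m: "m \<in> M"
  then obtain a where "\<forall>k<length b. a k \<in> R" "V m = lincomb a b"
    using assms(1,4) unfolding module_basis_alt by blast
  then show "\<exists>a. (\<forall>k<length b. a k \<in> R) \<and> m = lincomb a (map U b)"
    using assms(5)[OF m] linear_map_lincomb[OF assms(2)] by metis
next
  fix a k assume *: "\<forall>k<length b. a k \<in> R" "lincomb a (map U b) = (\<lambda>z. 0)" "k < length b"
  have m: "lincomb a b \<in> M"
    using lincomb_mem[OF assms(1)] * by blast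
  have "lincomb (\<lambda>k. 0) b \<in> M"
    using lincomb_mem[OF assms(1)] by simp
  then have z: "(\<lambda>z. 0) \<in> M"
    by (simp add: lincomb_def)
  have "U (lincomb a b) = U (\<lambda>z. 0)"
    using * linear_map_lincomb[OF assms(2)] linear_map_zero[OF assms(2)] by metis
  then have "lincomb a b = (\<lambda>z. 0)"
    using assms(6) m z by metis
  then show "a k = 0"
    using assms(1) * unfolding module_basis_alt by blast
qed

text \<open>Made for character orthogonality: \<open>w k\<close> will be an inverse character
  divided by \<open>q - 1\<close>, or evaluation at 0, and the pairing with \<open>w k\<close> reads
  off the coordinate at \<open>b ! k\<close>.\<close>

lemma module_basis_dual:
  fixes w :: "nat \<Rightarrow> 'v::finite \<Rightarrow> 'k"
  assumes dual: "\<And>k j. k < length b \<Longrightarrow> j < length b \<Longrightarrow> (\<Sum>x\<in>UNIV. w k x * (b ! j) x) = (if k = j then 1 else 0)"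
    and mem: "\<And>a. \<forall>k<length b. a k \<in> R \<Longrightarrow> lincomb a b \<in> M"
    and coeff: "\<And>m k. m \<in> M \<Longrightarrow> k < length b \<Longrightarrow> (\<Sum>x\<in>UNIV. w k x * m x) \<in> R"
    and expand: "\<And>m. m \<in> M \<Longrightarrow> m = lincomb (\<lambda>k. \<Sum>x\<in>UNIV. w k x * m x) b"
  shows "module_basis R M b"
  unfolding module_basis_alt
proof (intro conjI allI impI ballI)
  fix m assume "m \<in> M"
  then show "\<exists>a. (\<forall>k<length b. a k \<in> R) \<and> m = lincomb a b"
    using coeff expand by (intro exI[of _ "\<lambda>k. \<Sum>x\<in>UNIV. w k x * m x"]) auto
next
  fix a k assume *: "\<forall>k<length b. a k \<in> R" "lincomb a b = (\<lambda>z. 0)" "k < length b"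
  have "0 = (\<Sum>x\<in>UNIV. w k x * lincomb a b x)"
    by (simp add: *)
  also have "\<dots> = (\<Sum>j<length b. a j * (\<Sum>x\<in>UNIV. w k x * (b ! j) x))"
    unfolding lincomb_def sum_distrib_left by (subst sum.swap) (simp add: algebra_simps)
  also have "\<dots> = (\<Sum>j<length b. if k = j then a j else 0)"
    by (intro sum.cong) (auto simp: dual *)
  also have "\<dots> = a k"
    using *(3) by simp
  finally show "a k = 0"
    by simp
qed (use mem in auto)

lemma module_endo_mem:
  assumes "linear_map f" "module_basis R M b" "module_basis R M c" "length d = length b"
    "length c = length b" "\<And>k. k < length b \<Longrightarrow> d ! k \<in> R"
    "\<And>k. k < length b \<Longrightarrow> f (b ! k) = (\<lambda>z. d ! k * (c ! k) z)" "m \<in> M"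
  shows "f m \<in> M"
proof -
  obtain a where a: "\<forall>k<length b. a k \<in> R" "m = lincomb a b"
    using assms(2,8) unfolding module_basis_alt by blast
  have "f m = lincomb (\<lambda>k. a k * d ! k) c"
    unfolding a linear_map_lincomb[OF assms(1)]
    using assms(5,7) by (simp add: lincomb_def algebra_simps)
  then show ?thesis
    using lincomb_mem[OF assms(3), of "\<lambda>k. a k * d ! k"] a(1) assms(5,6) by simp
qed

section \<open>From diagonalizing bases to elementary divisors\<close>

lemma has_elementary_divisorsI:
  assumes "linear_map f" and bases: "module_basis R M b" "module_basis R M c"
    and len: "length d = length b" "length c = length b"
    and f: "\<And>k. k < length b \<Longrightarrow> f (b ! k) = (\<lambda>z. d ! k * (c ! k) z)"
    and d: "\<And>x. x \<in> set d \<Longrightarrow> x = 0 \<or> (\<exists>k. x = \<rho> ^ k)"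
    and chain: "\<And>k. Suc k < length d \<Longrightarrow> \<exists>u\<in>R. d ! Suc k = u * d ! k"
  shows "has_elementary_divisors R \<rho> f M M (mset d)"
  unfolding has_elementary_divisors_def
proof (intro conjI exI[of _ d])
  have dR: "set d \<subseteq> R"
    using d by (metis power_R rho_R subsetI zero_R)
  then have "f m \<in> M" if "m \<in> M" for m
    using module_endo_mem[OF assms(1) bases len _ f that] len(1) by (simp add: subset_iff)
  then show "smith_normal_form R f M M d"
    unfolding smith_normal_form_def using bases len f chain dR
    by (intro conjI exI[of _ b] exI[of _ c]) auto
qed (use d in auto)

text \<open>The Smith form demands a divisibility chain, while the result is a multiset. Keeping
  each exponent in a triple with its two basis vectors lets one sort by exponent settle the
  order.\<close>

lemma has_elementary_divisors_powersI:
  assumes "linear_map f" and bases: "module_basis R M (map (\<lambda>(k, x, y). x) ts)"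
      "module_basis R M (map (\<lambda>(k, x, y). y) ts)"
    and f: "\<And>k x y. (k, x, y) \<in> set ts \<Longrightarrow> f x = (\<lambda>z. \<rho> ^ k * y z)"
  shows "has_elementary_divisors R \<rho> f M M (mset (map (\<lambda>(k, x, y). \<rho> ^ k) ts))"
proof -
  define ts' where "ts' = sort_key fst ts"
  have ts': "mset ts' = mset ts" "sorted (map fst ts')"
    by (simp_all add: ts'_def)
  have set: "set ts' = set ts"
    by (simp add: ts'_def)
  have "has_elementary_divisors R \<rho> f M M (mset (map (\<lambda>(k, x, y). \<rho> ^ k) ts'))"
  proof (rule has_elementary_divisorsI[OF assms(1),
        where b = "map (\<lambda>(k, x, y). x) ts'" and c = "map (\<lambda>(k, x, y). y) ts'"])
    show "module_basis R M (map (\<lambda>(k, x, y). x) ts')"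
      by (rule module_basis_mset_cong[OF bases(1)]) (simp add: ts')
    show "module_basis R M (map (\<lambda>(k, x, y). y) ts')"
      by (rule module_basis_mset_cong[OF bases(2)]) (simp add: ts')
  next
    fix k assume "k < length (map (\<lambda>(k, x, y). x) ts')"
    then show "f (map (\<lambda>(k, x, y). x) ts' ! k) =
        (\<lambda>z. map (\<lambda>(k, x, y). \<rho> ^ k) ts' ! k * (map (\<lambda>(k, x, y). y) ts' ! k) z)"
      using f nth_mem[of k ts'] unfolding set by (auto split: prod.splits)
  next
    fix k assume k: "Suc k < length (map (\<lambda>(k, x, y). \<rho> ^ k) ts')"
    then have "fst (ts' ! k) \<le> fst (ts' ! Suc k)"
      using sorted_nth_mono[OF ts'(2), of k "Suc k"] by simp
    then have "\<rho> ^ fst (ts' ! Suc k) = \<rho> ^ (fst (ts' ! Suc k) - fst (ts' ! k)) * \<rho> ^ fst (ts' ! k)"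
      by (simp flip: power_add)
    then show "\<exists>u\<in>R. map (\<lambda>(k, x, y). \<rho> ^ k) ts' ! Suc k = u * map (\<lambda>(k, x, y). \<rho> ^ k) ts' ! k"
      using k by (auto simp: case_prod_unfold)
  qed auto
  then show ?thesis
    by (simp add: ts')
qed

text \<open>One step of Gaussian elimination with pivot \<open>a\<close>: subtracting
  \<open>c / a\<close> times \<open>x\<^sub>1\<close> from \<open>x\<^sub>2\<close> clears the lower
  row, and \<open>b / a\<close> is absorbed into the new \<open>y\<^sub>1\<close>. Both quotients
  lie in \<open>R\<close> by assumption.\<close>

lemma diagonalize_block_aux:
  assumes "linear_map f" and bases: "module_basis R M (x\<^sub>1 # x\<^sub>2 # xs)" "module_basis R N (y\<^sub>1 # y\<^sub>2 # ys)"
    and f: "f x\<^sub>1 = (\<lambda>z. a * y\<^sub>1 z + b * y\<^sub>2 z)" "f x\<^sub>2 = (\<lambda>z. c * y\<^sub>1 z + d * y\<^sub>2 z)"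
    and val: "has_val a i" "has_val (a * d - b * c) (i + l)" "b / a \<in> R" "c / a \<in> R"
  shows "\<exists>x\<^sub>1' x\<^sub>2' y\<^sub>1' y\<^sub>2'. module_basis R M (x\<^sub>1' # x\<^sub>2' # xs) \<and> module_basis R N (y\<^sub>1' # y\<^sub>2' # ys) \<and>
     f x\<^sub>1' = (\<lambda>z. \<rho> ^ i * y\<^sub>1' z) \<and> f x\<^sub>2' = (\<lambda>z. \<rho> ^ l * y\<^sub>2' z)"
proof -
  define u where "u = a / \<rho> ^ i"
  \<comment> \<open>The unit part of the Schur complement. The latter is the determinant divided by
    the pivot, hence of valuation \<open>l\<close>.\<close>
  define v where "v = (d - b * c / a) / \<rho> ^ l"
  have u: "R_unit u"
    unfolding u_def using val(1) has_val_rho by (rule has_val_divide_unit)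
  have anz: "a \<noteq> 0"
    using val(1) has_val_nz by blast
  have v_alt: "v = (a * d - b * c) / (a * \<rho> ^ l)"
    using anz by (simp add: v_def field_simps)
  have v: "R_unit v"
    unfolding v_alt by (rule has_val_divide_unit[OF val(2) has_val_mult[OF val(1) has_val_rho]])
  have a_eq: "a = \<rho> ^ i * u"
    by (simp add: u_def)
  have d_eq: "d - c / a * b = \<rho> ^ l * v"
    by (simp add: v_def)
  have x: "module_basis R M (x\<^sub>1 # (\<lambda>z. x\<^sub>2 z - c / a * x\<^sub>1 z) # xs)"
  proof -
    have "module_basis R M ((\<lambda>z. x\<^sub>2 z + - (c / a) * x\<^sub>1 z) # x\<^sub>1 # xs)"
      using module_basis_modify_head[OF module_basis_mset_cong[OF bases(1), of "x\<^sub>2 # x\<^sub>1 # xs"] R_unit_1,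
          of "- (c / a)"] val(4) by (simp add: add_mset_commute)
    then show ?thesis
      using module_basis_mset_cong by fastforce
  qed
  have y: "module_basis R N ((\<lambda>z. u * y\<^sub>1 z + u * (b / a) * y\<^sub>2 z) # (\<lambda>z. v * y\<^sub>2 z) # ys)"
  proof -
    have "module_basis R N ((\<lambda>z. u * y\<^sub>1 z + u * (b / a) * y\<^sub>2 z) # y\<^sub>2 # ys)"
      using module_basis_modify_head[OF bases(2) u mult_R[OF R_unit_R[OF u] val(3)]] .
    then have "module_basis R N (y\<^sub>2 # (\<lambda>z. u * y\<^sub>1 z + u * (b / a) * y\<^sub>2 z) # ys)"
      by (rule module_basis_mset_cong) (simp add: add_mset_commute)
    then have "module_basis R N ((\<lambda>z. v * y\<^sub>2 z) # (\<lambda>z. u * y\<^sub>1 z + u * (b / a) * y\<^sub>2 z) # ys)"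
      by (rule module_basis_scale_head[OF _ v])
    then show ?thesis
      by (rule module_basis_mset_cong) (simp add: add_mset_commute)
  qed
  have "f (\<lambda>z. x\<^sub>2 z - c / a * x\<^sub>1 z) = (\<lambda>z. f x\<^sub>2 z + - (c / a) * f x\<^sub>1 z)"
    using linear_map_add[OF assms(1), of x\<^sub>2 "\<lambda>z. - (c / a) * x\<^sub>1 z"]
      linear_map_scale[OF assms(1), of "- (c / a)" x\<^sub>1] by simp
  also have "\<dots> = (\<lambda>z. (d - c / a * b) * y\<^sub>2 z)"
    using anz by (simp add: f algebra_simps)
  also have "\<dots> = (\<lambda>z. \<rho> ^ l * (v * y\<^sub>2 z))"
    by (simp only: d_eq mult.assoc)
  finally have fx2: "f (\<lambda>z. x\<^sub>2 z - c / a * x\<^sub>1 z) = (\<lambda>z. \<rho> ^ l * (v * y\<^sub>2 z))" .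
  have "\<rho> ^ i * (u * s + u * (b / a) * t) = a * s + b * t" for s t
  proof -
    have "\<rho> ^ i * (u * s + u * (b / a) * t) = (\<rho> ^ i * u) * s + (\<rho> ^ i * u) * (b / a) * t"
      by (simp only: distrib_left mult.assoc)
    then show ?thesis
      using anz by (simp flip: a_eq)
  qed
  then have fx1: "f x\<^sub>1 = (\<lambda>z. \<rho> ^ i * (u * y\<^sub>1 z + u * (b / a) * y\<^sub>2 z))"
    by (simp only: f)
  show ?thesis
    using x y fx1 fx2 by blast
qed

text \<open>The pivot only has to divide the off-diagonal entries; the determinant then fixes the
  other exponent. If the pivot is \<open>d\<close>, both pairs of vectors are exchanged before and
  after, so that \<open>i\<close> and \<open>l\<close> keep their places.\<close>

lemma diagonalize_block:
  assumes "linear_map f" and bases: "module_basis R M (x\<^sub>1 # x\<^sub>2 # xs)" "module_basis R N (y\<^sub>1 # y\<^sub>2 # ys)"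
    and f: "f x\<^sub>1 = (\<lambda>z. a * y\<^sub>1 z + b * y\<^sub>2 z)" "f x\<^sub>2 = (\<lambda>z. c * y\<^sub>1 z + d * y\<^sub>2 z)"
    and val: "has_val a i" "has_val b j" "has_val c k" "has_val d l"
    and det: "has_val (a * d - b * c) (i + l)"
    and min: "i \<le> j \<and> i \<le> k \<or> l \<le> j \<and> l \<le> k"
  shows "\<exists>x\<^sub>1' x\<^sub>2' y\<^sub>1' y\<^sub>2'. module_basis R M (x\<^sub>1' # x\<^sub>2' # xs) \<and> module_basis R N (y\<^sub>1' # y\<^sub>2' # ys) \<and>
     f x\<^sub>1' = (\<lambda>z. \<rho> ^ i * y\<^sub>1' z) \<and> f x\<^sub>2' = (\<lambda>z. \<rho> ^ l * y\<^sub>2' z)"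
  using min
proof
  assume "i \<le> j \<and> i \<le> k"
  then show ?thesis
    using diagonalize_block_aux[OF assms(1) bases f val(1) det] has_val_divide_R val by blast
next
  assume *: "l \<le> j \<and> l \<le> k"
  have "module_basis R M (x\<^sub>2 # x\<^sub>1 # xs)" "module_basis R N (y\<^sub>2 # y\<^sub>1 # ys)"
    using bases by (auto intro: module_basis_mset_cong simp: add_mset_commute)
  moreover have "f x\<^sub>2 = (\<lambda>z. d * y\<^sub>2 z + c * y\<^sub>1 z)" "f x\<^sub>1 = (\<lambda>z. b * y\<^sub>2 z + a * y\<^sub>1 z)"
    using f by (simp_all add: add.commute)
  moreover have "has_val (d * a - c * b) (l + i)"
    using det by (simp add: mult.commute add.commute)
  moreover have "b / d \<in> R" "c / d \<in> R"
    using * has_val_divide_R val by blast+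
  ultimately have "\<exists>x\<^sub>1' x\<^sub>2' y\<^sub>1' y\<^sub>2'. module_basis R M (x\<^sub>1' # x\<^sub>2' # xs) \<and> module_basis R N (y\<^sub>1' # y\<^sub>2' # ys) \<and>
     f x\<^sub>1' = (\<lambda>z. \<rho> ^ l * y\<^sub>1' z) \<and> f x\<^sub>2' = (\<lambda>z. \<rho> ^ i * y\<^sub>2' z)"
    using val(4) by (intro diagonalize_block_aux[OF assms(1)])
  then obtain x\<^sub>1' x\<^sub>2' y\<^sub>1' y\<^sub>2' where
    "module_basis R M (x\<^sub>1' # x\<^sub>2' # xs)" "module_basis R N (y\<^sub>1' # y\<^sub>2' # ys)"
    "f x\<^sub>1' = (\<lambda>z. \<rho> ^ l * y\<^sub>1' z)" "f x\<^sub>2' = (\<lambda>z. \<rho> ^ i * y\<^sub>2' z)"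
    by blast
  moreover from this have "module_basis R M (x\<^sub>2' # x\<^sub>1' # xs)" "module_basis R N (y\<^sub>2' # y\<^sub>1' # ys)"
    by (auto intro: module_basis_mset_cong simp: add_mset_commute)
  ultimately show ?thesis
    by blast
qed

text \<open>The exponents of the two blocks are interleaved because the lists in the final statement
  are ordered by the index shift \<open>0, r, 2 * r, 3 * r\<close>, whose parity separates the
  blocks.\<close>

lemma diagonalize_two_blocks:
  assumes "linear_map f" and bases: "module_basis R M [x\<^sub>0, x\<^sub>2, x\<^sub>1, x\<^sub>3]" "module_basis R M [y\<^sub>0, y\<^sub>2, y\<^sub>1, y\<^sub>3]"
    and f: "f x\<^sub>0 = (\<lambda>z. a * y\<^sub>0 z + b * y\<^sub>2 z)" "f x\<^sub>2 = (\<lambda>z. c * y\<^sub>0 z + d * y\<^sub>2 z)"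
      "f x\<^sub>1 = (\<lambda>z. a' * y\<^sub>1 z + b' * y\<^sub>3 z)" "f x\<^sub>3 = (\<lambda>z. c' * y\<^sub>1 z + d' * y\<^sub>3 z)"
    and val: "has_val a i" "has_val b j" "has_val c k" "has_val d l"
      "has_val a' i'" "has_val b' j'" "has_val c' k'" "has_val d' l'"
    and det: "has_val (a * d - b * c) (i + l)" "has_val (a' * d' - b' * c') (i' + l')"
    and min: "i \<le> j \<and> i \<le> k \<or> l \<le> j \<and> l \<le> k" "i' \<le> j' \<and> i' \<le> k' \<or> l' \<le> j' \<and> l' \<le> k'"
  shows "\<exists>ts. map fst ts = [i, i', l, l'] \<and> module_basis R M (map (\<lambda>(k, x, y). x) ts) \<and>
    module_basis R M (map (\<lambda>(k, x, y). y) ts) \<and> (\<forall>(k, x, y)\<in>set ts. f x = (\<lambda>z. \<rho> ^ k * y z))"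
proof -
  obtain u\<^sub>0 u\<^sub>2 v\<^sub>0 v\<^sub>2 where 1: "module_basis R M [u\<^sub>0, u\<^sub>2, x\<^sub>1, x\<^sub>3]" "module_basis R M [v\<^sub>0, v\<^sub>2, y\<^sub>1, y\<^sub>3]"
    "f u\<^sub>0 = (\<lambda>z. \<rho> ^ i * v\<^sub>0 z)" "f u\<^sub>2 = (\<lambda>z. \<rho> ^ l * v\<^sub>2 z)"
    using diagonalize_block[OF assms(1) bases f(1,2) val(1-4) det(1) min(1)] by blast
  have "module_basis R M [x\<^sub>1, x\<^sub>3, u\<^sub>0, u\<^sub>2]" "module_basis R M [y\<^sub>1, y\<^sub>3, v\<^sub>0, v\<^sub>2]"
    using 1(1,2) by (auto intro: module_basis_mset_cong simp: add_mset_commute)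
  then obtain u\<^sub>1 u\<^sub>3 v\<^sub>1 v\<^sub>3 where 2: "module_basis R M [u\<^sub>1, u\<^sub>3, u\<^sub>0, u\<^sub>2]" "module_basis R M [v\<^sub>1, v\<^sub>3, v\<^sub>0, v\<^sub>2]"
    "f u\<^sub>1 = (\<lambda>z. \<rho> ^ i' * v\<^sub>1 z)" "f u\<^sub>3 = (\<lambda>z. \<rho> ^ l' * v\<^sub>3 z)"
    using diagonalize_block[OF assms(1) _ _ f(3,4) val(5-8) det(2) min(2)] by blast
  have "module_basis R M [u\<^sub>0, u\<^sub>1, u\<^sub>2, u\<^sub>3]" "module_basis R M [v\<^sub>0, v\<^sub>1, v\<^sub>2, v\<^sub>3]"
    using 2(1,2) by (auto intro: module_basis_mset_cong simp: add_mset_commute)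
  then show ?thesis
    using 1 2 by (intro exI[of _ "[(i, u\<^sub>0, v\<^sub>0), (i', u\<^sub>1, v\<^sub>1), (l, u\<^sub>2, v\<^sub>2), (l', u\<^sub>3, v\<^sub>3)]"]) simp
qed

end

section \<open>Jacobi sums\<close>

definition conv :: "('f::{finite, ab_group_add} \<Rightarrow> 'k::field) \<Rightarrow> ('f \<Rightarrow> 'k) \<Rightarrow> 'f \<Rightarrow> 'k" where
  "conv f g = (\<lambda>z. \<Sum>x\<in>UNIV. f x * g (z - x))"

lemma sum_minus_reindex: "(\<Sum>x\<in>UNIV. g (c - x)) = (\<Sum>x\<in>UNIV. g (x::'f::{finite, ab_group_add}))"
  by (rule sum.reindex_bij_witness[of _ "\<lambda>x. c - x" "\<lambda>x. c - x"]) auto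

lemma sum_plus_reindex: "(\<Sum>x\<in>UNIV. g (x + c)) = (\<Sum>x\<in>UNIV. g (x::'f::{finite, ab_group_add}))"
  by (rule sum.reindex_bij_witness[of _ "\<lambda>x. x - c" "\<lambda>x. x + c"]) auto

lemma sum_mult_reindex:
  "c \<noteq> 0 \<Longrightarrow> (\<Sum>x\<in>UNIV. g (c * x)) = (\<Sum>x\<in>UNIV. g (x::'f::{finite, field}))"
  by (rule sum.reindex_bij_witness[of _ "\<lambda>x. x / c" "\<lambda>x. c * x"]) auto

lemma conv_commute: "conv f g = conv g f"
proof
  fix z
  show "conv f g z = conv g f z"
    using sum_minus_reindex[of "\<lambda>x. f x * g (z - x)" z] by (simp add: conv_def mult.commute)
qed

lemma conv_assoc: "conv (conv f g) h = conv f (conv g h)"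
proof
  fix z
  have "conv (conv f g) h z = (\<Sum>x\<in>UNIV. \<Sum>y\<in>UNIV. f y * (g (x - y) * h (z - x)))"
    by (simp add: conv_def sum_distrib_right mult.assoc)
  also have "\<dots> = (\<Sum>y\<in>UNIV. \<Sum>x\<in>UNIV. f y * (g (x - y) * h (z - x)))"
    by (rule sum.swap)
  also have "\<dots> = (\<Sum>y\<in>UNIV. \<Sum>x\<in>UNIV. f y * (g x * h (z - y - x)))"
  proof (rule sum.cong)
    fix y
    show "(\<Sum>x\<in>UNIV. f y * (g (x - y) * h (z - x))) = (\<Sum>x\<in>UNIV. f y * (g x * h (z - y - x)))"
      using sum_plus_reindex[of "\<lambda>x. f y * (g (x - y) * h (z - x))" y, symmetric]
      by (simp add: algebra_simps)
  qed simp
  also have "\<dots> = conv f (conv g h) z"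
    by (simp add: conv_def sum_distrib_left)
  finally show "conv (conv f g) h z = conv f (conv g h) z" .
qed

lemma conv_add_right: "conv f (\<lambda>z. g z + h z) = (\<lambda>z. conv f g z + conv f h z)"
  by (simp add: conv_def algebra_simps sum.distrib)

lemma conv_scale_right: "conv f (\<lambda>z. c * g z) = (\<lambda>z. c * conv f g z)"
  by (simp add: conv_def sum_distrib_left algebra_simps)

lemma conv_const_right: "conv f (\<lambda>z. c) = (\<lambda>z. sum f UNIV * c)"
  by (simp add: conv_def sum_distrib_right)

lemma conv_add_left: "conv (\<lambda>z. g z + h z) f = (\<lambda>z. conv g f z + conv h f z)"
  by (simp add: conv_def algebra_simps sum.distrib)

lemma conv_scale_left: "conv (\<lambda>z. c * g z) f = (\<lambda>z. c * conv g f z)"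
  by (simp add: conv_def sum_distrib_left algebra_simps)

lemma conv_basis_elt_right: "conv f (basis_elt 0) = f"
proof
  fix z
  have "conv f (basis_elt 0) z = (\<Sum>x\<in>UNIV. if x = z then f x else 0)"
    unfolding conv_def by (intro sum.cong) (auto simp: basis_elt_def)
  then show "conv f (basis_elt 0) z = f z"
    by simp
qed

lemma conv_basis_elt_left: "conv (basis_elt 0) f = f"
  by (simp add: conv_commute[of "basis_elt 0"] conv_basis_elt_right)

lemma sum_conv: "sum (conv f g) UNIV = sum f UNIV * sum g UNIV"
proof -
  have "sum (conv f g) UNIV = (\<Sum>x\<in>UNIV. \<Sum>z\<in>UNIV. f x * g (z - x))"
    unfolding conv_def by (rule sum.swap)
  also have "\<dots> = (\<Sum>x\<in>UNIV. f x * sum g UNIV)"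
    using sum_plus_reindex[of "\<lambda>z. f x * g z" "- x" for x] by (simp add: sum_distrib_left)
  finally show ?thesis
    by (simp add: sum_distrib_right)
qed

lemma linear_map_conv: "linear_map (conv f)"
  by (simp add: linear_map_def conv_add_right conv_scale_right)

lemma sum_periodic:
  fixes g :: "int \<Rightarrow> 'a::comm_monoid_add"
  assumes "m > 0" "\<And>c d. m dvd c - d \<Longrightarrow> g c = g d"
  shows "(\<Sum>c\<in>{0..<m}. g (c + b)) = (\<Sum>c\<in>{0..<m}. g c)"
proof -
  have "(\<Sum>c\<in>{0..<m}. g ((c + b) mod m)) = (\<Sum>c\<in>{0..<m}. g c)"
  proof (rule sum.reindex_bij_witness[of _ "\<lambda>c. (c - b) mod m" "\<lambda>c. (c + b) mod m"])
    fix a assume "a \<in> {0..<m}"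
    then show "((a + b) mod m - b) mod m = a"
      by (simp add: mod_diff_left_eq)
    fix a assume "a \<in> {0..<m}"
    then show "((a - b) mod m + b) mod m = a"
      by (simp add: mod_add_left_eq)
  qed (use assms in auto)
  moreover have "g ((c + b) mod m) = g (c + b)" for c
    using assms(2)[of "(c + b) mod m" "c + b"] by (simp add: mod_eq_dvd_iff[symmetric])
  ultimately show ?thesis
    by simp
qed

locale teichmueller_lift = residue_dvr R red "of_nat p"
  for R :: "'k::field_char_0 set" and red :: "'k \<Rightarrow> 'f::finite_field" and p :: nat +
  fixes n q :: nat and \<xi> :: 'k and \<beta> :: 'f
  assumes prime_p: "Factorial_Ring.prime p"
    and q_def: "q = p ^ n" and q_gt: "q > 2"
    and card_F: "CARD('f) = q"
    and xi_R: "\<xi> \<in> R" and xi_pow: "\<xi> ^ (q - 1) = 1"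
    and xi_order: "\<And>k. 0 < k \<Longrightarrow> k < q - 1 \<Longrightarrow> \<xi> ^ k \<noteq> 1"
    and beta_def: "\<beta> = red \<xi>"
begin

section \<open>The residue field and its primitive element\<close>

lemma of_nat_p_F [simp]: "of_nat p = (0::'f)"
  using red_rho red_of_nat by metis

lemma n_pos: "n > 0"
  using q_def q_gt by (cases n) auto

lemma of_nat_q_F [simp]: "of_nat q = (0::'f)"
  using n_pos by (simp add: q_def)

lemma of_nat_q1_F: "of_nat (q - 1) = (-1::'f)"
  using q_gt by (simp add: of_nat_diff)

lemma CHAR_F: "CHAR('f) = p"
proof -
  have "CHAR('f) dvd p"
    using of_nat_eq_0_iff_char_dvd[where 'a = 'f, of p] by simp
  then show ?thesis
    using prime_p prime_nat_iff by (metis CHAR_not_1' One_nat_def)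
qed

definition m :: int where "m = int q - 1"

lemma m_gt: "m > 1"
  using q_gt by (simp add: m_def)

lemma m_eq: "m = int (q - 1)"
  using q_gt by (simp add: m_def)

lemma not_m_dvd_1: "\<not> m dvd 1"
  using m_gt by auto

lemma beta_pow: "\<beta> ^ (q - 1) = 1"
  using arg_cong[OF xi_pow, of red] xi_R by (simp add: beta_def)

lemma xi_nz [simp]: "\<xi> \<noteq> 0"
  using xi_pow q_gt by (auto simp: power_0_left)

lemma beta_nz [simp]: "\<beta> \<noteq> 0"
  using beta_pow q_gt by (auto simp: power_0_left)

text \<open>
  If \<open>\<zeta> = \<xi> ^ k \<noteq> 1\<close> reduced to \<open>1\<close>, then reducing the vanishing sum of the \<open>q - 1\<close> powers
  of \<open>\<zeta>\<close> would give \<open>q - 1 = 0\<close> in the residue field.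
\<close>
lemma beta_order:
  assumes "0 < k" "k < q - 1" shows "\<beta> ^ k \<noteq> 1"
proof
  assume *: "\<beta> ^ k = 1"
  have "(\<xi> ^ k) ^ (q - 1) = 1"
    by (metis xi_pow power_mult mult.commute power_one)
  then have "(\<Sum>j<q - 1. (\<xi> ^ k) ^ j) = 0"
    using power_diff_1_eq[of "\<xi> ^ k" "q - 1"] xi_order[OF assms] by simp
  then have "red (\<Sum>j<q - 1. (\<xi> ^ k) ^ j) = 0"
    by simp
  then have "(\<Sum>j<q - 1. (\<beta> ^ k) ^ j) = 0"
    using xi_R by (simp add: red_sum beta_def)
  then show False
    using * of_nat_q1_F by simp
qed

lemma xi_power_power: "(\<xi> ^ k) ^ (q - 1) = 1"
  unfolding power_mult[symmetric] mult.commute[of k] by (simp only: power_mult xi_pow power_one)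

lemma beta_power_eq_1_iff: "\<beta> ^ k = 1 \<longleftrightarrow> (q - 1) dvd k"
proof
  assume *: "\<beta> ^ k = 1"
  have "\<beta> ^ k = \<beta> ^ ((q - 1) * (k div (q - 1)) + k mod (q - 1))"
    by simp
  also have "\<dots> = \<beta> ^ (k mod (q - 1))"
    unfolding power_add power_mult beta_pow by simp
  finally have "\<beta> ^ (k mod (q - 1)) = 1"
    using * by simp
  then show "(q - 1) dvd k"
    using beta_order[of "k mod (q - 1)"] q_gt by (cases "k mod (q - 1) = 0") auto
next
  assume "(q - 1) dvd k"
  then show "\<beta> ^ k = 1"
    by (elim dvdE) (simp only: power_mult beta_pow power_one)
qed

lemma xi_power_eq:
  assumes "\<beta> ^ i = \<beta> ^ j" shows "\<xi> ^ i = \<xi> ^ j"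
proof -
  have *: "\<xi> ^ i = \<xi> ^ j" if "i \<le> j" "\<beta> ^ i = \<beta> ^ j" for i j
  proof -
    have "\<beta> ^ (j - i) = 1"
      using that by (simp add: power_diff)
    then have "(q - 1) dvd (j - i)"
      by (simp add: beta_power_eq_1_iff)
    then have "\<xi> ^ (j - i) = 1"
      by (elim dvdE) (simp only: power_mult xi_pow power_one)
    then have "\<xi> ^ i * \<xi> ^ (j - i) = \<xi> ^ i"
      by simp
    then show ?thesis
      using that by (simp flip: power_add)
  qed
  show ?thesis
    using *[of i j] *[of j i] assms by (metis nat_le_linear)
qed

lemma beta_generates:
  assumes "x \<noteq> 0" obtains j where "j < q - 1" "x = \<beta> ^ j"
proof -
  have inj: "inj_on (\<lambda>j. \<beta> ^ j) {..<q - 1}"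
  proof (rule linorder_inj_onI)
    fix i j assume ij: "i < j" "i \<in> {..<q - 1}" "j \<in> {..<q - 1}"
    show "\<beta> ^ i \<noteq> \<beta> ^ j"
    proof
      assume "\<beta> ^ i = \<beta> ^ j"
      then have "\<beta> ^ (j - i) = 1"
        using ij by (simp add: power_diff)
      moreover have "0 < j - i" "j - i < q - 1"
        using ij by auto
      ultimately show False
        using beta_order by blast
    qed
  qed auto
  have "(\<lambda>j. \<beta> ^ j) ` {..<q - 1} = UNIV - {0}"
  proof (rule card_subset_eq)
    show "card ((\<lambda>j. \<beta> ^ j) ` {..<q - 1}) = card (UNIV - {0::'f})"
      unfolding card_image[OF inj] by (simp add: card_Diff_singleton card_F)
  qed auto
  then show ?thesis
    using that assms by blast
qed

section \<open>The Teichmueller character and its powers\<close>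

definition T :: "'f \<Rightarrow> 'k" where "T = teichmueller \<xi> \<beta>"

lemma T_beta [simp]: "T (\<beta> ^ j) = \<xi> ^ j"
proof -
  have "(THE u. \<exists>i. \<beta> ^ j = \<beta> ^ i \<and> u = \<xi> ^ i) = \<xi> ^ j"
    by (rule the_equality) (blast, metis xi_power_eq)
  then show ?thesis
    by (simp add: T_def teichmueller_def)
qed

lemma T_mult: "x \<noteq> 0 \<Longrightarrow> y \<noteq> 0 \<Longrightarrow> T (x * y) = T x * T y"
  by (elim beta_generates) (simp flip: power_add)

lemma T_1 [simp]: "T 1 = 1"
  using T_beta[of 0] by simp

lemma T_R: "x \<noteq> 0 \<Longrightarrow> T x \<in> R"
  by (elim beta_generates) (simp add: xi_R)

lemma red_T: "x \<noteq> 0 \<Longrightarrow> red (T x) = x"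
  by (elim beta_generates) (simp add: xi_R flip: beta_def)

lemma T_nz: "x \<noteq> 0 \<Longrightarrow> T x \<noteq> 0"
  by (elim beta_generates) simp

lemma T_pow: "x \<noteq> 0 \<Longrightarrow> T x ^ (q - 1) = 1"
  by (elim beta_generates) (simp only: T_beta xi_power_power)

lemma T_power: "x \<noteq> 0 \<Longrightarrow> T (x ^ k) = T x ^ k"
  by (induction k) (simp_all add: T_mult)

lemma T_powi_cong:
  assumes "x \<noteq> 0" "m dvd a - b" shows "T x powi a = T x powi b"
proof -
  obtain c where "a = b + m * c"
    using assms(2) by (metis dvdE add.commute diff_add_cancel)
  then have "T x powi a = T x powi b * (T x powi m) powi c"
    using T_nz[OF assms(1)] by (simp add: power_int_add power_int_mult)
  then show ?thesis
    using T_pow[OF assms(1)] by (simp add: m_eq)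
qed

lemma T_powi_unit: "x \<noteq> 0 \<Longrightarrow> R_unit (T x powi a)"
proof -
  assume x: "x \<noteq> 0"
  have "T x powi a = T x powi (a mod m)"
    using x by (intro T_powi_cong) (auto simp: mod_eq_dvd_iff[symmetric])
  also have "\<dots> = T x ^ nat (a mod m)"
    using m_gt by (simp add: power_int_nonneg_exp)
  finally show ?thesis
    using T_R[OF x] red_T[OF x] x by (simp add: R_unit_def)
qed

text \<open>
  \<open>\<chi> a\<close> is the character \<open>T\<close> to the power \<open>- a\<close>, extended by \<open>0\<close>; as an element of the free
  module it is the \<open>e\<^sub>a\<close> of the informal statement.
\<close>
definition \<chi> :: "int \<Rightarrow> 'f \<Rightarrow> 'k" where
  "\<chi> a x = (if x = 0 then 0 else T x powi (- a))"

lemma chi_0 [simp]: "\<chi> a 0 = 0"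
  by (simp add: \<chi>_def)

lemma chi_1 [simp]: "\<chi> a 1 = 1"
  by (simp add: \<chi>_def)

lemma chi_cong: "m dvd a - b \<Longrightarrow> \<chi> a = \<chi> b"
  by (auto simp: \<chi>_def fun_eq_iff intro!: T_powi_cong) (metis dvd_minus_iff minus_diff_eq)

lemma chi_unit: "x \<noteq> 0 \<Longrightarrow> R_unit (\<chi> a x)"
  by (simp add: \<chi>_def T_powi_unit)

lemma chi_R [simp]: "\<chi> a x \<in> R"
  using chi_unit[of x a] R_unit_R by (cases "x = 0") auto

lemma chi_mult: "\<chi> a (x * y) = \<chi> a x * \<chi> a y"
  by (simp add: \<chi>_def T_mult power_int_mult_distrib)

lemma chi_add: "\<chi> (a + b) x = \<chi> a x * \<chi> b x"
  using T_nz[of x] power_int_add[of "T x" "- a" "- b"] by (simp add: \<chi>_def)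

lemma chi_beta: "\<chi> a (\<beta> ^ j) = \<xi> powi (- a * int j)"
  by (simp add: \<chi>_def power_int_power mult.commute)

lemma chi_triv: "m dvd a \<Longrightarrow> \<chi> a = (\<lambda>x. if x = 0 then 0 else 1)"
  using chi_cong[of a 0] by (simp add: \<chi>_def[of 0] fun_eq_iff)

lemma chi_beta_nontriv:
  assumes "\<not> m dvd a" shows "\<chi> a \<beta> \<noteq> 1"
proof
  assume *: "\<chi> a \<beta> = 1"
  have "\<chi> a \<beta> = \<chi> (a mod m) \<beta>"
    by (rule fun_cong[OF chi_cong]) (metis mod_eq_dvd_iff mod_mod_trivial)
  also have "\<dots> = \<xi> powi (- (a mod m))"
    using chi_beta[of "a mod m" 1] by simp
  finally have "\<xi> ^ nat (a mod m) = 1"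
    using * m_gt by (simp add: power_int_minus power_int_nonneg_exp)
  moreover have "0 < nat (a mod m)" "nat (a mod m) < q - 1"
    using assms m_gt pos_mod_bound[of m a] pos_mod_sign[of m a] m_eq unfolding dvd_eq_mod_eq_0 by linarith+
  ultimately show False
    using xi_order by blast
qed

lemma sum_chi: "\<not> m dvd a \<Longrightarrow> sum (\<chi> a) UNIV = 0"
proof -
  assume *: "\<not> m dvd a"
  have "sum (\<chi> a) UNIV = \<chi> a \<beta> * sum (\<chi> a) UNIV"
    using sum_mult_reindex[of \<beta> "\<chi> a"] by (simp add: chi_mult sum_distrib_left)
  then show ?thesis
    using chi_beta_nontriv[OF *] by (simp add: mult_cancel_right1)
qed

lemma sum_chi_triv: "m dvd a \<Longrightarrow> sum (\<chi> a) UNIV = of_nat (q - 1)"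
  by (simp add: chi_triv sum.If_cases Collect_neg_eq card_F Compl_eq_Diff_UNIV card_Diff_singleton)

lemma chi_minus_one_square: "\<chi> a (-1) * \<chi> a (-1) = 1"
  using chi_mult[of a "-1" "-1"] by simp

text \<open>The trivial character \<open>\<chi> 0\<close> is \<open>1 - [0]\<close>, which modulo
  constants is \<open>- [0]\<close>. Taking \<open>[0]\<close> itself instead makes
  \<open>e 0\<close> the identity of convolution.\<close>

definition e :: "int \<Rightarrow> 'f \<Rightarrow> 'k" where
  "e a = (if m dvd a then basis_elt 0 else \<chi> a)"

definition J :: "int \<Rightarrow> int \<Rightarrow> 'k" where
  "J a b = (\<Sum>x\<in>UNIV. \<chi> a x * \<chi> b (1 - x))"

text \<open>
  \<open>N a b\<close> is the ratio \<open>g(a) g(b) / g(a + b)\<close> of Gauss sums, where \<open>g(0)\<close> is normalised to \<open>1\<close>.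
  Working modulo the constant functions, on which additive convolution acts by scalars, it is
  the structure constant of the functions \<open>e a\<close> under convolution, so no additive
  character is needed.
\<close>
definition N :: "int \<Rightarrow> int \<Rightarrow> 'k" where
  "N a b = (if m dvd a \<or> m dvd b then 1
     else if m dvd a + b then \<chi> b (-1) * of_nat q else J a b)"

text \<open>The constant that working modulo constants discards. It is nonzero only for two
  nontrivial, mutually inverse characters, where it equals the Jacobi sum.\<close>

definition C :: "int \<Rightarrow> int \<Rightarrow> 'k" where
  "C a b = (if \<not> m dvd a \<and> \<not> m dvd b \<and> m dvd a + b then - \<chi> b (-1) else 0)"

lemma conv_chi:
  assumes "z \<noteq> 0" shows "conv (\<chi> a) (\<chi> b) z = \<chi> (a + b) z * J a b"
proof -
  have "conv (\<chi> a) (\<chi> b) z = (\<Sum>x\<in>UNIV. \<chi> a (z * x) * \<chi> b (z * (1 - x)))"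
    using sum_mult_reindex[OF assms, of "\<lambda>x. \<chi> a x * \<chi> b (z - x)"]
    by (simp add: conv_def right_diff_distrib)
  then show ?thesis
    by (simp add: chi_mult chi_add J_def sum_distrib_left mult.left_commute mult.assoc)
qed

lemma conv_chi_0: "conv (\<chi> a) (\<chi> b) 0 = \<chi> b (-1) * sum (\<chi> (a + b)) UNIV"
  unfolding conv_def sum_distrib_left
proof (rule sum.cong)
  fix x show "\<chi> a x * \<chi> b (0 - x) = \<chi> b (-1) * \<chi> (a + b) x"
    using chi_mult[of b "-1" x] by (simp add: chi_add)
qed simp

text \<open>The values of the convolution add up to the product of two vanishing character sums. Its
  value at 0 is known, and at the \<open>q - 1\<close> other points it is constantly
  \<open>J a b\<close>.\<close>

lemma J_opposite:
  assumes "\<not> m dvd a" "\<not> m dvd b" "m dvd a + b"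
  shows "J a b = - \<chi> b (-1)"
proof -
  have "0 = sum (conv (\<chi> a) (\<chi> b)) UNIV"
    by (simp add: sum_conv sum_chi assms)
  also have "\<dots> = conv (\<chi> a) (\<chi> b) 0 + (\<Sum>z\<in>UNIV - {0}. conv (\<chi> a) (\<chi> b) z)"
    by (simp add: sum.remove)
  also have "(\<Sum>z\<in>UNIV - {0}. conv (\<chi> a) (\<chi> b) z) = (\<Sum>z\<in>UNIV - {0::'f}. J a b)"
    by (intro sum.cong) (simp_all add: conv_chi chi_triv assms)
  finally have "of_nat (q - 1) * (J a b + \<chi> b (-1)) = 0"
    by (simp add: conv_chi_0 sum_chi_triv assms card_F card_Diff_singleton algebra_simps)
  then show ?thesis
    using q_gt by (simp add: eq_neg_iff_add_eq_0)
qed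

lemma e_cong: "m dvd a - b \<Longrightarrow> e a = e b"
  using dvd_diff_commute dvd_add_right_iff[of m "a - b" b] chi_cong by (simp add: e_def)

text \<open>Modulo constants, the functions on the field thus form a twisted group ring of \<int>/(q
  - 1) with basis \<open>e a\<close> and cocycle \<open>N\<close>.\<close>

lemma conv_e: "conv (e a) (e b) = (\<lambda>z. N a b * e (a + b) z + C a b)"
proof (cases "m dvd a \<or> m dvd b")
  case True
  then show ?thesis
  proof
    assume "m dvd a"
    moreover from this have "e (a + b) = e b"
      by (intro e_cong) simp
    ultimately show ?thesis
      by (simp add: N_def C_def conv_basis_elt_left e_def[of a])
  next
    assume "m dvd b"
    moreover from this have "e (a + b) = e a"
      by (intro e_cong) simp
    ultimately show ?thesis
      by (simp add: N_def C_def conv_basis_elt_right e_def[of b])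
  qed
next
  case False
  show ?thesis
  proof
    fix z
    show "conv (e a) (e b) z = N a b * e (a + b) z + C a b"
    proof (cases "m dvd a + b"; cases "z = 0")
      assume *: "m dvd a + b" "z = 0"
      then show ?thesis
        using False q_gt by (simp add: e_def conv_chi_0 sum_chi_triv N_def C_def basis_elt_def
            of_nat_diff algebra_simps)
    next
      assume *: "m dvd a + b" "z \<noteq> 0"
      then show ?thesis
        using False by (simp add: e_def conv_chi J_opposite C_def basis_elt_def chi_triv)
    next
      assume *: "\<not> m dvd a + b" "z = 0"
      then show ?thesis
        using False by (simp add: e_def conv_chi_0 sum_chi C_def)
    next
      assume *: "\<not> m dvd a + b" "z \<noteq> 0"
      then show ?thesis
        using False by (simp add: e_def conv_chi N_def C_def)
    qed
  qed
qed

text \<open>Both bracketings of a triple convolution are compared through the difference of their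
  values at 1 and 0: this kills the constants and is \<open>1\<close> or \<open>- 1\<close> on
  \<open>e\<close>.\<close>

lemma N_cocycle: "N a b * N (a + b) c = N b c * N a (b + c)"
proof -
  let ?s = "a + b + c"
  have l: "conv (conv (e a) (e b)) (e c) =
      (\<lambda>z. N a b * (N (a + b) c * e ?s z + C (a + b) c) + sum (e c) UNIV * C a b)"
    by (simp add: conv_e[of a b] conv_add_left conv_scale_left conv_e[of "a + b"]
        conv_commute[of "\<lambda>z. C a b"] conv_const_right)
  have r: "conv (e a) (conv (e b) (e c)) =
      (\<lambda>z. N b c * (N a (b + c) * e ?s z + C a (b + c)) + sum (e a) UNIV * C b c)"
    by (simp add: conv_e[of b c] conv_add_right conv_scale_right conv_e[of a "b + c"]
        conv_const_right add.assoc)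
  have "conv (conv (e a) (e b)) (e c) 1 - conv (conv (e a) (e b)) (e c) 0 =
      conv (e a) (conv (e b) (e c)) 1 - conv (e a) (conv (e b) (e c)) 0"
    by (simp only: conv_assoc)
  then have "N a b * N (a + b) c * (e ?s 1 - e ?s 0) = N b c * N a (b + c) * (e ?s 1 - e ?s 0)"
    unfolding l r by (simp add: algebra_simps)
  moreover have "e ?s 1 - e ?s 0 \<noteq> 0"
    by (simp add: e_def basis_elt_def)
  ultimately show ?thesis
    by simp
qed

lemma N_commute: "N a b = N b a"
proof -
  have "\<chi> b (-1) = \<chi> a (-1)" if "m dvd a + b"
  proof -
    have "\<chi> a (-1) * \<chi> b (-1) = \<chi> b (-1) * \<chi> b (-1)"
      using chi_add[of a b "-1"] chi_minus_one_square[of b] chi_triv[OF that] by simp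
    then show ?thesis
      using chi_minus_one_square[of b] by (metis mult_right_cancel mult_zero_left zero_neq_one)
  qed
  moreover have "J a b = J b a"
    using fun_cong[OF conv_commute[of "\<chi> a" "\<chi> b"], of 1]
    by (simp add: conv_chi)
  ultimately show ?thesis
    by (auto simp: N_def add.commute)
qed

lemma m_dvd_cong: "m dvd a - a' \<Longrightarrow> m dvd a \<longleftrightarrow> m dvd a'"
  using dvd_add_right_iff[of m "a - a'" a'] by simp

lemma N_cong:
  assumes "m dvd a - a'" "m dvd b - b'" shows "N a b = N a' b'"
proof -
  have "m dvd (a + b) - (a' + b')"
    using dvd_add[OF assms] by (simp add: algebra_simps)
  then have "m dvd a + b \<longleftrightarrow> m dvd a' + b'" "m dvd a \<longleftrightarrow> m dvd a'" "m dvd b \<longleftrightarrow> m dvd b'"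
    using assms by (blast dest: m_dvd_cong)+
  then show ?thesis
    using chi_cong[OF assms(1)] chi_cong[OF assms(2)] by (simp add: N_def J_def)
qed

lemma N_triv [simp]: "N 0 b = 1" "N a 0 = 1"
  by (simp_all add: N_def)

lemma J_R: "J a b \<in> R"
  by (auto simp: J_def intro!: sum_R)

lemma N_R: "N a b \<in> R"
  by (simp add: N_def J_R)

lemma N_opposite: "m dvd a + b \<Longrightarrow> \<not> m dvd a \<Longrightarrow> N a b = \<chi> b (-1) * of_nat q"
  using dvd_add_left_iff[of m b a] by (auto simp: N_def)

lemma has_val_q: "has_val (of_nat q) n"
  using has_val_rho[of n] by (simp add: q_def)

lemma has_val_N_opposite: "m dvd a + b \<Longrightarrow> has_val (N a b) (if m dvd a then 0 else n)"
  using N_opposite[of a b] has_val_unit_mult[OF chi_unit has_val_q, of "-1" b]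
    has_val_unit[OF R_unit_1]
  by (auto simp: N_def)

text \<open>The cocycle identity at \<open>c = - b\<close>. It makes \<open>N a b\<close> a divisor
  of an element of known valuation, so \<open>has_val_factor\<close> applies.\<close>

lemma N_mult_opposite: "N a b * N (a + b) (- b) = N b (- b)"
  using N_cocycle[of a b "- b"] by simp

lemma has_val_N: "\<exists>k. has_val (N a b) k"
  using has_val_factor[OF N_R N_R] has_val_N_opposite[of b "- b"] N_mult_opposite
  by (metis add.right_inverse dvd_0_right)

section \<open>The valuation cocycle as a coboundary\<close>

definition V :: "int \<Rightarrow> int \<Rightarrow> nat" where
  "V a b = (THE k. has_val (N a b) k)"

lemma has_val_V: "has_val (N a b) (V a b)"
  unfolding V_def using has_val_N has_val_unique by (metis (mono_tags) theI)

lemma V_eqI: "has_val (N a b) k \<Longrightarrow> V a b = k"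
  using has_val_V has_val_unique by blast

lemma V_cocycle: "V a b + V (a + b) c = V b c + V a (b + c)"
  using has_val_mult[OF has_val_V has_val_V] N_cocycle has_val_unique by metis

lemma V_commute: "V a b = V b a"
  by (simp add: V_def N_commute)

lemma V_cong: "m dvd a - a' \<Longrightarrow> m dvd b - b' \<Longrightarrow> V a b = V a' b'"
  using N_cong by (simp add: V_def)

lemma V_triv [simp]: "V 0 b = 0" "V a 0 = 0"
  by (intro V_eqI; simp add: has_val_unit R_unit_1)+

lemma V_opposite: "V a (- a) = (if m dvd a then 0 else n)"
  by (intro V_eqI has_val_N_opposite) simp

text \<open>
  Averaging the cocycle \<open>V\<close> over the cyclic group exhibits it as a coboundary: \<open>F a\<close> plays the
  role of \<open>q - 1\<close> times the valuation of the Gauss sum \<open>g(a)\<close>.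
\<close>
definition F :: "int \<Rightarrow> int" where
  "F a = (\<Sum>c\<in>{0..<m}. int (V a c))"

text \<open>Sum the cocycle identity over \<open>c\<close>: the term \<open>V a b\<close> occurs
  \<open>m\<close> times, and translating \<open>c\<close> by \<open>b\<close> does not change a sum
  over a full period.\<close>

lemma F_coboundary: "m * int (V a b) = F a + F b - F (a + b)"
proof -
  have "(\<Sum>c\<in>{0..<m}. int (V a b) + int (V (a + b) c)) = (\<Sum>c\<in>{0..<m}. int (V b c) + int (V a (b + c)))"
    by (simp only: V_cocycle flip: of_nat_add)
  moreover have "(\<Sum>c\<in>{0..<m}. int (V a (c + b))) = (\<Sum>c\<in>{0..<m}. int (V a c))"
    by (rule sum_periodic) (use m_gt V_cong in auto)
  ultimately show ?thesis
    using m_gt by (simp add: F_def sum.distrib add.commute)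
qed

lemma F_0 [simp]: "F 0 = 0"
  by (simp add: F_def)

lemma F_cong: "m dvd a - b \<Longrightarrow> F a = F b"
  unfolding F_def by (intro sum.cong refl arg_cong[of _ _ int] V_cong) auto

lemma F_opposite: "\<not> m dvd a \<Longrightarrow> F a + F (- a) = m * int n"
  using F_coboundary[of a "- a"] by (simp add: V_opposite)

section \<open>Invariance under Frobenius\<close>

lemma power_p_diff: "(x - y :: 'f) ^ p = x ^ p - y ^ p"
  using freshmans_dream[OF CHAR_prime CHAR_F[symmetric], of "x - y" y]
  by (simp only: diff_add_cancel add_diff_cancel_right')

lemma chi_frobenius: "\<chi> (int p * a) x = \<chi> a (x ^ p)"
  using prime_p by (auto simp: \<chi>_def T_power power_int_power power_0_left)

lemma m_dvd_frobenius: "m dvd int p * a \<longleftrightarrow> m dvd a"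
proof -
  have "coprime (int q) m"
    using coprime_add_one_right[of m] by (simp add: m_def coprime_commute)
  then have "coprime m (int p)"
    using n_pos by (simp add: q_def coprime_commute)
  then show ?thesis
    by (simp add: coprime_dvd_mult_right_iff)
qed

text \<open>Multiplying an index by \<open>p\<close> precomposes the character with the field
  automorphism \<open>x ^ p\<close>, which commutes with \<open>1 - x\<close> and permutes the
  summation range.\<close>

lemma J_frobenius: "J (int p * a) (int p * b) = J a b"
proof -
  have inj: "inj (\<lambda>x::'f. x ^ p)"
  proof (rule injI)
    fix x y :: 'f assume "x ^ p = y ^ p"
    then have "(x - y) ^ p = 0"
      by (simp add: power_p_diff)
    then show "x = y"
      by simp
  qed
  then have bij: "bij (\<lambda>x::'f. x ^ p)"
    by (simp add: bij_def finite_UNIV_inj_surj)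
  have "J (int p * a) (int p * b) = (\<Sum>x\<in>UNIV. \<chi> a (x ^ p) * \<chi> b (1 - x ^ p))"
    unfolding J_def chi_frobenius power_p_diff by simp
  also have "\<dots> = J a b"
    unfolding J_def by (rule sum.reindex_bij_betw[OF bij])
  finally show ?thesis .
qed

lemma N_frobenius: "N (int p * a) (int p * b) = N a b"
proof -
  have "(-1) ^ p = (-1 :: 'f)"
    using power_p_diff[of 0 1] prime_p by (simp add: power_0_left)
  then show ?thesis
    using m_dvd_frobenius[of "a + b"]
    by (simp add: N_def m_dvd_frobenius J_frobenius chi_frobenius distrib_left)
qed

lemma V_frobenius: "V (int p * a) (int p * b) = V a b"
  by (simp add: V_def N_frobenius)

text \<open>The difference of both sides is an additive function on a finite group with values in \<open>\<int>\<close>.\<close>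
lemma F_frobenius: "F (int p * a) = F a"
proof -
  define G where "G a = F (int p * a) - F a" for a
  have add: "G (a + b) = G a + G b" for a b
    using F_coboundary[of a b] F_coboundary[of "int p * a" "int p * b"]
    by (simp add: G_def V_frobenius distrib_left)
  have "G (int k * a) = int k * G a" for k
    by (induction k) (simp_all add: G_def[of 0] add distrib_right)
  from this[of "q - 1"] have "m * G a = G (m * a)"
    by (simp add: m_eq)
  also have "\<dots> = 0"
    using F_cong[of "m * a" 0] F_cong[of "int p * (m * a)" 0] by (simp add: G_def)
  finally show ?thesis
    using m_gt by (simp add: G_def)
qed

end

section \<open>Valuations of Jacobi sums\<close>

definition dsum :: "nat \<Rightarrow> nat \<Rightarrow> nat \<Rightarrow> nat" where
  "dsum p k a = (\<Sum>i<k. a div p ^ i mod p)"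

lemma dsum_0 [simp]: "dsum p k 0 = 0"
  by (simp add: dsum_def)

lemma dsum_Suc: "dsum p (Suc k) a = a mod p + dsum p k (a div p)"
  by (simp add: dsum_def sum.lessThan_Suc_shift div_mult2_eq del: sum.lessThan_Suc)

lemma dsum_succ:
  assumes "k > 0" "\<not> p dvd Suc a" shows "dsum p k (Suc a) = Suc (dsum p k a)"
  using assms by (cases k) (simp_all add: dsum_Suc div_Suc mod_Suc dvd_eq_mod_eq_0 split: if_splits)

lemma dsum_mult:
  assumes "p * a < p ^ k" shows "dsum p k (p * a) = dsum p k a"
proof (cases k)
  case (Suc k')
  have "p > 0"
    using assms Suc by (cases p) auto
  moreover from this have "a < p ^ k'"
    using assms Suc by simp
  ultimately show ?thesis
    using dsum_Suc[of p k' "p * a"] by (simp add: Suc) (simp add: dsum_def)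
qed (use assms in \<open>simp add: dsum_def\<close>)

lemma dsum_max:
  assumes "p > 1" shows "dsum p k (p ^ k - 1) = k * (p - 1)"
proof (induction k)
  case (Suc k)
  have *: "p ^ Suc k - 1 = p * (p ^ k - 1) + (p - 1)"
    using assms by (simp add: algebra_simps)
  have "(p * x + r) mod p = r" "(p * x + r) div p = x" if "r < p" for x r
    using that by simp_all
  from this[of "p - 1" "p ^ k - 1"]
  have "(p ^ Suc k - 1) mod p = p - 1" "(p ^ Suc k - 1) div p = p ^ k - 1"
    unfolding * using assms by simp_all
  then show ?case
    unfolding dsum_Suc using Suc by simp
qed (simp add: dsum_def)

context teichmueller_lift
begin

section \<open>Reduction of Jacobi sums to the residue field\<close>

lemma sum_power_F:
  assumes "0 < k" "k < q - 1" shows "(\<Sum>x\<in>UNIV. x ^ k) = (0::'f)"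
proof -
  have "(\<Sum>x\<in>UNIV. x ^ k) = \<beta> ^ k * (\<Sum>x\<in>UNIV. x ^ k)"
    using sum_mult_reindex[of \<beta> "\<lambda>x. x ^ k"] by (simp add: power_mult_distrib sum_distrib_left)
  then show ?thesis
    using beta_order[OF assms] by (simp add: mult_cancel_right1)
qed

lemma red_chi: "x \<noteq> 0 \<Longrightarrow> red (\<chi> (int a) x) = inverse x ^ a"
proof -
  assume x: "x \<noteq> 0"
  have "red (T x ^ a) * red (inverse (T x ^ a)) = red 1"
    using x T_nz[OF x] T_powi_unit[OF x, of "- int a"]
    by (subst red_mult[symmetric]) (simp_all add: T_R R_unit_def power_int_minus)
  then have "x ^ a * red (\<chi> (int a) x) = 1"
    using x by (simp add: red_T T_R \<chi>_def power_int_minus)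
  then show ?thesis
    using x by (simp add: field_simps)
qed

text \<open>
  After the substitution \<open>x = 1 / y\<close> the reduction of the Jacobi sum becomes the sum of
  \<open>y ^ (a + 1) / (y - 1) = 1 + y + \<dots> + y ^ a + 1 / (y - 1)\<close> over \<open>y \<noteq> 0, 1\<close>.
\<close>
lemma red_J_1:
  assumes "a < q - 2" shows "red (J (int a) 1) = - of_nat (a + 1)"
proof -
  let ?U = "UNIV - {0, 1::'f}"
  have "red (J (int a) 1) = (\<Sum>x\<in>UNIV. red (\<chi> (int a) x) * red (\<chi> 1 (1 - x)))"
    by (simp add: J_def red_sum)
  also have "\<dots> = (\<Sum>x\<in>?U. red (\<chi> (int a) x) * red (\<chi> 1 (1 - x)))"
    by (rule sum.mono_neutral_right) auto
  also have "\<dots> = (\<Sum>x\<in>?U. inverse x ^ a * inverse (1 - x))"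
    using red_chi[of _ a] red_chi[of _ 1] by (intro sum.cong) auto
  also have "\<dots> = (\<Sum>y\<in>?U. y ^ a * inverse (1 - inverse y))"
    by (rule sum.reindex_bij_witness[of _ inverse inverse]) auto
  also have "\<dots> = (\<Sum>y\<in>?U. (\<Sum>k\<le>a. y ^ k) + inverse (y - 1))"
  proof (rule sum.cong)
    fix y assume y: "y \<in> ?U"
    then have nz: "y \<noteq> 0" "y - 1 \<noteq> 0" "1 - inverse y \<noteq> 0"
      by auto
    have "y ^ a * inverse (1 - inverse y) * (y - 1) = y ^ Suc a"
      using nz by (simp add: field_simps)
    moreover have "(\<Sum>k\<le>a. y ^ k) * (y - 1) = y ^ Suc a - 1"
      unfolding power_diff_1_eq[of y "Suc a"] lessThan_Suc_atMost by (rule mult.commute)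
    then have "((\<Sum>k\<le>a. y ^ k) + inverse (y - 1)) * (y - 1) = y ^ Suc a"
      unfolding distrib_right using nz by simp
    ultimately show "y ^ a * inverse (1 - inverse y) = (\<Sum>k\<le>a. y ^ k) + inverse (y - 1)"
      using nz(2) by (metis mult_right_cancel)
  qed simp
  also have "\<dots> = (\<Sum>k\<le>a. \<Sum>y\<in>?U. y ^ k) + (\<Sum>y\<in>?U. inverse (y - 1))"
    by (simp add: sum.distrib sum.swap[of _ _ ?U])
  \<comment> \<open>For \<open>k > 0\<close> the power sum over the whole field vanishes, and
    omitting \<open>y = 1\<close> leaves \<open>- 1\<close>. For \<open>k = 0\<close> there are
    \<open>q - 2\<close> terms, which is \<open>- 2\<close> in characteristic
    \<open>p\<close>.\<close>
  also have "(\<Sum>k\<le>a. \<Sum>y\<in>?U. y ^ k) = - 1 - of_nat (a + 1)"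
  proof -
    have "(\<Sum>y\<in>?U. y ^ k) = - 1" if "0 < k" "k \<le> a" for k
    proof -
      have "(\<Sum>y\<in>UNIV. y ^ k) = (\<Sum>y\<in>?U. y ^ k) + (\<Sum>y\<in>{0, 1::'f}. y ^ k)"
        by (rule sum.subset_diff) auto
      then show ?thesis
        using sum_power_F[of k] that assms by (simp add: eq_neg_iff_add_eq_0 power_0_left)
    qed
    then have "(\<Sum>k\<le>a. \<Sum>y\<in>?U. y ^ k) = (\<Sum>k\<le>a. - 1 - (if k = 0 then 1 else 0 :: 'f))"
      by (intro sum.cong) (use of_nat_q_F q_gt in \<open>auto simp: card_Diff_subset card_F of_nat_diff\<close>)
    also have "\<dots> = - 1 - of_nat (a + 1)"
      by (simp add: sum_subtractf sum_negf)
    finally show ?thesis .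
  qed
  \<comment> \<open>Over the whole field, with \<open>inverse 0 = 0\<close>, the sum vanishes; the
    omitted point \<open>y = 0\<close> accounts for \<open>- 1\<close>, the omitted point
    \<open>y = 1\<close> for nothing.\<close>
  also have "(\<Sum>y\<in>?U. inverse (y - 1)) = 1"
  proof -
    have "(\<Sum>y\<in>UNIV. inverse (y - 1 :: 'f)) = (\<Sum>y\<in>UNIV. inverse y)"
      using sum_plus_reindex[of inverse "- 1"] by simp
    also have "\<dots> = (\<Sum>y\<in>UNIV. y ^ 1)"
      by (rule sum.reindex_bij_witness[of _ inverse inverse]) auto
    also have "\<dots> = 0"
      using q_gt by (intro sum_power_F) auto
    finally have "(\<Sum>y\<in>UNIV. inverse (y - 1 :: 'f)) = 0" .
    moreover have "(\<Sum>y\<in>UNIV. inverse (y - 1)) =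
        (\<Sum>y\<in>?U. inverse (y - 1)) + (\<Sum>y\<in>{0, 1::'f}. inverse (y - 1))"
      by (rule sum.subset_diff) auto
    ultimately show ?thesis
      by simp
  qed
  finally show ?thesis
    by simp
qed

text \<open>The reduction of the Jacobi sum is \<open>- (a + 1)\<close>, nonzero in the residue
  field. The bound on \<open>a\<close> keeps \<open>a + 1\<close> away from the trivial character,
  where \<open>N\<close> is not a Jacobi sum.\<close>

lemma V_1:
  assumes "a < q - 2" "\<not> p dvd Suc a" shows "V (int a) 1 = 0"
proof (cases "a = 0")
  case False
  have "\<not> m dvd int a" "\<not> m dvd int a + 1"
    using False assms q_gt by (auto simp: m_def dest!: zdvd_imp_le)
  then have "N (int a) 1 = J (int a) 1"
    using not_m_dvd_1 by (simp add: N_def)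
  moreover have "of_nat (a + 1) \<noteq> (0::'f)"
    using assms CHAR_F of_nat_eq_0_iff_char_dvd[where 'a = 'f, of "a + 1"] by simp
  then have "red (J (int a) 1) \<noteq> 0"
    unfolding red_J_1[OF assms(1)] neg_equal_0_iff_equal .
  ultimately show ?thesis
    by (intro V_eqI has_val_unit) (simp add: R_unit_def J_R)
qed simp

text \<open>A final digit 0 is stripped by Frobenius invariance; any other final digit is lowered by
  one, which costs \<open>F 1\<close> since \<open>V (a - 1) 1 = 0\<close> there.\<close>

lemma F_dsum: "a < q - 1 \<Longrightarrow> F (int a) = int (dsum p n a) * F 1"
proof (induction a rule: less_induct)
  case (less a)
  consider "a = 0" | "a > 0" "p dvd a" | b where "a = Suc b" "\<not> p dvd Suc b"
    by (cases a) auto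
  then show ?case
  proof cases
    case 2
    then obtain c where c: "a = p * c"
      by blast
    moreover have "c < a"
      using 2 c prime_gt_1_nat[OF prime_p] by simp
    moreover have "p * c < p ^ n"
      using less.prems c q_def by simp
    ultimately show ?thesis
      using less.IH[of c] less.prems F_frobenius[of "int c"] dsum_mult[of p c n]
      by (metis of_nat_mult order.strict_trans)
  next
    case 3
    then have "F (int a) = F (int b) + F 1"
      using F_coboundary[of "int b" 1] V_1[of b] less.prems by (simp add: add.commute)
    then show ?thesis
      using 3 less dsum_succ[OF n_pos 3(2)] by (simp add: distrib_right)
  qed simp
qed

text \<open>
  Determined by the reflection \<open>F 1 + F (- 1) = m n\<close>; in terms of Gauss sums, \<open>g(1)\<close> has
  valuation \<open>1 / (p - 1)\<close>.
\<close>
lemma F_1: "F 1 * (int p - 1) = m"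
proof -
  have p: "p > 1"
    using prime_p prime_gt_1_nat by blast
  have "\<not> p dvd q - 1"
  proof
    assume "p dvd q - 1"
    moreover have "p dvd q"
      using n_pos by (simp add: q_def)
    ultimately show False
      using q_gt p by (metis dvd_diffD1 less_imp_le_nat less_one nat_dvd_1_iff_1 nat_neq_iff
          one_less_numeral_iff order_less_trans semiring_norm(76))
  qed
  moreover have q1: "q - 1 = Suc (q - 2)"
    using q_gt by simp
  \<comment> \<open>All \<open>n\<close> digits of \<open>q - 1\<close> equal \<open>p - 1\<close>,
    and \<open>q - 2\<close>, which represents \<open>- 1\<close>, has its last digit one
    lower.\<close>
  ultimately have "Suc (dsum p n (q - 2)) = n * (p - 1)"
    using dsum_succ[OF n_pos, of p "q - 2"] dsum_max[OF p, of n] by (simp add: q_def)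
  then have "int (Suc (dsum p n (q - 2))) = int n * int (p - 1)"
    by (simp only: of_nat_mult)
  then have d: "int (dsum p n (q - 2)) = int n * (int p - 1) - 1"
    using p by (simp add: of_nat_diff)
  have "- 1 - int (q - 2) = - m"
    using q_gt by (simp add: m_def of_nat_diff)
  then have "m dvd - 1 - int (q - 2)"
    by simp
  then have "F (- 1) = int (dsum p n (q - 2)) * F 1"
    using F_cong[of "- 1" "int (q - 2)"] F_dsum[of "q - 2"] q_gt by simp
  then have "int n * (F 1 * (int p - 1)) = int n * m"
    using F_opposite[OF not_m_dvd_1] d by (simp add: algebra_simps)
  then show ?thesis
    using n_pos by simp
qed

lemma V_dsum: "int (V a b) * (int p - 1) =
  int (dsum p n (nat (a mod m))) + int (dsum p n (nat (b mod m))) - int (dsum p n (nat ((a + b) mod m)))"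
proof -
  have F: "F a = int (dsum p n (nat (a mod m))) * F 1" for a
  proof -
    have "F a = F (int (nat (a mod m)))"
      using m_gt by (intro F_cong) (simp add: mod_eq_dvd_iff[symmetric])
    also have "\<dots> = int (dsum p n (nat (a mod m))) * F 1"
      using m_gt pos_mod_bound[of m a] m_eq by (intro F_dsum) linarith
    finally show ?thesis .
  qed
  have "m * (int (V a b) * (int p - 1)) = (F a + F b - F (a + b)) * (int p - 1)"
    by (simp add: F_coboundary flip: mult.assoc)
  also have "\<dots> = (int (dsum p n (nat (a mod m))) + int (dsum p n (nat (b mod m)))
      - int (dsum p n (nat ((a + b) mod m)))) * (F 1 * (int p - 1))"
    unfolding F[of a] F[of b] F[of "a + b"] by (simp add: algebra_simps)
  finally show ?thesis
    using m_gt by (simp add: F_1)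
qed

text \<open>By \<open>V_dsum\<close> the digit sums differ by a multiple of \<open>p - 1\<close>, so
  the integer division in \<open>carries\<close> is exact.\<close>

lemma carries_eq_V:
  assumes "n = 2 * t" shows "carries p t a b = int (V a b)"
proof -
  have "digit_sum p t a = int (dsum p n (nat (a mod m)))" for a
  proof -
    have "int p ^ (2 * t) - 1 = m"
      unfolding m_def unfolding q_def assms by simp
    then show ?thesis
      using m_gt by (simp add: digit_sum_def dsum_def assms zdiv_int zmod_int)
  qed
  then show ?thesis
    using V_dsum[of a b] prime_gt_1_nat[OF prime_p] by (simp add: carries_def flip: V_dsum)
qed

end

section \<open>The Laplacian of the Peisert graph\<close>

locale peisert = teichmueller_lift R red p "2 * t" q \<xi> \<beta>
  for R :: "'k::field_char_0 set" and red :: "'k \<Rightarrow> 'f::finite_field"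
    and p t q :: nat and \<xi> :: 'k and \<beta> :: 'f +
  assumes p_mod_4: "p mod 4 = 3"
begin

section \<open>Characters of order dividing 4 and the connection set\<close>

definition r :: int where "r = m div 4"

text \<open>Odd squares are 1 modulo 8. Modulus 8 is what makes \<open>r\<close> even and hence
  \<open>- 1\<close> a fourth power.\<close>

lemma q_mod_8: "q mod 8 = 1"
proof -
  obtain a where a: "p = 4 * a + 3"
    using p_mod_4 by (metis mult_div_mod_eq)
  have "p ^ 2 = 8 * (2 * a ^ 2 + 3 * a + 1) + 1"
    by (simp add: a power2_eq_square algebra_simps)
  then have "p ^ 2 mod 8 = 1"
    by presburger
  then have "(p ^ 2) ^ t mod 8 = 1"
    using power_mod[of "p ^ 2" 8 t] by simp
  then show ?thesis
    by (simp add: q_def power_mult)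
qed

lemma m_eq_4_r: "m = 4 * r" and r_even: "even r" and r_pos: "r > 0"
proof -
  have "int q mod 8 = 1"
    using q_mod_8 by (metis of_nat_1 of_nat_mod of_nat_numeral)
  then show "m = 4 * r" "even r"
    unfolding r_def m_def by presburger+
  then show "r > 0"
    using m_gt by simp
qed

lemma m_dvd_r_mult: "m dvd k * r \<longleftrightarrow> 4 dvd k"
  using r_pos by (simp add: m_eq_4_r)

lemma two_unit: "R_unit 2"
proof -
  have "(2::'f) \<noteq> 0"
  proof
    assume "(2::'f) = 0"
    then have "of_nat 2 = (0::'f)"
      by simp
    then have "p dvd 2"
      unfolding of_nat_eq_0_iff_char_dvd CHAR_F .
    then have "p \<le> 2"
      by (rule dvd_imp_le) simp
    then show False
      using p_mod_4 by (auto simp: le_Suc_eq numeral_2_eq_2)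
  qed
  then show ?thesis
    using red_of_nat[of 2] by (simp add: R_unit_def)
qed

lemma four_unit: "R_unit 4"
  using R_unit_mult[OF two_unit two_unit] by simp

lemma q1_unit: "R_unit (of_nat (q - 1))"
  unfolding R_unit_def red_of_nat of_nat_q1_F by simp

definition \<iota> :: 'k where "\<iota> = \<xi> ^ nat r"

lemma i_square: "\<iota> * \<iota> = - 1"
proof -
  have "(\<iota> * \<iota>) * (\<iota> * \<iota>) = \<xi> ^ (q - 1)"
  proof -
    have "nat r + nat r + (nat r + nat r) = q - 1"
      using m_eq m_eq_4_r r_pos by linarith
    then show ?thesis
      by (simp only: \<iota>_def flip: power_add)
  qed
  then have "(\<iota> * \<iota> - 1) * (\<iota> * \<iota> + 1) = 0"
    unfolding xi_pow by (simp add: algebra_simps)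
  moreover have "\<iota> * \<iota> = \<xi> ^ nat (2 * r)"
  proof -
    have "nat (2 * r) = nat r + nat r"
      using r_pos by simp
    then show ?thesis
      by (simp only: \<iota>_def power_add)
  qed
  then have "\<iota> * \<iota> \<noteq> 1"
    using xi_order[of "nat (2 * r)"] r_pos m_eq m_eq_4_r by simp
  ultimately show ?thesis
    by (simp add: eq_neg_iff_add_eq_0)
qed

lemma i_R: "\<iota> \<in> R"
  by (simp add: \<iota>_def xi_R)

lemma i_unit: "R_unit \<iota>"
  using i_R i_square by (intro R_unitI[of _ "- \<iota>"]) simp_all

lemma inverse_i: "inverse \<iota> = - \<iota>"
  using i_square by (intro inverse_unique) simp

lemma i_pow_4: "\<iota> ^ 4 = 1"
  by (simp add: numeral_eq_Suc i_square flip: mult.assoc)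

lemma i_powers: "\<iota> ^ 2 = - 1" "\<iota> ^ 3 = - \<iota>" "(- \<iota>) ^ 3 = \<iota>"
  by (simp_all add: power2_eq_square power3_eq_cube i_square)

lemma i_pow_mod: "\<iota> ^ j = \<iota> ^ (j mod 4)" "(- \<iota>) ^ j = (- \<iota>) ^ (j mod 4)"
proof -
  have *: "x ^ j = x ^ (j mod 4)" if "x ^ 4 = 1" for x :: 'k
  proof -
    have "x ^ j = x ^ (4 * (j div 4) + j mod 4)"
      by simp
    then show ?thesis
      unfolding power_add power_mult that by simp
  qed
  show "\<iota> ^ j = \<iota> ^ (j mod 4)"
    by (rule *[OF i_pow_4])
  have "(- \<iota>) ^ 4 = \<iota> ^ 4"
    by simp
  then show "(- \<iota>) ^ j = (- \<iota>) ^ (j mod 4)"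
    using i_pow_4 by (intro *) simp
qed

text \<open>The sign appears because \<open>\<chi> r\<close> is an inverse power of the Teichmueller
  character and \<open>inverse \<iota> = - \<iota>\<close>.\<close>

lemma chi_r: "\<chi> r (\<beta> ^ j) = (- \<iota>) ^ j"
proof -
  have "\<chi> r (\<beta> ^ j) = (\<xi> powi r) powi (- int j)"
    unfolding chi_beta by (simp flip: power_int_mult)
  also have "\<xi> powi r = \<iota>"
    using r_pos by (simp add: \<iota>_def power_int_nonneg_exp)
  also have "\<iota> powi (- int j) = (- \<iota>) ^ j"
    by (simp add: power_int_minus inverse_i flip: power_inverse)
  finally show ?thesis .
qed

lemma chi_2r: "\<chi> (2 * r) (\<beta> ^ j) = (- 1) ^ j"
  using chi_add[of r r "\<beta> ^ j"] i_square by (simp add: chi_r flip: mult_2 power_mult_distrib)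

lemma chi_3r: "\<chi> (3 * r) (\<beta> ^ j) = \<iota> ^ j"
  using chi_add[of "2 * r" r "\<beta> ^ j"] by (simp add: chi_r chi_2r flip: power_mult_distrib)

text \<open>The character \<open>\<chi> (3 * r)\<close> is 1 on fourth powers, and its value
  \<open>\<iota> ^ j\<close> determines \<open>j\<close> modulo 4.\<close>

lemma beta_power_in_fourth_powers: "\<beta> ^ j \<in> fourth_powers \<longleftrightarrow> 4 dvd j"
proof
  assume "\<beta> ^ j \<in> fourth_powers"
  then obtain y :: 'f where "y \<noteq> 0" "\<beta> ^ j = y ^ 4"
    by (auto simp: fourth_powers_def)
  then obtain i where "\<beta> ^ j = (\<beta> ^ i) ^ 4"
    by (auto elim: beta_generates)
  then have "\<iota> ^ j = (\<iota> ^ i) ^ 4"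
    using chi_3r[of j] chi_3r[of "i * 4"] by (simp add: power_mult)
  also have "\<dots> = 1"
    by (metis i_pow_4 mult.commute power_mult power_one)
  finally have "\<iota> ^ (j mod 4) = 1"
    by (simp only: i_pow_mod(1)[of j])
  moreover have "\<iota> \<noteq> 1" "\<iota> \<noteq> - 1"
    using i_square by auto
  moreover have "j mod 4 \<in> {0, 1, 2, 3}"
    by auto
  ultimately have "j mod 4 = 0"
    by (auto simp: i_powers) (metis minus_minus)
  then show "4 dvd j"
    by presburger
next
  assume "4 dvd j"
  then obtain i where "j = i * 4"
    by (metis dvdE mult.commute)
  then show "\<beta> ^ j \<in> fourth_powers"
    unfolding fourth_powers_def by (auto simp: power_mult intro!: exI[of _ "\<beta> ^ i"])
qed

lemma beta_power_in_beta_fourth_powers: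
  "\<beta> ^ j \<in> (\<lambda>x. \<beta> * x) ` fourth_powers \<longleftrightarrow> j mod 4 = 1"
proof -
  have "\<beta> ^ j \<in> (\<lambda>x. \<beta> * x) ` fourth_powers \<longleftrightarrow> inverse \<beta> * \<beta> ^ j \<in> fourth_powers"
    by (force simp: image_iff field_simps)
  also have "inverse \<beta> * \<beta> ^ j = \<beta> ^ (q - 2) * \<beta> ^ j"
  proof -
    have "\<beta> ^ (q - 2) * \<beta> = \<beta> ^ (q - 1)"
      using q_gt by (simp flip: power_Suc2 add: Suc_diff_le numeral_2_eq_2 Suc_diff_Suc)
    then show ?thesis
      using beta_pow by (simp add: field_simps)
  qed
  also have "\<dots> \<in> fourth_powers \<longleftrightarrow> 4 dvd (q - 2 + j)"
    by (simp add: beta_power_in_fourth_powers flip: power_add)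
  also have "\<dots> \<longleftrightarrow> j mod 4 = 1"
    using q_mod_8 q_gt by presburger
  finally show ?thesis .
qed

text \<open>\<open>\<alpha>\<close> and \<open>\<alpha>'\<close> are the Fourier coefficients, at
  \<open>\<chi> r\<close> and \<open>\<chi> (3 * r)\<close>, of the indicator of the exponents 0 and
  1 modulo 4. The coefficient at \<open>\<chi> (2 * r)\<close> is \<open>(1 - 1) / 4 = 0\<close>,
  that at the trivial character \<open>1 / 2\<close>.\<close>

definition \<alpha> :: 'k where "\<alpha> = (1 + \<iota>) / 4"
definition \<alpha>' :: 'k where "\<alpha>' = (1 - \<iota>) / 4"

lemma alpha_R: "\<alpha> \<in> R" "\<alpha>' \<in> R"
  unfolding \<alpha>_def \<alpha>'_def divide_inverse
  by (intro mult_R R_unit_R[OF R_unit_inverse[OF four_unit]]; simp add: i_R)+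

lemma alpha_mult: "\<alpha> * \<alpha>' = 1 / 8"
  by (simp add: \<alpha>_def \<alpha>'_def algebra_simps i_square)

lemma alpha_add: "\<alpha> + \<alpha>' = 1 / 2"
  by (simp add: \<alpha>_def \<alpha>'_def flip: add_divide_distrib)

lemma alpha_diff: "\<alpha>' * \<iota> - \<alpha> * \<iota> = 1 / 2"
  by (simp add: \<alpha>_def \<alpha>'_def algebra_simps i_square flip: diff_divide_distrib)

text \<open>The sum 0 removes the quadratic character from \<open>E h\<close>; the difference
  \<open>\<iota> / 4\<close> is a unit, which prevents cancellation in the block
  determinants.\<close>

lemma alpha_squares: "\<alpha> * \<alpha> = \<iota> / 8" "\<alpha>' * \<alpha>' = - \<iota> / 8"
  by (simp_all add: \<alpha>_def \<alpha>'_def algebra_simps i_square)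

lemma alpha_unit: "R_unit \<alpha>" "R_unit \<alpha>'"
  using R_unitI[OF alpha_R(1), of "8 * \<alpha>'"] R_unitI[OF alpha_R(2), of "8 * \<alpha>"] alpha_mult alpha_R
  by (simp_all add: field_simps)

lemma alpha_nz: "\<alpha> \<noteq> 0" "\<alpha>' \<noteq> 0"
  using alpha_unit R_unit_nz by auto

definition h :: "'f \<Rightarrow> 'k" where "h = (\<lambda>z. \<alpha> * e r z + \<alpha>' * e (3 * r) z)"

lemma e_r: "e r = \<chi> r" "e (2 * r) = \<chi> (2 * r)" "e (3 * r) = \<chi> (3 * r)"
  using m_dvd_r_mult[of 1] m_dvd_r_mult[of 2] m_dvd_r_mult[of 3] by (simp_all add: e_def)

lemma zero_not_in_peisert_set: "0 \<notin> peisert_set \<beta>"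
  by (auto simp: peisert_set_def fourth_powers_def)

lemma peisert_indicator:
  "(if z \<in> peisert_set \<beta> then 1 else 0) = (1 - basis_elt 0 z) / 2 + h z"
proof (cases "z = 0")
  case True
  then show ?thesis
    by (simp add: zero_not_in_peisert_set h_def e_r basis_elt_def)
next
  case False
  then obtain j where j: "z = \<beta> ^ j"
    by (rule beta_generates)
  have P: "z \<in> peisert_set \<beta> \<longleftrightarrow> j mod 4 = 0 \<or> j mod 4 = 1"
    by (simp add: j peisert_set_def beta_power_in_fourth_powers beta_power_in_beta_fourth_powers
        dvd_eq_mod_eq_0)
  have "h z = \<alpha> * (- \<iota>) ^ (j mod 4) + \<alpha>' * \<iota> ^ (j mod 4)"
    by (simp add: h_def e_r j chi_r chi_3r i_pow_mod[of j])
  moreover have "\<alpha>' = 1 / 2 - \<alpha>" "\<alpha>' * \<iota> = \<alpha> * \<iota> + 1 / 2"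
    using alpha_add alpha_diff by (metis eq_diff_eq add.commute, metis diff_eq_eq add.commute)
  moreover consider "j mod 4 = 0" | "j mod 4 = 1" | "j mod 4 = 2" | "j mod 4 = 3"
    by linarith
  then have "(if j mod 4 = 0 \<or> j mod 4 = 1 then 1 else 0) =
      1 / 2 + (\<alpha> * (- \<iota>) ^ (j mod 4) + \<alpha>' * \<iota> ^ (j mod 4))"
    by cases (simp_all add: i_powers calculation(2), simp_all add: calculation(3) flip: calculation(2))
  ultimately show ?thesis
    using False unfolding P by (simp add: basis_elt_def)
qed

section \<open>The operator \<open>E\<close> and the factorization of the Laplacian\<close>

definition E :: "('f \<Rightarrow> 'k) \<Rightarrow> 'f \<Rightarrow> 'k" where "E = conv h"

lemma linear_map_E: "linear_map E"
  unfolding E_def by (rule linear_map_conv)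

lemma mu_L_eq: "mu_L \<beta> f = (\<lambda>z. of_nat q / 2 * f z - sum f UNIV / 2 - E f z)"
proof
  fix z
  let ?k = "of_nat ((CARD('f) - 1) div 2) :: 'k"
  have k: "?k = (of_nat q - 1) / 2"
  proof -
    have "2 * ((q - 1) div 2) + 1 = q"
      using q_mod_8 by presburger
    then have "2 * of_nat ((q - 1) div 2) + 1 = (of_nat q :: 'k)"
      by (metis of_nat_1 of_nat_add of_nat_mult of_nat_numeral)
    then show ?thesis
      by (simp add: card_F field_simps)
  qed
  have "(\<Sum>y | y - x \<in> peisert_set \<beta>. basis_elt y z) = (1 - basis_elt 0 (z - x)) / 2 + h (z - x)" for x
  proof -
    have "(\<Sum>y | y - x \<in> peisert_set \<beta>. basis_elt y z) = (\<Sum>y | y - x \<in> peisert_set \<beta>. if y = z then 1 else 0 :: 'k)"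
      by (intro sum.cong) (auto simp: basis_elt_def)
    also have "\<dots> = (if z - x \<in> peisert_set \<beta> then 1 else 0)"
      by simp
    finally show ?thesis
      by (simp add: peisert_indicator)
  qed
  then have "mu_L \<beta> f z = (\<Sum>x\<in>UNIV. f x * (?k * basis_elt x z - ((1 - basis_elt 0 (z - x)) / 2 + h (z - x))))"
    by (simp add: mu_L_def lin_extend_def)
  \<comment> \<open>The degree term and the \<open>[0]\<close> part of the indicator are both
    multiples of the identity; together they give
    \<open>(q - 1) / 2 + 1 / 2 = q / 2\<close>.\<close>
  also have "\<dots> = (\<Sum>x\<in>UNIV. (?k + 1 / 2) * (f x * basis_elt 0 (z - x)) - f x / 2 - f x * h (z - x))"
    by (intro sum.cong) (auto simp: basis_elt_def field_simps)
  also have "\<dots> = (?k + 1 / 2) * conv f (basis_elt 0) z - sum f UNIV / 2 - conv f h z"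
    by (simp add: sum_subtractf conv_def sum_distrib_left sum_divide_distrib)
  also have "\<dots> = of_nat q / 2 * f z - sum f UNIV / 2 - E f z"
    unfolding k conv_basis_elt_right E_def conv_commute[of f h] by (simp add: field_simps)
  finally show "mu_L \<beta> f z = of_nat q / 2 * f z - sum f UNIV / 2 - E f z" .
qed

text \<open>If \<open>- 1 = \<beta> ^ j\<close>, then \<open>q - 1\<close> and so 8 divides
  \<open>2 * j\<close>; thus \<open>- 1\<close> is a fourth power and characters of order dividing 4
  are trivial on it.\<close>

lemma chi_minus_one: "\<chi> (k * r) (-1) = 1"
proof -
  have "(-1 :: 'f) \<noteq> 0"
    by simp
  then obtain j where j: "- 1 = \<beta> ^ j"
    by (rule beta_generates)
  have "\<beta> ^ (2 * j) = 1"
    by (simp add: power_mult power2_eq_square mult.commute flip: j)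
  then have "(q - 1) dvd 2 * j"
    by (simp add: beta_power_eq_1_iff)
  moreover have "8 dvd q - 1"
    using q_mod_8 by presburger
  ultimately have "8 dvd 2 * j"
    using dvd_trans by blast
  then have "4 dvd int j"
    by presburger
  then obtain c where "int j = 4 * c" ..
  then have "m dvd (k * r) * int j"
    by (simp add: m_eq_4_r)
  then have "\<xi> powi (- (k * r) * int j) = 1"
    using T_powi_cong[of \<beta> "- (k * r) * int j" 0] T_beta[of 1] by simp
  then show ?thesis
    by (simp add: j chi_beta)
qed

lemma N_r_3r: "N r (3 * r) = of_nat q" "N (3 * r) r = of_nat q"
  using N_opposite[of r "3 * r"] m_dvd_r_mult[of 1] chi_minus_one[of 3] N_commute[of r "3 * r"]
  by (simp_all add: m_eq_4_r)

text \<open>Since \<open>p\<close> is 3 modulo 4, Frobenius acts on multiples of \<open>r\<close> as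
  multiplication by 3, that is by \<open>- 1\<close>: it interchanges the two characters of order
  4.\<close>

lemma m_dvd_frobenius_r: "m dvd int p * (k * r) - 3 * k * r"
proof -
  define c where "c = int p div 4"
  have "int p = 4 * c + 3"
    using p_mod_4 unfolding c_def by presburger
  then have "int p * (k * r) - 3 * k * r = m * (c * k)"
    by (simp add: m_eq_4_r algebra_simps)
  then show ?thesis
    by simp
qed

lemma N_3r: "N (3 * k * r) (3 * l * r) = N (k * r) (l * r)"
  using N_cong[OF m_dvd_frobenius_r m_dvd_frobenius_r, of k l] N_frobenius[of "k * r" "l * r"] by simp

lemma F_3r: "F (3 * k * r) = F (k * r)"
  using F_cong[OF m_dvd_frobenius_r, of k] F_frobenius[of "k * r"] by simp

text \<open>Frobenius carries \<open>k * r\<close> to \<open>- k * r\<close> modulo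
  \<open>m\<close>, so the reflection formula reads \<open>2 * F (k * r) = 2 * t * m\<close>. This
  is the purity of semiprimitive Gauss sums.\<close>

lemma F_r: "F r = m * int t" "F (2 * r) = m * int t" "F (3 * r) = m * int t"
proof -
  have *: "F (k * r) = m * int t" if "\<not> 4 dvd k" for k
  proof -
    have "F (- (k * r)) = F (3 * k * r)"
      by (rule F_cong) (simp add: m_eq_4_r flip: distrib_right)
    then show ?thesis
      using F_opposite[of "k * r"] F_3r[of k] that m_dvd_r_mult[of k] by simp
  qed
  show "F r = m * int t" "F (2 * r) = m * int t" "F (3 * r) = m * int t"
    using *[of 1] *[of 2] *[of 3] by simp_all
qed

lemma V_r: "V r r = t" "V r (2 * r) = t"
  using F_coboundary[of r r] F_coboundary[of r "2 * r"] m_gt by (simp_all add: F_r flip: mult_2)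

lemma E_e: "E (e j) = (\<lambda>z. \<alpha> * (N r j * e (r + j) z + C r j) + \<alpha>' * (N (3 * r) j * e (3 * r + j) z + C (3 * r) j))"
  by (simp add: E_def h_def conv_add_left conv_scale_left conv_e)

lemma E_e_r:
  "E (e 0) = h"
  "E (e r) = (\<lambda>z. \<alpha> * N r r * e (2 * r) z + \<alpha>' * (of_nat q * e 0 z - 1))"
  "E (e (2 * r)) = (\<lambda>z. N r (2 * r) * (\<alpha> * e (3 * r) z + \<alpha>' * e r z))"
  "E (e (3 * r)) = (\<lambda>z. \<alpha> * (of_nat q * e 0 z - 1) + \<alpha>' * N r r * e (2 * r) z)"
proof -
  have e: "e (r + r) = e (2 * r)" "e (3 * r + r) = e 0" "e (r + 2 * r) = e (3 * r)"
    "e (3 * r + 2 * r) = e r" "e (r + 3 * r) = e 0" "e (4 * r) = e 0" "e (5 * r) = e r" "e (6 * r) = e (2 * r)" "e (3 * r + 3 * r) = e (2 * r)"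
    by (auto intro!: e_cong simp: m_eq_4_r)
  have c: "C r r = 0" "C (3 * r) r = - 1" "C r (2 * r) = 0" "C (3 * r) (2 * r) = 0"
    "C r (3 * r) = - 1" "C (3 * r) (3 * r) = 0" "C r 0 = 0" "C (3 * r) 0 = 0"
    using m_dvd_r_mult[of 1] m_dvd_r_mult[of 2] m_dvd_r_mult[of 3] m_dvd_r_mult[of 5]
      m_dvd_r_mult[of 6] chi_minus_one[of 1] chi_minus_one[of 3]
    by (simp_all add: C_def m_eq_4_r)
  have n: "N (3 * r) (3 * r) = N r r" "N (3 * r) (2 * r) = N r (2 * r)"
    using N_3r[of 1 1] N_3r[of 1 2] N_cong[of "3 * r" "3 * r" "6 * r" "2 * r"] by (simp_all add: m_eq_4_r)
  show "E (e 0) = h"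
    by (simp add: E_e c h_def)
  show "E (e r) = (\<lambda>z. \<alpha> * N r r * e (2 * r) z + \<alpha>' * (of_nat q * e 0 z - 1))"
    by (simp add: E_e e c N_r_3r mult.assoc)
  show "E (e (2 * r)) = (\<lambda>z. N r (2 * r) * (\<alpha> * e (3 * r) z + \<alpha>' * e r z))"
    by (simp add: E_e e c n) (simp add: distrib_left mult.left_commute)
  show "E (e (3 * r)) = (\<lambda>z. \<alpha> * (of_nat q * e 0 z - 1) + \<alpha>' * N r r * e (2 * r) z)"
    by (simp add: E_e e c n N_r_3r mult.assoc)
qed

text \<open>The two mixed terms carry \<open>2 * \<alpha> * \<alpha>' = 1 / 4\<close>; the terms at
  \<open>2 * r\<close> cancel because
  \<open>\<alpha> * \<alpha> + \<alpha>' * \<alpha>' = 0\<close>.\<close>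

lemma E_h: "E h = (\<lambda>z. of_nat q / 4 * basis_elt 0 z - 1 / 4)"
proof
  fix z
  have "E h z = \<alpha> * E (e r) z + \<alpha>' * E (e (3 * r)) z"
    unfolding h_def by (simp add: linear_map_add[OF linear_map_E] linear_map_scale[OF linear_map_E])
  also have "\<dots> = (\<alpha> * \<alpha> + \<alpha>' * \<alpha>') * N r r * e (2 * r) z + 2 * (\<alpha> * \<alpha>') * (of_nat q * e 0 z - 1)"
    unfolding E_e_r by (simp add: algebra_simps)
  finally show "E h z = of_nat q / 4 * basis_elt 0 z - 1 / 4"
    by (simp add: alpha_squares alpha_mult e_def algebra_simps)
qed

lemma E_E: "E (E f) = (\<lambda>z. of_nat q / 4 * f z - sum f UNIV / 4)"
proof -
  have "E (E f) = conv (E h) f"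
    by (simp add: E_def conv_assoc)
  also have "\<dots> = (\<lambda>z. of_nat q / 4 * f z - sum f UNIV / 4)"
    using conv_add_left[of "\<lambda>z. of_nat q / 4 * basis_elt 0 z" "\<lambda>z. - 1 / 4" f]
      conv_scale_left[of "of_nat q / 4" "basis_elt 0" f] conv_const_right[of f "- 1 / 4"]
    by (simp add: E_h conv_basis_elt_left conv_commute[of "\<lambda>z. - (1 / 4)"])
  finally show ?thesis .
qed

lemma sum_h: "sum h UNIV = 0"
  using sum_chi[of r] sum_chi[of "3 * r"] m_dvd_r_mult[of 1] m_dvd_r_mult[of 3]
  by (simp add: h_def e_r sum.distrib flip: sum_distrib_left)

lemma sum_E: "sum (E f) UNIV = 0"
  by (simp add: E_def sum_conv sum_h)

lemma E_const: "E (\<lambda>z. c) = (\<lambda>z. 0)"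
  by (simp add: E_def conv_const_right sum_h)

definition U :: "('f \<Rightarrow> 'k) \<Rightarrow> 'f \<Rightarrow> 'k" where "U f = (\<lambda>z. 2 * E f z - f z)"

text \<open>By \<open>E_E\<close>, \<open>(2 E - 1) (2 E + 1)\<close> is \<open>q - 1\<close> minus
  the map \<open>f \<mapsto> sum f UNIV\<close>. As \<open>E\<close> kills constants,
  \<open>2 E - 1\<close> negates them, so subtracting that map from the second factor removes the
  error.\<close>

definition U_inv :: "('f \<Rightarrow> 'k) \<Rightarrow> 'f \<Rightarrow> 'k" where
  "U_inv f = (\<lambda>z. (2 * E f z + f z - sum f UNIV) / of_nat (q - 1))"

lemma E_diff: "E (\<lambda>z. f z - g z) = (\<lambda>z. E f z - E g z)"
  using linear_map_add[OF linear_map_E, of f "\<lambda>z. - 1 * g z"] linear_map_scale[OF linear_map_E, of "- 1" g]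
  by simp

lemma E_add: "E (\<lambda>z. f z + g z) = (\<lambda>z. E f z + E g z)"
  by (rule linear_map_add[OF linear_map_E])

lemma E_scale: "E (\<lambda>z. c * f z) = (\<lambda>z. c * E f z)"
  by (rule linear_map_scale[OF linear_map_E])

lemma E_divide: "E (\<lambda>z. f z / c) = (\<lambda>z. E f z / c)"
  using E_scale[of "inverse c" f] by (simp add: divide_inverse mult.commute)

lemma linear_map_U: "linear_map U"
  by (simp add: linear_map_def U_def E_add E_scale algebra_simps)

lemma linear_map_mu_L: "linear_map (mu_L \<beta> :: ('f \<Rightarrow> 'k) \<Rightarrow> _)"
  by (simp add: linear_map_def mu_L_eq E_add E_scale sum.distrib flip: sum_distrib_left)
    (simp add: field_simps)

lemma U_E: "U (E f) = mu_L \<beta> f"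
  by (simp add: U_def E_E mu_L_eq)

lemma q1_nz: "of_nat (q - 1) \<noteq> (0::'k)"
  using R_unit_nz[OF q1_unit] .

lemma of_nat_q1: "of_nat (q - 1) = (of_nat q - 1 :: 'k)"
  using q_gt by (simp add: of_nat_diff)

lemma U_U_inv: "U (U_inv f) = f"
proof
  fix z
  have "U (U_inv f) z = (2 * (2 * E (E f) z + E f z) - (2 * E f z + f z - sum f UNIV)) / of_nat (q - 1)"
  proof -
    have "E (U_inv f) z = (2 * E (E f) z + E f z) / of_nat (q - 1)"
      by (simp add: U_inv_def E_divide E_diff E_add E_scale E_const)
    then show ?thesis
      by (simp only: U_def) (simp only: U_inv_def times_divide_eq_right diff_divide_distrib)
  qed
  also have "2 * (2 * E (E f) z + E f z) - (2 * E f z + f z - sum f UNIV) = of_nat (q - 1) * f z"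
    unfolding E_E of_nat_q1 by (simp add: algebra_simps)
  finally show "U (U_inv f) z = f z"
    using q1_nz by simp
qed

lemma sum_U: "sum (U f) UNIV = - sum f UNIV"
  by (simp add: U_def sum_subtractf sum_E flip: sum_distrib_left)

lemma U_inv_U: "U_inv (U f) = f"
proof
  fix z
  have "2 * E (U f) z + U f z - sum (U f) UNIV = of_nat (q - 1) * f z"
    unfolding sum_U by (simp add: U_def E_diff E_scale E_E of_nat_q1[unfolded One_nat_def] algebra_simps)
  then show "U_inv (U f) z = f z"
    using q1_nz by (simp add: U_inv_def)
qed

text \<open>
  As \<open>L = U \<circ> E\<close> with \<open>U = 2 E - 1\<close> invertible over \<open>R\<close>, the maps \<open>L\<close> and \<open>E\<close> have the same
  elementary divisors.
\<close>
lemma module_basis_map_U: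
  assumes "module_basis R M b"
    and add: "\<And>f g. f \<in> M \<Longrightarrow> g \<in> M \<Longrightarrow> (\<lambda>z. f z + g z) \<in> M"
    and scale: "\<And>c f. c \<in> R \<Longrightarrow> f \<in> M \<Longrightarrow> (\<lambda>z. c * f z) \<in> M"
    and E: "\<And>f. f \<in> M \<Longrightarrow> E f \<in> M"
    and const: "\<And>f. f \<in> M \<Longrightarrow> (\<lambda>z. sum f UNIV) \<in> M"
  shows "module_basis R M (map U b)"
proof (rule module_basis_image[OF assms(1) linear_map_U _ _ U_U_inv U_inv_U])
  fix f assume f: "f \<in> M"
  have "(\<lambda>z. 2 * E f z + (- 1) * f z) \<in> M"
    by (intro add scale E f) simp_all
  then show "U f \<in> M"
    by (simp add: U_def)
  have "inverse (of_nat (q - 1)) \<in> R"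
    using R_unit_R[OF R_unit_inverse[OF q1_unit]] .
  then have "(\<lambda>z. inverse (of_nat (q - 1)) * ((2 * E f z + f z) + (- 1) * sum f UNIV)) \<in> M"
    by (intro add scale E f const) simp_all
  then show "U_inv f \<in> M"
    by (simp add: U_inv_def divide_inverse mult.commute)
qed

section \<open>The action of the fourth powers and Fourier expansion\<close>

lemma act_eq: "y \<noteq> 0 \<Longrightarrow> act y f z = (f (z / y) :: 'k)"
proof -
  assume y: "y \<noteq> 0"
  have "act y f z = (\<Sum>x\<in>UNIV. if x = z / y then f x else 0)"
    unfolding act_def lin_extend_def
    by (intro sum.cong) (use y in \<open>auto simp: basis_elt_def field_simps\<close>)
  then show ?thesis
    by simp
qed

lemma fourth_powers_nz: "y \<in> fourth_powers \<Longrightarrow> y \<noteq> 0"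
  by (auto simp: fourth_powers_def)

text \<open>Moving \<open>[x]\<close> to \<open>[y x]\<close> means evaluating at
  \<open>z / y\<close>; solving for the value at \<open>y * z\<close> turns the \<open>i\<close>-th
  power of the Teichmueller character into its inverse \<open>\<chi> i\<close>.\<close>

lemma isotypic_iff:
  "f \<in> isotypic R \<xi> \<beta> i \<longleftrightarrow> range f \<subseteq> R \<and> (\<forall>y\<in>fourth_powers. \<forall>z. f (y * z) = \<chi> i y * f z)"
proof -
  have "act y f = (\<lambda>z. teichmueller \<xi> \<beta> y powi i * f z) \<longleftrightarrow> (\<forall>z. f (y * z) = \<chi> i y * f z)"
    if "y \<in> fourth_powers" for y
  proof -
    have y: "y \<noteq> 0"
      using that by (rule fourth_powers_nz)
    have *: "T y powi i * \<chi> i y = 1"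
      using y T_nz[OF y] by (simp add: \<chi>_def power_int_minus)
    have "act y f = (\<lambda>z. teichmueller \<xi> \<beta> y powi i * f z) \<longleftrightarrow> (\<forall>z. f (z / y) = T y powi i * f z)"
      using y by (simp add: fun_eq_iff act_eq flip: T_def)
    also have "\<dots> \<longleftrightarrow> (\<forall>z. f z = T y powi i * f (y * z))"
      using y by (metis nonzero_mult_div_cancel_left times_divide_eq_right)
    also have "\<dots> \<longleftrightarrow> (\<forall>z. f (y * z) = \<chi> i y * f z)"
    proof (intro iffI allI)
      fix z assume "\<forall>z. f z = T y powi i * f (y * z)"
      then have "\<chi> i y * f z = (T y powi i * \<chi> i y) * f (y * z)"
        by (metis mult.assoc mult.commute)
      then show "f (y * z) = \<chi> i y * f z"
        by (simp add: *)
    next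
      fix z assume "\<forall>z. f (y * z) = \<chi> i y * f z"
      then have "T y powi i * f (y * z) = (T y powi i * \<chi> i y) * f z"
        by (simp add: mult.assoc)
      then show "f z = T y powi i * f (y * z)"
        by (simp add: *)
    qed
    finally show ?thesis .
  qed
  then show ?thesis
    by (auto simp: isotypic_def)
qed

lemma chi_fourth_power: "y \<in> fourth_powers \<Longrightarrow> \<chi> (i + int k * r) y = \<chi> i y"
proof -
  assume "y \<in> fourth_powers"
  then obtain x where x: "x \<noteq> 0" "y = x ^ 4"
    by (auto simp: fourth_powers_def)
  have "\<chi> (int k * r) y = \<chi> (int k * r) x ^ 4"
    by (simp add: x numeral_eq_Suc chi_mult)
  also have "\<dots> = \<chi> (4 * (int k * r)) x"
  proof -
    have "4 * (int k * r) = (int k * r + int k * r) + (int k * r + int k * r)"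
      by simp
    then show ?thesis
      by (simp only: chi_add) (simp add: power4_eq_xxxx mult.assoc)
  qed
  also have "\<dots> = 1"
    using x by (simp add: chi_triv m_eq_4_r)
  finally show ?thesis
    by (simp add: chi_add)
qed

lemma chi_in_isotypic: "\<chi> (i + int k * r) \<in> isotypic R \<xi> \<beta> i"
  by (auto simp: isotypic_iff chi_mult chi_fourth_power)

lemma isotypic_add:
  "f \<in> isotypic R \<xi> \<beta> i \<Longrightarrow> g \<in> isotypic R \<xi> \<beta> i \<Longrightarrow> (\<lambda>z. f z + g z) \<in> isotypic R \<xi> \<beta> i"
  by (auto simp: isotypic_iff image_subset_iff distrib_left)

lemma isotypic_scale:
  "c \<in> R \<Longrightarrow> f \<in> isotypic R \<xi> \<beta> i \<Longrightarrow> (\<lambda>z. c * f z) \<in> isotypic R \<xi> \<beta> i"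
  by (auto simp: isotypic_iff image_subset_iff)

text \<open>The kernel \<open>h\<close> is invariant under multiplication by fourth powers, so
  convolution with it commutes with their action.\<close>

lemma isotypic_E:
  assumes "f \<in> isotypic R \<xi> \<beta> i" shows "E f \<in> isotypic R \<xi> \<beta> i"
  unfolding isotypic_iff
proof (intro conjI ballI allI image_subsetI)
  fix z
  have "h x \<in> R" for x
    by (simp add: h_def e_r alpha_R)
  then show "E f z \<in> R"
    using assms by (auto simp: E_def conv_def isotypic_iff image_subset_iff intro!: sum_R)
next
  fix y z assume y: "y \<in> (fourth_powers :: 'f set)"
  have "h (y * x) = h x" for x
    using chi_fourth_power[OF y, of 0 1] chi_fourth_power[OF y, of 0 3] fourth_powers_nz[OF y]
    by (simp add: h_def e_r chi_mult chi_triv[of 0])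
  moreover have "f (y * z - y * x) = \<chi> i y * f (z - x)" for x
    using assms y by (simp add: isotypic_iff flip: right_diff_distrib)
  ultimately show "E f (y * z) = \<chi> i y * E f z"
    using sum_mult_reindex[OF fourth_powers_nz[OF y], of "\<lambda>x. h x * f (y * z - x)"]
    by (simp add: E_def conv_def sum_distrib_left mult.left_commute)
qed

lemma isotypic_lincomb:
  assumes "set b \<subseteq> isotypic R \<xi> \<beta> i" "\<forall>k<length b. a k \<in> R"
  shows "lincomb a b \<in> isotypic R \<xi> \<beta> i"
  using assms
proof (induction b arbitrary: a)
  case Nil
  then show ?case
    by (simp add: isotypic_iff)
next
  case (Cons x b)
  have "\<forall>k<length b. a (Suc k) \<in> R"
    using Cons.prems by simp
  then show ?case
    using Cons unfolding lincomb_Cons by (intro isotypic_add isotypic_scale) force+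
qed

text \<open>Orthogonality for the cyclic quotient of order 4 by the fourth powers.\<close>

lemma sum_chi_r:
  assumes "w \<noteq> 0" "(\<Sum>k<4. \<chi> (int k * r) w) \<noteq> 0" shows "w \<in> fourth_powers"
proof -
  obtain j where j: "w = \<beta> ^ j"
    using assms(1) by (rule beta_generates)
  have "(\<Sum>k<4. \<chi> (int k * r) w) = 1 + (- \<iota>) ^ j + (- 1) ^ j + \<iota> ^ j"
    using assms(1) by (simp add: numeral_eq_Suc chi_triv[of 0])
      (simp add: j chi_r chi_2r[unfolded numeral_eq_Suc, simplified] chi_3r[unfolded numeral_eq_Suc, simplified])
  also have "\<dots> = 1 + (- \<iota>) ^ (j mod 4) + (- 1) ^ (j mod 4) + \<iota> ^ (j mod 4)"
  proof -
    have "even j \<longleftrightarrow> even (j mod 4)"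
      by presburger
    then have "(- 1) ^ j = ((- 1) ^ (j mod 4) :: 'k)"
      by (simp add: minus_one_power_iff)
    then show ?thesis
      using i_pow_mod[of j] by simp
  qed
  finally have *: "1 + (- \<iota>) ^ (j mod 4) + (- 1) ^ (j mod 4) + \<iota> ^ (j mod 4) \<noteq> 0"
    using assms(2) by simp
  consider "j mod 4 = 0" | "j mod 4 = 1" | "j mod 4 = 2" | "j mod 4 = 3"
    by linarith
  then have "j mod 4 = 0"
    by cases (use * in \<open>simp_all add: i_powers power3_eq_cube[of "- 1"]\<close>)
  then show ?thesis
    by (simp add: j beta_power_in_fourth_powers dvd_eq_mod_eq_0)
qed

text \<open>The functional dual to \<open>\<chi> a\<close>. The denominator is a unit of
  \<open>R\<close>, as it reduces to \<open>- 1\<close>, so coordinates stay integral.\<close>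

definition co :: "int \<Rightarrow> 'f \<Rightarrow> 'k" where "co a x = \<chi> (- a) x / of_nat (q - 1)"

lemma co_R: "co a x \<in> R"
  using R_unit_R[OF R_unit_inverse[OF q1_unit]] by (simp add: co_def divide_inverse)

lemma sum_co_chi: "(\<Sum>x\<in>UNIV. co a x * \<chi> b x) = (if m dvd b - a then 1 else 0)"
proof -
  have "(\<Sum>x\<in>UNIV. co a x * \<chi> b x) = sum (\<chi> (b - a)) UNIV / of_nat (q - 1)"
    using chi_add[of "- a" b] by (simp add: co_def sum_divide_distrib)
  then show ?thesis
    using sum_chi[of "b - a"] sum_chi_triv[of "b - a"] q1_nz by simp
qed

text \<open>The kernel \<open>K (z / x)\<close> is supported on pairs whose quotient is a fourth
  power, and there \<open>\<chi> i (z / x) * f x\<close> is already \<open>f z\<close>. What remains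
  is the total mass \<open>q - 1\<close> of \<open>K\<close>, which comes from the trivial
  character.\<close>

lemma isotypic_expand:
  assumes f: "f \<in> isotypic R \<xi> \<beta> i" and z: "z \<noteq> 0"
  shows "f z = (\<Sum>k<4. (\<Sum>x\<in>UNIV. co (i + int k * r) x * f x) * \<chi> (i + int k * r) z)"
proof -
  define K where "K w = (\<Sum>k<4. \<chi> (int k * r) w)" for w
  have K: "K (z * inverse x) * \<chi> i (z * inverse x) * f x = K (z * inverse x) * f z" if "x \<noteq> 0" for x
  proof (cases "K (z * inverse x) = 0")
    case False
    then have "z * inverse x \<in> fourth_powers"
      using that z by (intro sum_chi_r) (auto simp: K_def)
    then have "f (z * inverse x * x) = \<chi> i (z * inverse x) * f x"
      using f by (simp add: isotypic_iff)
    then show ?thesis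
      using that by (simp add: mult.assoc)
  qed simp
  have inv: "\<chi> (- a) x * \<chi> a z = \<chi> a (z * inverse x)" for a x
  proof (cases "x = 0")
    case False
    have "\<chi> (- a) x = \<chi> (- a) x * (\<chi> a x * \<chi> a (inverse x))"
      using False chi_mult[of a x "inverse x"] by simp
    also have "\<dots> = \<chi> a (inverse x)"
      using False chi_add[of "- a" a x] by (simp add: chi_triv flip: mult.assoc)
    finally show ?thesis
      by (simp add: chi_mult mult.commute)
  qed simp
  have "(\<Sum>k<4. (\<Sum>x\<in>UNIV. co (i + int k * r) x * f x) * \<chi> (i + int k * r) z)
      = (\<Sum>k<4. \<Sum>x\<in>UNIV. (\<chi> (- (i + int k * r)) x * \<chi> (i + int k * r) z) * f x) / of_nat (q - 1)"
    unfolding co_def sum_divide_distrib sum_distrib_right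
    by (intro sum.cong refl) simp
  also have "\<dots> = (\<Sum>x\<in>UNIV. K (z * inverse x) * \<chi> i (z * inverse x) * f x) / of_nat (q - 1)"
    unfolding inv by (subst sum.swap) (simp add: K_def chi_add sum_distrib_left sum_distrib_right mult.commute)
  also have "(\<Sum>x\<in>UNIV. K (z * inverse x) * \<chi> i (z * inverse x) * f x) = (\<Sum>x\<in>UNIV. K (z * inverse x) * f z)"
  proof (rule sum.cong)
    fix x show "K (z * inverse x) * \<chi> i (z * inverse x) * f x = K (z * inverse x) * f z"
      using K[of x] by (cases "x = 0") (simp_all add: K_def)
  qed simp
  also have "\<dots> = (\<Sum>x\<in>UNIV. K x) * f z"
    using sum_mult_reindex[OF z, of K] sum.reindex_bij_witness[of UNIV inverse inverse UNIV "\<lambda>x. K (z * x)" "\<lambda>x. K (z * inverse x)"]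
    by (simp flip: sum_distrib_right)
  also have "(\<Sum>x\<in>UNIV. K x) = of_nat (q - 1)"
  proof -
    have "(\<Sum>x\<in>UNIV. K x) = (\<Sum>k<4. sum (\<chi> (int k * r)) UNIV)"
      unfolding K_def by (rule sum.swap)
    also have "\<dots> = (\<Sum>k<4::nat. if k = 0 then of_nat (q - 1) else 0)"
    proof (rule sum.cong)
      fix k :: nat assume "k \<in> {..<4}"
      then have "m dvd int k * r \<longleftrightarrow> k = 0"
        unfolding m_dvd_r_mult by (auto dest: zdvd_imp_le)
      then show "sum (\<chi> (int k * r)) UNIV = (if k = 0 then of_nat (q - 1) else 0)"
        using sum_chi[of "int k * r"] sum_chi_triv[of "int k * r"] by simp
    qed simp
    finally show ?thesis
      by simp
  qed
  finally show ?thesis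
    using q1_nz by simp
qed

end

section \<open>Isotypic components\<close>

context peisert
begin

lemma isotypic_range: "f \<in> isotypic R \<xi> \<beta> i \<Longrightarrow> f z \<in> R"
  by (auto simp: isotypic_iff image_subset_iff)

lemma sum_co_chi_r:
  assumes "k < 4" "j < 4"
  shows "(\<Sum>x\<in>UNIV. co (i + int k * r) x * \<chi> (i + int j * r) x) = (if k = j then 1 else 0)"
proof -
  have "i + int j * r - (i + int k * r) = (int j - int k) * r"
    by (simp add: algebra_simps)
  then have "m dvd i + int j * r - (i + int k * r) \<longleftrightarrow> 4 dvd int j - int k"
    by (simp only: m_dvd_r_mult)
  also have "\<dots> \<longleftrightarrow> k = j"
    using assms by presburger
  finally show ?thesis
    by (simp add: sum_co_chi)
qed

lemma chi_nontrivial_on_fourth_powers: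
  assumes "0 < i" "i < r" shows "\<exists>y\<in>fourth_powers. \<chi> i y \<noteq> 1"
proof
  have "\<chi> i (\<beta> ^ 4) = \<chi> (4 * i) \<beta>"
    using chi_beta[of i 4] chi_beta[of "4 * i" 1] by (simp add: mult.commute)
  moreover have "\<not> m dvd 4 * i"
    using assms by (auto simp: m_eq_4_r dest: zdvd_imp_le)
  ultimately show "\<chi> i (\<beta> ^ 4) \<noteq> 1"
    using chi_beta_nontriv by simp
  show "\<beta> ^ 4 \<in> fourth_powers"
    by (simp add: beta_power_in_fourth_powers)
qed

text \<open>Some fourth power acts by a scalar other than 1, while evaluation at 0 and summation are
  invariant functionals.\<close>

lemma isotypic_zero:
  assumes "f \<in> isotypic R \<xi> \<beta> i" "0 < i" "i < r"
  shows "f 0 = 0" "sum f UNIV = 0"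
proof -
  obtain y where y: "y \<in> fourth_powers" "\<chi> i y \<noteq> 1"
    using chi_nontrivial_on_fourth_powers[OF assms(2,3)] by blast
  then have *: "f (y * z) = \<chi> i y * f z" for z
    using assms(1) by (simp add: isotypic_iff)
  show "f 0 = 0"
    using *[of 0] y by (simp add: mult_cancel_right1)
  have "sum f UNIV = \<chi> i y * sum f UNIV"
    using sum_mult_reindex[OF fourth_powers_nz[OF y(1)], of f] by (simp add: * sum_distrib_left)
  then show "sum f UNIV = 0"
    using y by (simp add: mult_cancel_right1)
qed

lemma upt_4: "[0..<4] = [0, 1, 2, 3]"
  by (simp add: upt_rec)

lemma module_basis_isotypic:
  assumes "0 < i" "i < r"
  shows "module_basis R (isotypic R \<xi> \<beta> i) [\<chi> i, \<chi> (i + r), \<chi> (i + 2 * r), \<chi> (i + 3 * r)]"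
proof -
  let ?b = "map (\<lambda>k. \<chi> (i + int k * r)) [0..<4]"
  have "module_basis R (isotypic R \<xi> \<beta> i) ?b"
  proof (rule module_basis_dual[where w = "\<lambda>k. co (i + int k * r)"])
    fix f assume f: "f \<in> isotypic R \<xi> \<beta> i"
    show "f = lincomb (\<lambda>k. \<Sum>x\<in>UNIV. co (i + int k * r) x * f x) ?b"
    proof
      fix z show "f z = lincomb (\<lambda>k. \<Sum>x\<in>UNIV. co (i + int k * r) x * f x) ?b z"
        using isotypic_expand[OF f, of z] isotypic_zero[OF f assms]
        by (cases "z = 0") (simp_all add: lincomb_def)
    qed
  next
    fix a :: "nat \<Rightarrow> 'k" assume "\<forall>k<length ?b. a k \<in> R"
    then show "lincomb a ?b \<in> isotypic R \<xi> \<beta> i"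
      by (intro isotypic_lincomb) (auto simp: chi_in_isotypic)
  qed (auto simp: sum_co_chi_r co_R isotypic_range intro!: sum_R)
  then show ?thesis
    by (simp add: upt_4)
qed

lemma isotypic_0_const: "c \<in> R \<Longrightarrow> (\<lambda>z. c) \<in> isotypic R \<xi> \<beta> 0"
  by (auto simp: isotypic_iff chi_triv[of 0] dest: fourth_powers_nz)

lemma isotypic_0_basis_elt: "basis_elt 0 \<in> isotypic R \<xi> \<beta> 0"
  by (auto simp: isotypic_iff chi_triv[of 0] basis_elt_def dest: fourth_powers_nz)

lemma module_basis_isotypic_0:
  "module_basis R (isotypic R \<xi> \<beta> 0) [basis_elt 0, \<chi> 0, \<chi> r, \<chi> (2 * r), \<chi> (3 * r)]"
proof -
  let ?b = "basis_elt 0 # map (\<lambda>k. \<chi> (0 + int k * r)) [0..<4]"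
  \<comment> \<open>Evaluation at 0 supplies the coordinate of \<open>[0]\<close>; the other
    functionals do not see it because every \<open>\<chi>\<close> vanishes at 0.\<close>
  define w where "w k = (case k of 0 \<Rightarrow> basis_elt 0 | Suc k \<Rightarrow> co (0 + int k * r))" for k
  have w_0: "(\<Sum>x\<in>UNIV. w 0 x * f x) = f 0" for f :: "'f \<Rightarrow> 'k"
    by (simp add: w_def basis_elt_def if_distrib[of "\<lambda>y. y * _"] cong: if_cong)
  have w_Suc: "w (Suc k) = co (0 + int k * r)" for k
    by (simp add: w_def)
  have "module_basis R (isotypic R \<xi> \<beta> 0) ?b"
  proof (rule module_basis_dual[where w = w])
    fix f assume f: "f \<in> isotypic R \<xi> \<beta> 0"
    show "f = lincomb (\<lambda>k. \<Sum>x\<in>UNIV. w k x * f x) ?b"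
    proof
      fix z show "f z = lincomb (\<lambda>k. \<Sum>x\<in>UNIV. w k x * f x) ?b z"
        using isotypic_expand[OF f, of z]
        by (cases "z = 0") (simp_all add: lincomb_Cons w_0 w_Suc basis_elt_def, simp_all add: lincomb_def)
    qed
    fix k assume "k < length ?b"
    show "(\<Sum>x\<in>UNIV. w k x * f x) \<in> R"
      using f by (cases k) (auto simp: w_0 w_Suc isotypic_range co_R intro!: sum_R)
  next
    fix a :: "nat \<Rightarrow> 'k" assume "\<forall>k<length ?b. a k \<in> R"
    then show "lincomb a ?b \<in> isotypic R \<xi> \<beta> 0"
      by (intro isotypic_lincomb) (auto simp: chi_in_isotypic[of 0, simplified] isotypic_0_basis_elt)
  next
    fix k j assume *: "k < length ?b" "j < length ?b"
    show "(\<Sum>x\<in>UNIV. w k x * (?b ! j) x) = (if k = j then 1 else 0)"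
    proof (cases k)
      case 0
      then show ?thesis
        using * by (cases j) (simp_all add: w_0, simp_all add: basis_elt_def)
    next
      case (Suc k')
      show ?thesis
      proof (cases j)
        case 0
        have "(\<Sum>x\<in>UNIV. co (int k' * r) x * basis_elt 0 x) = (\<Sum>x\<in>(UNIV::'f set). 0)"
          by (intro sum.cong) (auto simp: basis_elt_def co_def)
        then show ?thesis
          using 0 by (simp add: Suc w_Suc)
      next
        case (Suc j')
        then show ?thesis
          using * \<open>k = Suc k'\<close> sum_co_chi_r[of k' j' 0] by (simp add: w_Suc)
      qed
    qed
  qed
  then show ?thesis
    by (simp add: upt_4)
qed

text \<open>No index that occurs is divisible by \<open>m\<close>, so the constants \<open>C\<close>
  vanish and each \<open>e\<close> is a genuine character.\<close>

lemma E_chi: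
  assumes "\<not> r dvd j"
  shows "E (\<chi> j) = (\<lambda>z. \<alpha> * N r j * \<chi> (r + j) z + \<alpha>' * N (3 * r) j * \<chi> (3 * r + j) z)"
proof -
  have "\<not> m dvd k * r + j" for k
  proof
    assume "m dvd k * r + j"
    then have "r dvd k * r + j"
      by (rule dvd_trans[rotated]) (simp add: m_eq_4_r)
    then show False
      using assms by (simp add: dvd_add_right_iff)
  qed
  from this[of 0] this[of 1] this[of 3] show ?thesis
    using E_e[of j] by (simp add: e_def C_def mult.assoc)
qed

text \<open>
  In terms of Gauss sums both sides are \<open>g(r)\<^sup>2 g(j) g(j + 2 r) / (g(j + r) g(j + 3 r))\<close>, as
  \<open>g(r) = g(3 r)\<close>.
\<close>
lemma N_block: "N r j * N r (j + 2 * r) = N (3 * r) j * N (3 * r) (j + 2 * r)"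
proof -
  have c: "N b (r + 3 * r) = 1" "N j (3 * r + 3 * r) = N j (r + r)" for b
    using N_cong[of j j "3 * r + 3 * r" "r + r"] by (simp_all add: m_eq_4_r N_def[of b])
  have s: "j + 2 * r + r = j + 3 * r" "j + r + r = j + 2 * r"
    by simp_all
  let ?P = "N r j" and ?Q = "N r (j + 2 * r)" and ?P' = "N (3 * r) j" and ?Q' = "N (3 * r) (j + 2 * r)"
  let ?A = "N r (j + r)" and ?B = "N (3 * r) (j + 3 * r)"
  have 1: "?P * ?A = N r r * N j (r + r)"
    using N_cocycle[of j r r] by (simp only: N_commute[of j r] N_commute[of "j + r" r])
  have 2: "?P' * ?B = N r r * N j (r + r)"
    using N_cocycle[of j "3 * r" "3 * r"] N_3r[of 1 1]
    by (simp only: N_commute[of j "3 * r"] N_commute[of "j + 3 * r" "3 * r"] c mult_1 mult_1_right)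
  have 3: "?Q * ?B = of_nat q"
    using N_cocycle[of "j + 2 * r" r "3 * r"]
    by (simp only: s c N_r_3r mult_1_right N_commute[of "j + 2 * r" r] N_commute[of "j + 3 * r" "3 * r"])
  have 4: "?Q' * ?A = of_nat q"
    using N_cocycle[of "j + r" r "3 * r"]
    by (simp only: s c N_r_3r mult_1_right N_commute[of "j + r" r] N_commute[of "j + 2 * r" "3 * r"]
        mult.commute[of ?Q'])
  have "(?P * ?Q) * (?A * ?B) = (?P * ?A) * (?Q * ?B)"
    by (simp only: ac_simps)
  also have "\<dots> = (?P' * ?B) * (?Q' * ?A)"
    by (simp only: 1 2 3 4)
  also have "\<dots> = (?P' * ?Q') * (?A * ?B)"
    by (simp only: ac_simps)
  finally show ?thesis
    using has_val_nz[OF has_val_V, of r "j + r"] has_val_nz[OF has_val_V, of "3 * r" "j + 3 * r"] by simp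
qed

lemma V_block: "V r j + V r (j + 2 * r) = V (3 * r) j + V (3 * r) (j + 2 * r)"
  using has_val_mult[OF has_val_V[of r j] has_val_V[of r "j + 2 * r"]]
    has_val_mult[OF has_val_V[of "3 * r" j] has_val_V[of "3 * r" "j + 2 * r"]] N_block has_val_unique
  by metis

text \<open>Shifting by \<open>r\<close> and then by \<open>3 * r\<close> returns to the start: the
  cocycle identity gives the product \<open>N r (3 * r) = q\<close>. The valuations of one block are
  thus complementary to those of the other with respect to \<open>2 * t\<close>.\<close>

lemma V_inverse: "V r j + V (3 * r) (j + r) = 2 * t" "V (3 * r) j + V r (j + 3 * r) = 2 * t"
proof -
  have V0: "V b (r + 3 * r) = 0" "V b (3 * r + r) = 0" for b
    using V_cong[of b b "4 * r" 0] by (simp_all add: m_eq_4_r)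
  have q: "V r (3 * r) = 2 * t"
    by (rule V_eqI) (simp add: N_r_3r has_val_q)
  show "V r j + V (3 * r) (j + r) = 2 * t"
    using V_cocycle[of j r "3 * r"] V0 q V_commute[of j r] V_commute[of "j + r" "3 * r"] by simp
  show "V (3 * r) j + V r (j + 3 * r) = 2 * t"
    using V_cocycle[of j "3 * r" r] V0 q V_commute[of j "3 * r"] V_commute[of "j + 3 * r" r]
      V_commute[of "3 * r" r] by simp
qed

text \<open>By \<open>N_block\<close> the two products of structure constants agree, so the
  determinant is one of them times the unit
  \<open>\<alpha> * \<alpha> - \<alpha>' * \<alpha>' = \<iota> / 4\<close>.\<close>

lemma has_val_det:
  "has_val (\<alpha> * N r j * (\<alpha> * N r (j + 2 * r)) - \<alpha>' * N (3 * r) j * (\<alpha>' * N (3 * r) (j + 2 * r)))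
     (V r j + V r (j + 2 * r))"
proof -
  have "\<alpha> * N r j * (\<alpha> * N r (j + 2 * r)) - \<alpha>' * N (3 * r) j * (\<alpha>' * N (3 * r) (j + 2 * r))
      = \<alpha> * \<alpha> * (N r j * N r (j + 2 * r)) - \<alpha>' * \<alpha>' * (N (3 * r) j * N (3 * r) (j + 2 * r))"
    by (simp only: ac_simps)
  also have "\<dots> = \<iota> * inverse 4 * (N r j * N r (j + 2 * r))"
    unfolding N_block[symmetric] alpha_squares by (simp add: field_simps)
  finally show ?thesis
    by (simp only: has_val_unit_mult[OF R_unit_mult[OF i_unit R_unit_inverse[OF four_unit]]
        has_val_mult[OF has_val_V has_val_V]])
qed

lemma has_elementary_divisors_isotypic:
  assumes i: "0 < i" "i < r"
    and ts: "map fst ts = ks" "module_basis R (isotypic R \<xi> \<beta> i) (map (\<lambda>(k, x, y). x) ts)"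
      "module_basis R (isotypic R \<xi> \<beta> i) (map (\<lambda>(k, x, y). y) ts)"
      "\<forall>(k, x, y)\<in>set ts. E x = (\<lambda>z. of_nat p ^ k * y z)"
  shows "has_elementary_divisors R (of_nat p) (mu_L \<beta>) (isotypic R \<xi> \<beta> i) (isotypic R \<xi> \<beta> i)
    (mset (map (\<lambda>k. of_nat p ^ k) ks))"
proof -
  let ?M = "isotypic R \<xi> \<beta> i"
  \<comment> \<open>Because the Laplacian is \<open>U\<close> after \<open>E\<close>, the source
    basis and the exponents stay; only the target basis is transported by \<open>U\<close>.\<close>
  define ts' where "ts' = map (\<lambda>(k, x, y). (k, x, U y)) ts"
  have "module_basis R ?M (map U (map (\<lambda>(k, x, y). y) ts))"
  proof (rule module_basis_map_U[OF ts(3) isotypic_add isotypic_scale isotypic_E])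
    fix f assume "f \<in> ?M"
    then show "(\<lambda>z. sum f UNIV) \<in> ?M"
      using isotypic_zero(2)[OF _ i] by (auto simp: isotypic_iff)
  qed
  then have "has_elementary_divisors R (of_nat p) (mu_L \<beta>) ?M ?M
      (mset (map (\<lambda>(k, x, y). of_nat p ^ k) ts'))"
  proof (intro has_elementary_divisors_powersI)
    show "linear_map (mu_L \<beta> :: ('f \<Rightarrow> 'k) \<Rightarrow> _)"
      by (simp add: linear_map_mu_L)
    show "module_basis R ?M (map (\<lambda>(k, x, y). x) ts')"
      using ts(2) by (simp add: ts'_def case_prod_unfold comp_def)
    show "module_basis R ?M (map (\<lambda>(k, x, y). y) ts')"
      if "module_basis R ?M (map U (map (\<lambda>(k, x, y). y) ts))"
      using that by (simp add: ts'_def case_prod_unfold comp_def)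
    show "mu_L \<beta> x = (\<lambda>z. of_nat p ^ k * y z)" if xy: "(k, x, y) \<in> set ts'" for k x y
    proof -
      obtain y' where "(k, x, y') \<in> set ts" "y = U y'"
        using xy by (auto simp: ts'_def)
      then show ?thesis
        using ts(4) by (auto simp: linear_map_scale[OF linear_map_U] simp flip: U_E)
    qed
  qed
  moreover have "map (\<lambda>(k, x, y). of_nat p ^ k :: 'k) ts' = map (\<lambda>k. of_nat p ^ k) ks"
    by (simp add: ts'_def case_prod_unfold comp_def flip: ts(1))
  ultimately show ?thesis
    by (simp only:)
qed

text \<open>In each block one list gives the diagonal and the other the off-diagonal valuations,
  with equal sums. Equal sums mean that the list holding the least entry of a block also holds its
  greatest. Passing to the other block replaces every valuation by its complement to
  \<open>2 * t\<close>, so there the same list again holds the least entry.\<close>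

lemma elementary_divisors_isotypic:
  assumes i: "0 < i" "i < r"
  defines "A \<equiv> [V i r, V (i + r) (3 * r), V (i + 2 * r) r, V (i + 3 * r) (3 * r)]"
    and "B \<equiv> [V i (3 * r), V (i + r) r, V (i + 2 * r) (3 * r), V (i + 3 * r) r]"
  assumes ks: "ks = A \<or> ks = B" "x \<in> set ks" "\<forall>y\<in>set A \<union> set B. x \<le> y"
  shows "has_elementary_divisors R (of_nat p) (mu_L \<beta>) (isotypic R \<xi> \<beta> i) (isotypic R \<xi> \<beta> i)
    (mset (map (\<lambda>k. of_nat p ^ k) ks))"
proof -
  let ?M = "isotypic R \<xi> \<beta> i"
  define x\<^sub>0 x\<^sub>1 x\<^sub>2 x\<^sub>3 where x_defs: "x\<^sub>0 = \<chi> i" "x\<^sub>1 = \<chi> (i + r)" "x\<^sub>2 = \<chi> (i + 2 * r)" "x\<^sub>3 = \<chi> (i + 3 * r)"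
  have nd: "\<not> r dvd i + k * r" for k
    using i by (auto simp: dvd_add_left_iff dest: zdvd_imp_le)
  have cong: "\<chi> (r + i) = x\<^sub>1" "\<chi> (3 * r + i) = x\<^sub>3"
    "\<chi> (r + (i + r)) = x\<^sub>2" "\<chi> (3 * r + (i + r)) = x\<^sub>0"
    "\<chi> (r + (i + 2 * r)) = x\<^sub>3" "\<chi> (3 * r + (i + 2 * r)) = x\<^sub>1"
    "\<chi> (r + (i + 3 * r)) = x\<^sub>0" "\<chi> (3 * r + (i + 3 * r)) = x\<^sub>2"
    unfolding x_defs by (rule chi_cong; simp add: m_eq_4_r)+
  have E: "E x\<^sub>0 = (\<lambda>z. \<alpha> * N r i * x\<^sub>1 z + \<alpha>' * N (3 * r) i * x\<^sub>3 z)"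
    "E x\<^sub>1 = (\<lambda>z. \<alpha> * N r (i + r) * x\<^sub>2 z + \<alpha>' * N (3 * r) (i + r) * x\<^sub>0 z)"
    "E x\<^sub>2 = (\<lambda>z. \<alpha> * N r (i + 2 * r) * x\<^sub>3 z + \<alpha>' * N (3 * r) (i + 2 * r) * x\<^sub>1 z)"
    "E x\<^sub>3 = (\<lambda>z. \<alpha> * N r (i + 3 * r) * x\<^sub>0 z + \<alpha>' * N (3 * r) (i + 3 * r) * x\<^sub>2 z)"
    using E_chi[OF nd[of 0]] E_chi[OF nd[of 1]] E_chi[OF nd[of 2]] E_chi[OF nd[of 3]]
    by (simp_all only: x_defs(1)[symmetric] mult_zero_left add_0_right mult_1 cong)
      (simp_all only: x_defs)
  note E' = E[unfolded add.commute[of "\<alpha> * _ * _"]]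
  have basis: "module_basis R ?M [x\<^sub>0, x\<^sub>1, x\<^sub>2, x\<^sub>3]"
    using module_basis_isotypic[OF i] by (simp add: x_defs)
  \<comment> \<open>The source order, then two target orders: the second puts the entries of
    \<open>A\<close> on the block diagonals, the third those of \<open>B\<close>.\<close>
  have bases: "module_basis R ?M [x\<^sub>0, x\<^sub>2, x\<^sub>1, x\<^sub>3]" "module_basis R ?M [x\<^sub>1, x\<^sub>3, x\<^sub>0, x\<^sub>2]"
    "module_basis R ?M [x\<^sub>3, x\<^sub>1, x\<^sub>2, x\<^sub>0]"
    by (rule module_basis_mset_cong[OF basis]; simp add: add_mset_commute)+
  have val: "has_val (\<alpha> * N r j) (V r j)" "has_val (\<alpha>' * N (3 * r) j) (V (3 * r) j)" for j
    by (intro has_val_unit_mult alpha_unit has_val_V)+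
  have shift: "N b (i + 4 * r) = N b i" "V b (i + 4 * r) = V b i" for b
    using N_cong[of b b "i + 4 * r" i] V_cong[of b b "i + 4 * r" i] by (simp_all add: m_eq_4_r)
  have rel: "V r i + V (3 * r) (i + r) = 2 * t" "V (3 * r) i + V r (i + 3 * r) = 2 * t"
    "V r (i + 2 * r) + V (3 * r) (i + 3 * r) = 2 * t" "V (3 * r) (i + 2 * r) + V r (i + r) = 2 * t"
    "V r i + V r (i + 2 * r) = V (3 * r) i + V (3 * r) (i + 2 * r)"
    using V_inverse[of i] V_inverse(1)[of "i + 2 * r"] V_inverse(1)[of "i + r"] V_block[of i]
    by (simp_all add: add.commute)
  have det1: "has_val (\<alpha> * N r i * (\<alpha> * N r (i + 2 * r)) - \<alpha>' * N (3 * r) i * (\<alpha>' * N (3 * r) (i + 2 * r)))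
     (V r i + V r (i + 2 * r))"
    by (rule has_val_det)
  have det2: "has_val (\<alpha> * N r (i + r) * (\<alpha> * N r (i + 3 * r)) - \<alpha>' * N (3 * r) (i + r) * (\<alpha>' * N (3 * r) (i + 3 * r)))
     (V r (i + r) + V r (i + 3 * r))"
    using has_val_det[of "i + r"] by (simp add: add.assoc)
  have neg: "has_val (b * c - a * d) k" if "has_val (a * d - b * c) k" for a b c d k
    using has_val_unit_mult[OF R_unit_uminus[OF R_unit_1] that] by simp
  from ks(1) have "\<exists>ts. map fst ts = ks \<and> module_basis R ?M (map (\<lambda>(k, x, y). x) ts) \<and>
    module_basis R ?M (map (\<lambda>(k, x, y). y) ts) \<and> (\<forall>(k, x, y)\<in>set ts. E x = (\<lambda>z. of_nat p ^ k * y z))"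
  proof
    assume CA: "ks = A"
    have ks': "ks = [V r i, V (3 * r) (i + r), V r (i + 2 * r), V (3 * r) (i + 3 * r)]"
      by (simp add: CA A_def V_commute)
    have "V r i \<le> V (3 * r) i \<and> V r i \<le> V (3 * r) (i + 2 * r) \<or>
        V r (i + 2 * r) \<le> V (3 * r) i \<and> V r (i + 2 * r) \<le> V (3 * r) (i + 2 * r)"
      "V (3 * r) (i + r) \<le> V r (i + r) \<and> V (3 * r) (i + r) \<le> V r (i + 3 * r) \<or>
        V (3 * r) (i + 3 * r) \<le> V r (i + r) \<and> V (3 * r) (i + 3 * r) \<le> V r (i + 3 * r)"
      using ks(2,3) rel unfolding ks' A_def B_def V_commute[of _ r] V_commute[of _ "3 * r"] by auto
    moreover have "V (3 * r) (i + r) + V (3 * r) (i + 3 * r) = V r (i + r) + V r (i + 3 * r)"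
      using rel by linarith
    ultimately show ?thesis
      unfolding ks'
      using diagonalize_two_blocks[OF linear_map_E bases(1,2) E(1) E'(3,2) E(4)
          val(1) val(2) val(2) val(1) val(2) val(1) val(1) val(2)] det1 neg[OF det2] by presburger
  next
    assume CB: "ks = B"
    have ks': "ks = [V (3 * r) i, V r (i + r), V (3 * r) (i + 2 * r), V r (i + 3 * r)]"
      by (simp add: CB B_def V_commute)
    have "V (3 * r) i \<le> V r i \<and> V (3 * r) i \<le> V r (i + 2 * r) \<or>
        V (3 * r) (i + 2 * r) \<le> V r i \<and> V (3 * r) (i + 2 * r) \<le> V r (i + 2 * r)"
      "V r (i + r) \<le> V (3 * r) (i + r) \<and> V r (i + r) \<le> V (3 * r) (i + 3 * r) \<or>
        V r (i + 3 * r) \<le> V (3 * r) (i + r) \<and> V r (i + 3 * r) \<le> V (3 * r) (i + 3 * r)"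
      using ks(2,3) rel unfolding ks' A_def B_def V_commute[of _ r] V_commute[of _ "3 * r"] by auto
    then show ?thesis
      unfolding ks'
      using diagonalize_two_blocks[OF linear_map_E bases(1,3) E'(1) E(3) E(2) E'(4)
          val(2) val(1) val(1) val(2) val(1) val(2) val(2) val(1) neg[OF det1, unfolded rel(5)] det2]
      by blast
  qed
  then show ?thesis
    using has_elementary_divisors_isotypic[OF i] by blast
qed

text \<open>\<open>E\<close> maps \<open>[0]\<close> and \<open>\<chi> r\<close> to vectors of a
  basis, \<open>\<chi> (2 * r)\<close> and a combination of the two quartic characters to
  \<open>p ^ t\<close> times such vectors, and constants to 0. Here \<open>p ^ t\<close> comes from
  \<open>V r r = V r (2 * r) = t\<close>.\<close>

lemma elementary_divisors_isotypic_0: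
  "has_elementary_divisors R (of_nat p) (mu_L \<beta>) (isotypic R \<xi> \<beta> 0) (isotypic R \<xi> \<beta> 0)
     {#0, 1, 1, of_nat p ^ t, of_nat p ^ t#}"
proof -
  let ?M = "isotypic R \<xi> \<beta> 0"
  let ?d = "[1, 1, of_nat p ^ t, of_nat p ^ t, 0] :: 'k list"
  obtain u where u: "R_unit u" "N r r = u * of_nat p ^ t"
    using has_val_V[of r r] by (auto simp: V_r has_val_def)
  obtain u' where u': "R_unit u'" "N r (2 * r) = u' * of_nat p ^ t"
    using has_val_V[of r "2 * r"] by (auto simp: V_r has_val_def)
  have "R_unit (\<iota> * inverse 4)"
    by (intro R_unit_mult i_unit R_unit_inverse four_unit)
  moreover have "\<alpha> - \<alpha>' * \<alpha>' / \<alpha> = \<iota> * inverse 4 / \<alpha>" "\<alpha>' - \<alpha> * \<alpha> / \<alpha>' = - (\<iota> * inverse 4) / \<alpha>'"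
  proof -
    have "\<alpha> - \<alpha>' * \<alpha>' / \<alpha> = (\<alpha> * \<alpha> - \<alpha>' * \<alpha>') / \<alpha>" "\<alpha>' - \<alpha> * \<alpha> / \<alpha>' = (\<alpha>' * \<alpha>' - \<alpha> * \<alpha>) / \<alpha>'"
      using alpha_nz by (simp_all add: field_simps)
    moreover have "\<alpha> * \<alpha> - \<alpha>' * \<alpha>' = \<iota> * inverse 4" "\<alpha>' * \<alpha>' - \<alpha> * \<alpha> = - (\<iota> * inverse 4)"
      unfolding alpha_squares by (simp_all add: field_simps)
    ultimately show "\<alpha> - \<alpha>' * \<alpha>' / \<alpha> = \<iota> * inverse 4 / \<alpha>" "\<alpha>' - \<alpha> * \<alpha> / \<alpha>' = - (\<iota> * inverse 4) / \<alpha>'"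
      by (simp_all only:)
  qed
  ultimately have w: "R_unit (\<alpha> - \<alpha>' * \<alpha>' / \<alpha>)" "R_unit (\<alpha>' - \<alpha> * \<alpha> / \<alpha>')"
    using R_unit_divide[OF _ alpha_unit(1)] R_unit_divide[OF R_unit_uminus alpha_unit(2)] by metis+
  define v where "v = (\<alpha>' - \<alpha> * \<alpha> / \<alpha>') * u"
  \<comment> \<open>The ratio is chosen so that the terms \<open>of_nat q * [0] - 1\<close> in the
    images of the two quartic characters cancel, leaving a multiple of
    \<open>\<chi> (2 * r)\<close>.\<close>
  define b\<^sub>4 where "b\<^sub>4 = (\<lambda>z. \<chi> (3 * r) z - \<alpha> / \<alpha>' * \<chi> r z)"
  define c\<^sub>2 where "c\<^sub>2 = (\<lambda>z. \<alpha> * N r r * \<chi> (2 * r) z + \<alpha>' * (of_nat q * basis_elt 0 z - 1))"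
  define c\<^sub>3 where "c\<^sub>3 = (\<lambda>z. u' * (\<alpha> * \<chi> (3 * r) z + \<alpha>' * \<chi> r z))"
  define c\<^sub>4 where "c\<^sub>4 = (\<lambda>z. v * \<chi> (2 * r) z)"
  have v: "R_unit v"
    unfolding v_def by (intro R_unit_mult w u)
  have e_0: "e 0 = basis_elt 0"
    by (simp add: e_def)
  note E_simps = E_e_r[unfolded e_r e_0]
  have E\<^sub>4: "E b\<^sub>4 = (\<lambda>z. of_nat p ^ t * c\<^sub>4 z)"
  proof
    fix z
    have "E b\<^sub>4 z = E (\<chi> (3 * r)) z - \<alpha> / \<alpha>' * E (\<chi> r) z"
      unfolding b\<^sub>4_def by (simp only: E_diff E_scale)
    also have "\<dots> = (\<alpha>' - \<alpha> * \<alpha> / \<alpha>') * N r r * \<chi> (2 * r) z"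
      unfolding E_simps using alpha_nz by (simp add: field_simps)
    finally show "E b\<^sub>4 z = of_nat p ^ t * c\<^sub>4 z"
      by (simp only: c\<^sub>4_def v_def u ac_simps)
  qed
  have 1: "module_basis R ?M [\<lambda>z. 1, basis_elt 0, \<chi> r, \<chi> (2 * r), \<chi> (3 * r)]"
  proof -
    have "module_basis R ?M [\<chi> 0, basis_elt 0, \<chi> r, \<chi> (2 * r), \<chi> (3 * r)]"
      by (rule module_basis_mset_cong[OF module_basis_isotypic_0]) (simp add: add_mset_commute)
    moreover have "(\<lambda>z. 1 * \<chi> 0 z + 1 * basis_elt 0 z) = (\<lambda>z. 1)"
      by (auto simp: chi_triv basis_elt_def)
    ultimately show ?thesis
      using module_basis_modify_head[OF _ R_unit_1 one_R] by metis
  qed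
  have b: "module_basis R ?M [basis_elt 0, \<chi> r, \<chi> (2 * r), b\<^sub>4, \<lambda>z. 1]"
  proof -
    have "module_basis R ?M [\<chi> (3 * r), \<chi> r, basis_elt 0, \<chi> (2 * r), \<lambda>z. 1]"
      by (rule module_basis_mset_cong[OF 1]) (simp add: add_mset_commute)
    then have "module_basis R ?M [\<lambda>z. 1 * \<chi> (3 * r) z + - (\<alpha> / \<alpha>') * \<chi> r z, \<chi> r, basis_elt 0, \<chi> (2 * r), \<lambda>z. 1]"
      by (rule module_basis_modify_head[OF _ R_unit_1])
        (intro uminus_R R_unit_R R_unit_divide alpha_unit)
    then have "module_basis R ?M [b\<^sub>4, \<chi> r, basis_elt 0, \<chi> (2 * r), \<lambda>z. 1]"
      by (simp add: b\<^sub>4_def)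
    then show ?thesis
      by (rule module_basis_mset_cong) (simp add: add_mset_commute)
  qed
  have c: "module_basis R ?M [h, c\<^sub>2, c\<^sub>3, c\<^sub>4, basis_elt 0]"
  proof -
    \<comment> \<open>The constant function has coefficient \<open>- \<alpha>'\<close>, a unit, so
      \<open>c\<^sub>2\<close> can take its place. The vector \<open>[0]\<close> stays to complete
      the target basis, paired with the divisor 0.\<close>
    define g where "g = (\<lambda>z. - \<alpha>' * 1 + \<alpha>' * of_nat q * basis_elt (0::'f) z)"
    have "module_basis R ?M [g, basis_elt 0, \<chi> r, \<chi> (2 * r), \<chi> (3 * r)]"
      unfolding g_def using module_basis_modify_head[OF 1 R_unit_uminus[OF alpha_unit(2)]] alpha_R by simp
    then have "module_basis R ?M [g, \<chi> (2 * r), basis_elt 0, \<chi> r, \<chi> (3 * r)]"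
      by (rule module_basis_mset_cong) (simp add: add_mset_commute)
    then have "module_basis R ?M [\<lambda>z. 1 * g z + \<alpha> * N r r * \<chi> (2 * r) z, \<chi> (2 * r), basis_elt 0, \<chi> r, \<chi> (3 * r)]"
      by (rule module_basis_modify_head[OF _ R_unit_1]) (simp add: alpha_R N_R)
    moreover have "(\<lambda>z. 1 * g z + \<alpha> * N r r * \<chi> (2 * r) z) = c\<^sub>2"
      by (simp add: g_def c\<^sub>2_def algebra_simps)
    ultimately have "module_basis R ?M [c\<^sub>2, \<chi> (2 * r), basis_elt 0, \<chi> r, \<chi> (3 * r)]"
      by simp
    then have "module_basis R ?M [\<chi> (2 * r), c\<^sub>2, basis_elt 0, \<chi> r, \<chi> (3 * r)]"
      by (rule module_basis_mset_cong) (simp add: add_mset_commute)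
    then have "module_basis R ?M [c\<^sub>4, c\<^sub>2, basis_elt 0, \<chi> r, \<chi> (3 * r)]"
      unfolding c\<^sub>4_def by (rule module_basis_scale_head[OF _ v])
    then have "module_basis R ?M [\<chi> r, \<chi> (3 * r), c\<^sub>4, c\<^sub>2, basis_elt 0]"
      by (rule module_basis_mset_cong) (simp add: add_mset_commute)
    then have "module_basis R ?M [h, \<chi> (3 * r), c\<^sub>4, c\<^sub>2, basis_elt 0]"
      unfolding h_def e_r by (rule module_basis_modify_head[OF _ alpha_unit(1) alpha_R(2)])
    then have "module_basis R ?M [\<chi> (3 * r), h, c\<^sub>4, c\<^sub>2, basis_elt 0]"
      by (rule module_basis_mset_cong) (simp add: add_mset_commute)
    \<comment> \<open>Up to \<open>u'\<close>, \<open>c\<^sub>3\<close> is \<open>h\<close> with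
      \<open>\<alpha>\<close> and \<open>\<alpha>'\<close> exchanged. Rewritten through
      \<open>h\<close>, its coefficient at \<open>\<chi> (3 * r)\<close> is a unit, again because
      \<open>\<alpha> * \<alpha> - \<alpha>' * \<alpha>'\<close> is one.\<close>
    then have "module_basis R ?M [\<lambda>z. u' * (\<alpha> - \<alpha>' * \<alpha>' / \<alpha>) * \<chi> (3 * r) z + u' * (\<alpha>' / \<alpha>) * h z, h, c\<^sub>4, c\<^sub>2, basis_elt 0]"
      by (rule module_basis_modify_head) (intro R_unit_R R_unit_mult R_unit_divide u' w alpha_unit)+
    moreover have "(\<lambda>z. u' * (\<alpha> - \<alpha>' * \<alpha>' / \<alpha>) * \<chi> (3 * r) z + u' * (\<alpha>' / \<alpha>) * h z) = c\<^sub>3"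
      unfolding c\<^sub>3_def h_def e_r using alpha_nz by (intro ext) (simp add: field_simps)
    ultimately have "module_basis R ?M [c\<^sub>3, h, c\<^sub>4, c\<^sub>2, basis_elt 0]"
      by simp
    then show ?thesis
      by (rule module_basis_mset_cong) (simp add: add_mset_commute)
  qed
  have "module_basis R ?M (map U [h, c\<^sub>2, c\<^sub>3, c\<^sub>4, basis_elt 0])"
  proof (rule module_basis_map_U[OF c isotypic_add isotypic_scale isotypic_E])
    fix f :: "'f \<Rightarrow> 'k" assume "f \<in> ?M"
    then show "(\<lambda>z. sum f UNIV) \<in> ?M"
      using isotypic_range by (intro isotypic_0_const sum_R) blast
  qed
  then have "has_elementary_divisors R (of_nat p) (mu_L \<beta>) ?M ?M (mset ?d)"
  proof (rule has_elementary_divisorsI[OF linear_map_mu_L b])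
    fix k assume "k < length [basis_elt 0, \<chi> r, \<chi> (2 * r), b\<^sub>4, \<lambda>z. 1]"
    then consider "k = 0" | "k = 1" | "k = 2" | "k = 3" | "k = 4"
      by fastforce
    moreover have "E (\<chi> (2 * r)) = (\<lambda>z. of_nat p ^ t * c\<^sub>3 z)"
      unfolding E_simps u' c\<^sub>3_def by (simp only: ac_simps)
    ultimately show "mu_L \<beta> ([basis_elt 0, \<chi> r, \<chi> (2 * r), b\<^sub>4, \<lambda>z. 1] ! k) =
        (\<lambda>z. ?d ! k * (map U [h, c\<^sub>2, c\<^sub>3, c\<^sub>4, basis_elt 0] ! k) z)"
      by cases (simp_all add: U_E[symmetric] E_simps(1,2) E\<^sub>4 c\<^sub>2_def E_const
          linear_map_scale[OF linear_map_U] linear_map_zero[OF linear_map_U])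
  next
    fix k assume "Suc k < length ?d"
    then consider "k = 0" | "k = 1" | "k = 2" | "k = 3"
      by fastforce
    then show "\<exists>u\<in>R. ?d ! Suc k = u * ?d ! k"
    proof cases
      case 1
      then show ?thesis by (intro bexI[of _ 1]) auto
    next
      case 2
      then show ?thesis by (intro bexI[of _ "of_nat p ^ t"]) auto
    next
      case 3
      then show ?thesis by (intro bexI[of _ 1]) auto
    next
      case 4
      then show ?thesis by (intro bexI[of _ 0]) auto
    qed
  next
    fix x assume "x \<in> set ?d"
    then show "x = 0 \<or> (\<exists>k. x = of_nat p ^ k)"
      by (auto intro: exI[of _ 0])
  qed simp_all
  then show ?thesis
    by (simp add: add_mset_commute)
qed

end

section \<open>Localization at a prime ideal\<close>

lemma int_adjoin_generator: "\<xi> \<in> int_adjoin \<xi>"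
  unfolding int_adjoin_def by (rule range_eqI[of _ _ "[:0, 1:]"]) (simp add: map_poly_pCons)

text \<open>Translates the structure-based ideal predicate into closure rules for plain sets of
  field elements.\<close>

locale prime_of_subring =
  fixes A \<pi> :: "'k::field set"
  assumes primeideal: "primeideal \<pi> (subring_on A)"
begin

sublocale I: primeideal \<pi> "subring_on A"
  by (rule primeideal)

lemma one_A: "1 \<in> A"
  using I.one_closed by (simp add: ring_of_type_algebra_def)

lemma add_A: "x \<in> A \<Longrightarrow> y \<in> A \<Longrightarrow> x + y \<in> A"
  using I.add.m_closed[of x y] by (simp add: ring_of_type_algebra_def)

lemma mult_A: "x \<in> A \<Longrightarrow> y \<in> A \<Longrightarrow> x * y \<in> A"
  using I.m_closed[of x y] by (simp add: ring_of_type_algebra_def)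

lemma uminus_A:
  assumes "x \<in> A" shows "- x \<in> A"
proof -
  have "\<exists>y\<in>carrier (subring_on A). y \<oplus>\<^bsub>subring_on A\<^esub> x = \<zero>\<^bsub>subring_on A\<^esub>"
    using I.add.l_inv_ex[of x] assms by (simp add: ring_of_type_algebra_def)
  then obtain y where "y \<in> A" "y + x = 0"
    by (auto simp: ring_of_type_algebra_def)
  then show ?thesis
    by (metis eq_neg_iff_add_eq_0)
qed

lemma power_A: "x \<in> A \<Longrightarrow> x ^ n \<in> A"
  by (induction n) (simp_all add: one_A mult_A)

lemma ideal_subset: "\<pi> \<subseteq> A"
  using I.a_subset by (simp add: ring_of_type_algebra_def)

lemma add_ideal: "x \<in> \<pi> \<Longrightarrow> y \<in> \<pi> \<Longrightarrow> x + y \<in> \<pi>"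
  using additive_subgroup.a_closed[OF I.additive_subgroup_axioms, of x y] by (simp add: ring_of_type_algebra_def)

lemma zero_ideal: "0 \<in> \<pi>"
  using additive_subgroup.zero_closed[OF I.additive_subgroup_axioms] by (simp add: ring_of_type_algebra_def)

lemma mult_ideal: "x \<in> A \<Longrightarrow> y \<in> \<pi> \<Longrightarrow> x * y \<in> \<pi>"
  using I.I_l_closed[of y x] by (simp add: ring_of_type_algebra_def)

lemma prime_ideal: "x \<in> A \<Longrightarrow> y \<in> A \<Longrightarrow> x * y \<in> \<pi> \<Longrightarrow> x \<in> \<pi> \<or> y \<in> \<pi>"
  using I.I_prime[of x y] by (simp add: ring_of_type_algebra_def)

lemma one_not_ideal: "1 \<notin> \<pi>"
proof
  assume "1 \<in> \<pi>"
  then have "A \<subseteq> \<pi>"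
    using mult_ideal[of _ 1] by auto
  then show False
    using I.I_notcarr ideal_subset by (auto simp: ring_of_type_algebra_def)
qed

lemma power_ideal: "x \<in> A \<Longrightarrow> x ^ n \<in> \<pi> \<Longrightarrow> x \<in> \<pi>"
  by (induction n) (use one_not_ideal prime_ideal power_A in auto)

lemma localizeI: "a \<in> A \<Longrightarrow> b \<in> A \<Longrightarrow> b \<notin> \<pi> \<Longrightarrow> a / b \<in> localize_at A \<pi>"
  by (auto simp: localize_at_def)

lemma localizeE:
  assumes "x \<in> localize_at A \<pi>"
  obtains a b where "a \<in> A" "b \<in> A" "b \<notin> \<pi>" "b \<noteq> 0" "x = a / b"
  using assms zero_ideal by (auto simp: localize_at_def)

lemma subset_localize: "A \<subseteq> localize_at A \<pi>"
  using localizeI[OF _ one_A one_not_ideal] by force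

lemma add_localize:
  assumes "x \<in> localize_at A \<pi>" "y \<in> localize_at A \<pi>" shows "x + y \<in> localize_at A \<pi>"
proof -
  obtain a b c d where x: "a \<in> A" "b \<in> A" "b \<notin> \<pi>" "b \<noteq> 0" "x = a / b"
    and y: "c \<in> A" "d \<in> A" "d \<notin> \<pi>" "d \<noteq> 0" "y = c / d"
    using assms by (auto elim!: localizeE)
  have "(a * d + c * b) / (b * d) \<in> localize_at A \<pi>"
    using x y prime_ideal by (intro localizeI add_A mult_A) auto
  then show ?thesis
    using x y by (simp add: add_frac_eq)
qed

lemma mult_localize:
  assumes "x \<in> localize_at A \<pi>" "y \<in> localize_at A \<pi>" shows "x * y \<in> localize_at A \<pi>"
proof -
  obtain a b c d where x: "a \<in> A" "b \<in> A" "b \<notin> \<pi>" "x = a / b"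
    and y: "c \<in> A" "d \<in> A" "d \<notin> \<pi>" "y = c / d"
    using assms by (auto elim!: localizeE)
  have "(a * c) / (b * d) \<in> localize_at A \<pi>"
    using x y prime_ideal by (intro localizeI mult_A) auto
  then show ?thesis
    using x y by simp
qed

text \<open>
  If \<open>x = a / b\<close> with \<open>a\<close> in the prime ideal reduced to a nonzero element of a finite field, then
  \<open>x ^ k - 1\<close> would lie in the maximal ideal for \<open>k = CARD('f) - 1\<close>, and clearing denominators would
  put a denominator into the prime ideal.
\<close>
lemma residue_dvr_localize:
  fixes red :: "'k \<Rightarrow> 'f::finite_field"
  assumes red: "reduction_map (localize_at A \<pi>) \<rho> red" and \<rho>: "\<rho> \<in> \<pi>" "\<rho> \<noteq> 0"
  shows "residue_dvr (localize_at A \<pi>) red \<rho>"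
proof
  let ?R = "localize_at A \<pi>"
  have hom: "red \<in> ring_hom (subring_on ?R) ring_of_type_algebra"
    and ker: "a_kernel (subring_on ?R) ring_of_type_algebra red = {\<rho> * a | a. a \<in> ?R}"
    using red by (auto simp: reduction_map_def)
  show one: "1 \<in> ?R"
    using subset_localize one_A by blast
  show uminus: "- x \<in> ?R" if "x \<in> ?R" for x
    using mult_localize[OF subsetD[OF subset_localize uminus_A[OF one_A]] that] by simp
  show red_add: "red (x + y) = red x + red y" if "x \<in> ?R" "y \<in> ?R" for x y
    using ring_hom_add[OF hom, of x y] that by (simp add: ring_of_type_algebra_def)
  show red_mult: "red (x * y) = red x * red y" if "x \<in> ?R" "y \<in> ?R" for x y
    using ring_hom_mult[OF hom, of x y] that by (simp add: ring_of_type_algebra_def)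
  show red_1: "red 1 = 1"
    using ring_hom_one[OF hom] by (simp add: ring_of_type_algebra_def)
  have red_0: "red x = 0 \<longleftrightarrow> (\<exists>a\<in>?R. x = \<rho> * a)" if "x \<in> ?R" for x
    using ker that unfolding a_kernel_def' by (auto simp: ring_of_type_algebra_def set_eq_iff)
  then show "red x = 0 \<longleftrightarrow> (\<exists>a\<in>?R. x = \<rho> * a)" if "x \<in> ?R" for x
    using that by blast
  show "\<rho> \<in> ?R" "\<rho> \<noteq> 0"
    using \<rho> ideal_subset subset_localize by auto
  show "inverse x \<in> ?R" if x: "x \<in> ?R" "red x \<noteq> 0" for x
  proof -
    obtain a b where ab: "a \<in> A" "b \<in> A" "b \<notin> \<pi>" "b \<noteq> 0" "x = a / b"
      using x by (auto elim: localizeE)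
    define k where "k = CARD('f) - 1"
    have k: "Suc k = CARD('f)"
      using finite_UNIV_card_ge_0[where 'a = 'f] by (simp add: k_def)
    have "k \<noteq> 0"
    proof
      assume "k = 0"
      then have "CARD('f) = 1"
        using k by simp
      then have "(0::'f) = 1"
        by (metis UNIV_I card_1_singletonE singletonD)
      then show False
        by simp
    qed
    have pow: "x ^ j \<in> ?R" "red (x ^ j) = red x ^ j" for j
      by (induction j) (simp_all add: one mult_localize x red_1 red_mult)
    \<comment> \<open>Every element of a finite field with \<open>Suc k\<close> elements is fixed by
      the power \<open>Suc k\<close>; cancelling \<open>red x\<close> gives exponent
      \<open>k\<close>.\<close>
    have "red x * red x ^ k = red x * 1"
      using finite_field_power_card_eq_same[of "red x"] by (simp flip: k)
    then have "red (x ^ k) = 1"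
      using x pow by simp
    moreover have "red (- 1) = - 1"
      using red_add[OF one uminus[OF one]] red_0[of 0] one uminus[OF one] red_1
        add_localize[OF one uminus[OF one]] by (simp add: eq_neg_iff_add_eq_0) (metis mult_zero_right add.commute)
    ultimately have "red (x ^ k + - 1) = 0"
      using red_add[OF pow(1) uminus[OF one]] by simp
    then obtain y where y: "y \<in> ?R" "x ^ k - 1 = \<rho> * y"
      using red_0[OF add_localize[OF pow(1) uminus[OF one]]] by auto
    obtain c s where cs: "c \<in> A" "s \<in> A" "s \<notin> \<pi>" "s \<noteq> 0" "y = c / s"
      using y by (auto elim: localizeE)
    have "a \<notin> \<pi>"
    proof
      assume a: "a \<in> \<pi>"
      have "s * b ^ k = s * a ^ k + - (c * b ^ k) * \<rho>"
        using y(2) ab cs by (simp add: field_simps)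
      moreover have "a ^ k \<in> \<pi>"
        using \<open>k \<noteq> 0\<close> a ab power_A mult_ideal[of "a ^ (k - 1)" a]
        by (metis power_minus_mult not_gr_zero)
      then have "s * a ^ k + - (c * b ^ k) * \<rho> \<in> \<pi>"
        using ab cs \<rho> by (intro add_ideal mult_ideal uminus_A mult_A power_A)
      ultimately have "s \<in> \<pi> \<or> b ^ k \<in> \<pi>"
        using prime_ideal cs ab power_A by metis
      then show False
        using cs ab power_ideal by blast
    qed
    then show ?thesis
      using ab localizeI[of b a] by simp
  qed
qed (rule add_localize mult_localize; assumption)+

end

theorem theorem4p5:
  fixes p t q :: nat and r :: int
    and \<xi> :: "rat alg_closure" and \<pi> R :: "rat alg_closure set"
    and red :: "rat alg_closure \<Rightarrow> 'f::finite_field" and \<beta> :: 'f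
  assumes "Factorial_Ring.prime p" and "p mod 4 = 3" and "t \<ge> 1"
    and q: "q = p ^ (2 * t)" and r: "r = (int q - 1) div 4"
    and card: "CARD('f) = q"
    and prim_root: "\<xi> ^ (q - 1) = 1" "\<And>k. 0 < k \<Longrightarrow> k < q - 1 \<Longrightarrow> \<xi> ^ k \<noteq> 1"
    and \<pi>: "primeideal \<pi> (subring_on (int_adjoin \<xi>))" "of_nat p \<in> \<pi>"
    and R: "R = localize_at (int_adjoin \<xi>) \<pi>"
    and red: "reduction_map R (of_nat p) red"
    and \<beta>: "\<beta> = red \<xi>"
  shows
    "has_elementary_divisors R (of_nat p) (mu_L \<beta>) (isotypic R \<xi> \<beta> 0) (isotypic R \<xi> \<beta> 0)
       {#0, 1, 1, of_nat p ^ t, of_nat p ^ t#} \<and>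
     (\<forall>i::int. 1 \<le> i \<and> i \<le> (int q - 5) div 4 \<longrightarrow>
       (let c = carries p t;
            A = [c i r, c (i + r) (3 * r), c (i + 2 * r) r, c (i + 3 * r) (3 * r)];
            B = [c i (3 * r), c (i + r) r, c (i + 2 * r) (3 * r), c (i + 3 * r) r]
        in \<forall>C. C \<in> {A, B} \<and> Min (set A \<union> set B) \<in> set C \<longrightarrow>
             has_elementary_divisors R (of_nat p) (mu_L \<beta>) (isotypic R \<xi> \<beta> i) (isotypic R \<xi> \<beta> i)
               (mset (map (\<lambda>e. of_nat p powi e) C))))"
proof -
  interpret prime_of_subring "int_adjoin \<xi>" \<pi>
    by (rule prime_of_subring.intro[OF \<pi>(1)])
  have p: "p > 2"
    using \<open>p mod 4 = 3\<close> by presburger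
  interpret P: residue_dvr R red "of_nat p"
    unfolding R using red \<pi>(2) p by (intro residue_dvr_localize) (auto simp: R)
  have "p ^ 1 \<le> p ^ (2 * t)"
    using p \<open>t \<ge> 1\<close> by (intro power_increasing) auto
  then have q2: "q > 2"
    using p q by simp
  have xi: "\<xi> \<in> R"
    unfolding R using subset_localize int_adjoin_generator by blast
  interpret P: peisert R red p t q \<xi> \<beta>
    using assms q2 xi by unfold_locales auto
  have r_eq: "r = P.r"
    by (simp add: r P.r_def P.m_def)
  have carries: "carries p t a b = int (P.V a b)" for a b
    by (rule P.carries_eq_V) simp
  show ?thesis
  proof (intro conjI allI impI)
    show "has_elementary_divisors R (of_nat p) (mu_L \<beta>) (isotypic R \<xi> \<beta> 0) (isotypic R \<xi> \<beta> 0)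
       {#0, 1, 1, of_nat p ^ t, of_nat p ^ t#}"
      by (rule P.elementary_divisors_isotypic_0)
  next
    fix i :: int assume "1 \<le> i \<and> i \<le> (int q - 5) div 4"
    \<comment> \<open>\<open>(q - 5) div 4\<close> is \<open>r - 1\<close>.\<close>
    then have i: "0 < i" "i < r"
      using r by presburger+
    define A where "A = [P.V i r, P.V (i + r) (3 * r), P.V (i + 2 * r) r, P.V (i + 3 * r) (3 * r)]"
    define B where "B = [P.V i (3 * r), P.V (i + r) r, P.V (i + 2 * r) (3 * r), P.V (i + 3 * r) r]"
    \<comment> \<open>Both lists may attain the minimum; the claim is proved for each list that
      does.\<close>
    have "has_elementary_divisors R (of_nat p) (mu_L \<beta>) (isotypic R \<xi> \<beta> i) (isotypic R \<xi> \<beta> i)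
        (mset (map (\<lambda>e. of_nat p powi e) C))"
      if C: "C \<in> {map int A, map int B}" "Min (set (map int A) \<union> set (map int B)) \<in> set C" for C
    proof -
      obtain ks where ks: "ks = A \<or> ks = B" "C = map int ks"
        using C(1) by blast
      obtain x where x: "x \<in> set ks" "Min (set (map int A) \<union> set (map int B)) = int x"
        using C(2) by (auto simp: ks(2))
      have "x \<le> y" if "y \<in> set A \<union> set B" for y
      proof -
        have "Min (set (map int A) \<union> set (map int B)) \<le> int y"
          using that by (intro Min_le) auto
        then show ?thesis
          unfolding x(2) by simp
      qed
      then have "has_elementary_divisors R (of_nat p) (mu_L \<beta>) (isotypic R \<xi> \<beta> i) (isotypic R \<xi> \<beta> i)
          (mset (map (\<lambda>k. of_nat p ^ k) ks))"
        using P.elementary_divisors_isotypic[of i ks x] i ks(1) x(1) unfolding r_eq A_def B_def by blast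
      then show ?thesis
        by (simp add: ks(2) comp_def)
    qed
    moreover have "map int A = [int (P.V i r), int (P.V (i + r) (3 * r)), int (P.V (i + 2 * r) r), int (P.V (i + 3 * r) (3 * r))]"
      "map int B = [int (P.V i (3 * r)), int (P.V (i + r) r), int (P.V (i + 2 * r) (3 * r)), int (P.V (i + 3 * r) r)]"
      by (simp_all add: A_def B_def)
    ultimately show "let c = carries p t;
            A = [c i r, c (i + r) (3 * r), c (i + 2 * r) r, c (i + 3 * r) (3 * r)];
            B = [c i (3 * r), c (i + r) r, c (i + 2 * r) (3 * r), c (i + 3 * r) r]
        in \<forall>C. C \<in> {A, B} \<and> Min (set A \<union> set B) \<in> set C \<longrightarrow>
             has_elementary_divisors R (of_nat p) (mu_L \<beta>) (isotypic R \<xi> \<beta> i) (isotypic R \<xi> \<beta> i)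
               (mset (map (\<lambda>e. of_nat p powi e) C))"
      unfolding Let_def carries by (metis (no_types, lifting))
  qed
qed

end
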